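(* Let $n\geq 5$ be odd and let $S:=S^{(n-2,1^2)}_{\mathbb{Z}_2}$, with $\mathbb{Z}_2$-basis $\{b(i_1,i_2):2\le i_1<i_2\le n\}$. Let $$S_1:=\left\{\sum_{2\leq i_1<i_2\leq n}\alpha(i_1,i_2) b(i_1,i_2): \alpha(i_1,i_2)\in\mathbb{Z}_2,\ \sum_{2\leq i_1<i_2\leq n}\alpha(i_1,i_2)\equiv 0\pmod{2} \right\},$$ $$S_2:=\left\{ \sum_{2\leq i_1<i_2\leq n} \alpha(i_1,i_2)b(i_1,i_2): \alpha(i_1,i_2)\in\mathbb{Z}_2,\ \alpha(i_1,i_2)\equiv \alpha (n-1,n)\pmod{2}\text{ for all } i_1,i_2 \right\},$$ which are $\mathbb{Z}_2\mathfrak{S}_n$-sublattices of $S$. Then $S$, $S_1$ and $S_2$ are representatives of the isomorphism classes of $\mathbb{Z}_2$-forms of the Specht $\mathbb{Q}_2\mathfrak{S}_n$-module $S^{(n-2,1^2)}_{\mathbb{Q}_2}$.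
   Context: $\mathbb{Z}_2$ denotes the $2$-adic integers and $\mathbb{Q}_2$ the $2$-adic numbers. A $\mathbb{Z}_2$-form of a $\mathbb{Q}_2\mathfrak{S}_n$-module $V$ is a $\mathbb{Z}_2\mathfrak{S}_n$-module $M$, finitely generated and free over $\mathbb{Z}_2$, with $\mathbb{Q}_2\otimes_{\mathbb{Z}_2}M\cong V$. Representatives: pairwise non-isomorphic, and every $\mathbb{Z}_2$-form is isomorphic to one of them. For a principal ideal domain $R$, let $\mathfrak{S}_n$ permute the basis $\mathbf{1},\ldots,\mathbf{n}$ of the natural permutation lattice $M^{(n-1,1)}_R$; the natural Specht lattice is $S^{(n-1,1)}_R=\{\sum a_i\mathbf{i}:\sum a_i=0\}$, and the Specht lattice $S^{(n-2,1^2)}_R$ is identified with $\bigwedge^2(S^{(n-1,1)}_R)$ (diagonal action), with $R$-basis $b(i_1,i_2):=(\mathbf{i_1}-\mathbf{1})\wedge(\mathbf{i_2}-\mathbf{1})$, $2\le i_1<i_2\le n$. *)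

theory Defs
  imports
    "Jordan_Normal_Form.VS_Connect"
    "HOL-Algebra.AbelCoset"
    "HOL-Algebra.Sym_Groups"
    "HOL-Computational_Algebra.Fraction_Field"
    "HOL-Library.Poly_Mapping"
begin

section \<open>The 2-adic integers and the 2-adic numbers\<close>

text \<open>The 2-adic integers are the inverse limit of the rings of integers modulo \<open>2^k\<close>;
  the residue modulo \<open>2^k\<close> is represented by its remainder in \<open>{0..<2^k}\<close>.\<close>

typedef z2adic =
  "{x :: nat \<Rightarrow> int. \<forall>k. x k \<in> {0..<2 ^ k} \<and> x (Suc k) mod 2 ^ k = x k}"
  morphisms residue Abs_z2adic
  by (rule exI[of _ "\<lambda>_. 0"]) simp

setup_lifting type_definition_z2adic

lemma residue_mod: "residue x k mod 2 ^ k = residue x k"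
  using residue[of x] by (auto intro: mod_pos_pos_trivial)

lemma residue_0: "residue x 0 = 0"
  using residue_mod[of x 0] by simp

lemma residue_Suc: "residue x (Suc k) mod 2 ^ k = residue x k"
  using residue[of x] by auto

lemma mod_mod_power_Suc: "a mod (2 * 2 ^ k) mod 2 ^ k = a mod (2 ^ k :: int)"
  by (rule mod_mod_cancel) simp

lemma coherent_add: "a mod 2 ^ k = a' \<Longrightarrow> b mod 2 ^ k = b'
    \<Longrightarrow> (a + b) mod (2 * 2 ^ k) mod 2 ^ k = (a' + b') mod (2 ^ k :: int)"
  by (drule sym, drule sym) (simp only: mod_mod_power_Suc mod_add_eq)

lemma coherent_diff: "a mod 2 ^ k = a' \<Longrightarrow> b mod 2 ^ k = b'
    \<Longrightarrow> (a - b) mod (2 * 2 ^ k) mod 2 ^ k = (a' - b') mod (2 ^ k :: int)"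
  by (drule sym, drule sym) (simp only: mod_mod_power_Suc mod_diff_eq)

lemma coherent_minus: "a mod 2 ^ k = a'
    \<Longrightarrow> (- a) mod (2 * 2 ^ k) mod 2 ^ k = (- a') mod (2 ^ k :: int)"
  by (drule sym) (simp only: mod_mod_power_Suc mod_minus_eq)

lemma coherent_mult: "a mod 2 ^ k = a' \<Longrightarrow> b mod 2 ^ k = b'
    \<Longrightarrow> (a * b) mod (2 * 2 ^ k) mod 2 ^ k = (a' * b') mod (2 ^ k :: int)"
  by (drule sym, drule sym) (simp only: mod_mod_power_Suc mod_mult_eq)

lemma z2adic_eqI: "(\<And>k. residue x k = residue y k) \<Longrightarrow> x = y"
  by (simp add: residue_inject[symmetric] fun_eq_iff)

instantiation z2adic :: comm_ring_1
begin

lift_definition zero_z2adic :: z2adic is "\<lambda>_. 0" by simp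

lift_definition one_z2adic :: z2adic is "\<lambda>k. 1 mod 2 ^ k"
  by (intro CollectI allI conjI) (simp, simp only: power_Suc mod_mod_power_Suc)

lift_definition plus_z2adic :: "z2adic \<Rightarrow> z2adic \<Rightarrow> z2adic"
  is "\<lambda>x y k. (x k + y k) mod 2 ^ k"
  by (auto intro!: coherent_add)

lift_definition minus_z2adic :: "z2adic \<Rightarrow> z2adic \<Rightarrow> z2adic"
  is "\<lambda>x y k. (x k - y k) mod 2 ^ k"
  by (auto intro!: coherent_diff)

lift_definition uminus_z2adic :: "z2adic \<Rightarrow> z2adic"
  is "\<lambda>x k. (- x k) mod 2 ^ k"
  by (auto intro!: coherent_minus)

lift_definition times_z2adic :: "z2adic \<Rightarrow> z2adic \<Rightarrow> z2adic"
  is "\<lambda>x y k. (x k * y k) mod 2 ^ k"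
  by (auto intro!: coherent_mult)

instance
proof
  fix a b c :: z2adic
  show "a * b * c = a * (b * c)"
    by (rule z2adic_eqI) (simp add: times_z2adic.rep_eq mod_simps mult.assoc)
  show "a * b = b * a"
    by (rule z2adic_eqI) (simp add: times_z2adic.rep_eq mult.commute)
  show "1 * a = a"
    by (rule z2adic_eqI) (simp add: times_z2adic.rep_eq one_z2adic.rep_eq mod_simps residue_mod residue_0)
  show "a + b + c = a + (b + c)"
    by (rule z2adic_eqI) (simp add: plus_z2adic.rep_eq mod_simps add.assoc)
  show "a + b = b + a"
    by (rule z2adic_eqI) (simp add: plus_z2adic.rep_eq add.commute)
  show "0 + a = a"
    by (rule z2adic_eqI) (simp add: plus_z2adic.rep_eq zero_z2adic.rep_eq residue_mod)
  show "- a + a = 0"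
    by (rule z2adic_eqI)
      (simp add: plus_z2adic.rep_eq uminus_z2adic.rep_eq zero_z2adic.rep_eq mod_simps)
  show "a - b = a + - b"
    by (rule z2adic_eqI)
      (simp add: plus_z2adic.rep_eq uminus_z2adic.rep_eq minus_z2adic.rep_eq mod_simps)
  show "(a + b) * c = a * c + b * c"
    by (rule z2adic_eqI)
      (simp add: plus_z2adic.rep_eq times_z2adic.rep_eq mod_simps distrib_right)
  have "residue (0 :: z2adic) 1 \<noteq> residue 1 1"
    by (simp add: zero_z2adic.rep_eq one_z2adic.rep_eq)
  then show "(0 :: z2adic) \<noteq> 1" by auto
qed

end

lemma residue_add_mod: "residue x (k + l) mod 2 ^ k = residue x k"
proof (induction l)
  case 0
  show ?case by (simp add: residue_mod)
next
  case (Suc l)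
  have "residue x (k + l) mod 2 ^ k = residue x (Suc (k + l)) mod 2 ^ (k + l) mod 2 ^ k"
    by (simp only: residue_Suc)
  also have "\<dots> = residue x (Suc (k + l)) mod 2 ^ k"
    by (rule mod_mod_cancel) (simp add: le_imp_power_dvd)
  finally show ?case using Suc.IH by simp
qed

lemma two_power_dvd_multD:
  fixes a b :: int
  assumes "2 ^ (k + l) dvd a * b"
  shows "2 ^ k dvd a \<or> 2 ^ l dvd b"
proof (cases "a = 0 \<or> b = 0")
  case True
  then show ?thesis by auto
next
  case False
  have "prime (2 :: int)" by simp
  with False assms have "k + l \<le> multiplicity 2 a + multiplicity 2 b"
    by (metis mult_eq_0_iff not_prime_unit power_dvd_iff_le_multiplicity
        prime_elem_multiplicity_mult_distrib prime_imp_prime_elem)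
  then show ?thesis
    using multiplicity_dvd' [of k 2 a] multiplicity_dvd' [of l 2 b] by linarith
qed

instance z2adic :: idom
proof
  fix x y :: z2adic
  assume "x \<noteq> 0" "y \<noteq> 0"
  then obtain k l where "residue x k \<noteq> 0" "residue y l \<noteq> 0"
    using z2adic_eqI[of x 0] z2adic_eqI[of y 0] by (auto simp: zero_z2adic.rep_eq)
  then have "\<not> 2 ^ k dvd residue x (k + l)" "\<not> 2 ^ l dvd residue y (k + l)"
    using residue_add_mod[of x k l] residue_add_mod[of y l k]
    by (auto simp: dvd_eq_mod_eq_0 add.commute)
  then have "residue x (k + l) * residue y (k + l) mod 2 ^ (k + l) \<noteq> 0"
    using two_power_dvd_multD by (auto simp: dvd_eq_mod_eq_0[symmetric])
  then have "residue (x * y) (k + l) \<noteq> residue 0 (k + l)"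
    by (simp add: times_z2adic.rep_eq zero_z2adic.rep_eq)
  then show "x * y \<noteq> 0" by auto
qed

type_synonym q2adic = "z2adic fract"


section \<open>Modules with a linear group action\<close>

text \<open>A module over the group ring of \<open>G\<close> over \<open>R\<close> is given as an \<open>R\<close>-module with a left action of
  \<open>G\<close> by \<open>R\<close>-linear maps. The fields \<open>mult\<close> and \<open>one\<close>, which the library's module record inherits
  from the ring record, play no role for modules and are set to \<open>undefined\<close>.\<close>

record ('r, 'g, 'm) gmod = "('r, 'm) module" +
  act :: "'g \<Rightarrow> 'm \<Rightarrow> 'm"

locale gmodule = Module.module R M + G: group G
  for R :: "('r, 'a) ring_scheme" and G :: "('g, 'b) monoid_scheme"
    and M :: "('r, 'g, 'm) gmod" +
  assumes act_linear: "g \<in> carrier G \<Longrightarrow> act M g \<in> LinearCombinations.module_hom R M M"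
    and act_one: "x \<in> carrier M \<Longrightarrow> act M \<one>\<^bsub>G\<^esub> x = x"
    and act_mult: "\<lbrakk>g \<in> carrier G; h \<in> carrier G; x \<in> carrier M\<rbrakk>
      \<Longrightarrow> act M (g \<otimes>\<^bsub>G\<^esub> h) x = act M g (act M h x)"

definition gmod_iso :: "('r, 'a) ring_scheme \<Rightarrow> ('g, 'b) monoid_scheme
    \<Rightarrow> ('r, 'g, 'm) gmod \<Rightarrow> ('r, 'g, 'n) gmod \<Rightarrow> bool"
  where "gmod_iso R G M N \<longleftrightarrow>
    (\<exists>f \<in> LinearCombinations.module_hom R M N. bij_betw f (carrier M) (carrier N) \<and>
      (\<forall>g \<in> carrier G. \<forall>x \<in> carrier M. f (act M g x) = act N g (f x)))"

definition gsublattice :: "('r, 'a) ring_scheme \<Rightarrow> ('g, 'b) monoid_scheme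
    \<Rightarrow> ('r, 'g, 'm) gmod \<Rightarrow> 'm set \<Rightarrow> bool"
  where "gsublattice R G M N \<longleftrightarrow> LinearCombinations.submodule R N M \<and>
    (\<forall>g \<in> carrier G. \<forall>x \<in> N. act M g x \<in> N)"

definition is_basis :: "('r, 'a) ring_scheme \<Rightarrow> ('r, 'm, 'c) module_scheme \<Rightarrow> 'm set \<Rightarrow> bool"
  where "is_basis R M B \<longleftrightarrow> B \<subseteq> carrier M \<and>
    \<not> LinearCombinations.module.lin_dep R M B \<and> LinearCombinations.module.span R M B = carrier M"

definition fin_gen :: "('r, 'a) ring_scheme \<Rightarrow> ('r, 'm, 'c) module_scheme \<Rightarrow> bool"
  where "fin_gen R M \<longleftrightarrow>
    (\<exists>X. finite X \<and> X \<subseteq> carrier M \<and> LinearCombinations.module.span R M X = carrier M)"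


section \<open>Free modules, quotients, tensor products and exterior squares\<close>

definition free_mod :: "'x set \<Rightarrow> ('r::comm_ring_1, 'x \<Rightarrow>\<^sub>0 'r) module"
  where "free_mod X = \<lparr> carrier = {f. Poly_Mapping.keys f \<subseteq> X},
    monoid.mult = undefined, one = undefined, zero = 0, add = (+),
    smult = (\<lambda>r. Poly_Mapping.map ((*) r)) \<rparr>"

text \<open>The linear map between free modules that sends the basis element \<open>x\<close> to the basis
  element \<open>\<phi> x\<close>.\<close>

definition free_map :: "('x \<Rightarrow> 'y) \<Rightarrow> ('x \<Rightarrow>\<^sub>0 'r::comm_ring_1) \<Rightarrow> ('y \<Rightarrow>\<^sub>0 'r)"
  where "free_map \<phi> f =
    (\<Sum>x \<in> Poly_Mapping.keys f. Poly_Mapping.single (\<phi> x) (Poly_Mapping.lookup f x))"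

text \<open>A map \<open>\<phi>\<close> with \<open>\<phi> ` K \<subseteq> K\<close> that is additive induces a map on cosets of \<open>K\<close>.\<close>

definition coset_map :: "('r, 'm, 'c) module_scheme \<Rightarrow> 'm set \<Rightarrow> ('m \<Rightarrow> 'm) \<Rightarrow> 'm set \<Rightarrow> 'm set"
  where "coset_map M K \<phi> C = (\<Union>x \<in> C. K +>\<^bsub>M\<^esub> \<phi> x)"

definition quot_mod :: "('r, 'm, 'c) module_scheme \<Rightarrow> 'm set \<Rightarrow> ('r, 'm set) module"
  where "quot_mod M K = \<lparr> carrier = a_rcosets\<^bsub>M\<^esub> K,
    monoid.mult = undefined, one = undefined, zero = K, add = set_add M,
    smult = (\<lambda>r. coset_map M K (\<lambda>x. r \<odot>\<^bsub>M\<^esub> x)) \<rparr>"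

definition bilinear_rels :: "('r::comm_ring_1, 'm, 'c) module_scheme
    \<Rightarrow> ('r, 'n, 'd) module_scheme \<Rightarrow> ('m \<times> 'n \<Rightarrow>\<^sub>0 'r) set"
  where "bilinear_rels M N = (let e = (\<lambda>x y. Poly_Mapping.single (x, y) 1) in
      {e (x \<oplus>\<^bsub>M\<^esub> x') y - e x y - e x' y | x x' y.
        x \<in> carrier M \<and> x' \<in> carrier M \<and> y \<in> carrier N}
    \<union> {e x (y \<oplus>\<^bsub>N\<^esub> y') - e x y - e x y' | x y y'.
        x \<in> carrier M \<and> y \<in> carrier N \<and> y' \<in> carrier N}
    \<union> {e (r \<odot>\<^bsub>M\<^esub> x) y - Poly_Mapping.single (x, y) r | r x y.
        x \<in> carrier M \<and> y \<in> carrier N}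
    \<union> {e x (r \<odot>\<^bsub>N\<^esub> y) - Poly_Mapping.single (x, y) r | r x y.
        x \<in> carrier M \<and> y \<in> carrier N})"

definition tensor_kernel :: "('r::comm_ring_1, 'm, 'c) module_scheme
    \<Rightarrow> ('r, 'n, 'd) module_scheme \<Rightarrow> ('m \<times> 'n \<Rightarrow>\<^sub>0 'r) set"
  where "tensor_kernel M N =
    LinearCombinations.module.span class_ring (free_mod (carrier M \<times> carrier N)) (bilinear_rels M N)"

definition tensor_mod :: "('r::comm_ring_1, 'm, 'c) module_scheme
    \<Rightarrow> ('r, 'n, 'd) module_scheme \<Rightarrow> ('r, ('m \<times> 'n \<Rightarrow>\<^sub>0 'r) set) module"
  where "tensor_mod M N =
    quot_mod (free_mod (carrier M \<times> carrier N)) (tensor_kernel M N)"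

definition fract_mod :: "('r::idom, 'r fract) module"
  where "fract_mod = \<lparr> carrier = UNIV, monoid.mult = undefined, one = undefined,
    zero = 0, add = (+), smult = (\<lambda>r q. Fract r 1 * q) \<rparr>"

text \<open>Extension of scalars from an integral domain to its field of fractions: the tensor product
  of the field of fractions with \<open>M\<close>, scalars acting on the left and the group on the right factor.\<close>

definition extend_scalars :: "('r::idom, 'g, 'm) gmod
    \<Rightarrow> ('r fract, 'g, ('r fract \<times> 'm \<Rightarrow>\<^sub>0 'r) set) gmod"
  where "extend_scalars M =
    (let T = tensor_mod fract_mod M;
         F = free_mod (carrier fract_mod \<times> carrier M);
         K = tensor_kernel fract_mod M
     in \<lparr> carrier = carrier T, monoid.mult = undefined, one = undefined,
          zero = zero T, add = add T,
          smult = (\<lambda>q. coset_map F K (free_map (\<lambda>(a, x). (q * a, x)))),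
          act = (\<lambda>g. coset_map F K (free_map (\<lambda>(a, x). (a, act M g x)))) \<rparr>)"

definition ext2_kernel :: "('r::comm_ring_1, 'm, 'c) module_scheme \<Rightarrow> ('m \<times> 'm \<Rightarrow>\<^sub>0 'r) set"
  where "ext2_kernel M = LinearCombinations.module.span class_ring (free_mod (carrier M \<times> carrier M))
    (bilinear_rels M M \<union> {Poly_Mapping.single (x, x) 1 | x. x \<in> carrier M})"

definition wedge :: "('r::comm_ring_1, 'm, 'c) module_scheme \<Rightarrow> 'm \<Rightarrow> 'm \<Rightarrow> ('m \<times> 'm \<Rightarrow>\<^sub>0 'r) set"
  where "wedge M x y =
    a_r_coset (free_mod (carrier M \<times> carrier M) :: ('r, 'm \<times> 'm \<Rightarrow>\<^sub>0 'r) module)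
      (ext2_kernel M) (Poly_Mapping.single (x, y) 1)"

definition ext2 :: "('r::comm_ring_1, 'g, 'm) gmod \<Rightarrow> ('r, 'g, ('m \<times> 'm \<Rightarrow>\<^sub>0 'r) set) gmod"
  where "ext2 M =
    (let F = free_mod (carrier M \<times> carrier M);
         K = ext2_kernel M
     in Module.module.extend (quot_mod F K)
          \<lparr> act = (\<lambda>g. coset_map F K (free_map (\<lambda>(x, y). (act M g x, act M g y)))) \<rparr>)"


section \<open>Specht lattices\<close>

text \<open>The basis element written as a bold \<open>i\<close> in the natural permutation lattice is
  \<open>Poly_Mapping.single i 1\<close>.\<close>

definition perm_lattice :: "nat \<Rightarrow> ('r::comm_ring_1, nat \<Rightarrow> nat, nat \<Rightarrow>\<^sub>0 'r) gmod"
  where "perm_lattice n = Module.module.extend (free_mod {1..n}) \<lparr> act = free_map \<rparr>"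

definition nat_specht :: "nat \<Rightarrow> ('r::comm_ring_1, nat \<Rightarrow> nat, nat \<Rightarrow>\<^sub>0 'r) gmod"
  where "nat_specht n = (perm_lattice n)
    \<lparr> carrier := {f \<in> carrier (perm_lattice n). (\<Sum>i = 1..n. Poly_Mapping.lookup f i) = 0} \<rparr>"

definition specht :: "nat \<Rightarrow> ('r::comm_ring_1, nat \<Rightarrow> nat,
    ((nat \<Rightarrow>\<^sub>0 'r) \<times> (nat \<Rightarrow>\<^sub>0 'r) \<Rightarrow>\<^sub>0 'r) set) gmod"
  where "specht n = ext2 (nat_specht n)"

definition specht_idx :: "nat \<Rightarrow> (nat \<times> nat) set"
  where "specht_idx n = {(i, j). 2 \<le> i \<and> i < j \<and> j \<le> n}"

definition specht_b :: "nat \<Rightarrow> nat \<times> nat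
    \<Rightarrow> ((nat \<Rightarrow>\<^sub>0 'r::comm_ring_1) \<times> (nat \<Rightarrow>\<^sub>0 'r) \<Rightarrow>\<^sub>0 'r) set"
  where "specht_b n = (\<lambda>(i, j). wedge (nat_specht n)
    (Poly_Mapping.single i 1 - Poly_Mapping.single 1 1)
    (Poly_Mapping.single j 1 - Poly_Mapping.single 1 1))"

definition specht_comb :: "nat \<Rightarrow> (nat \<times> nat \<Rightarrow> 'r::comm_ring_1)
    \<Rightarrow> ((nat \<Rightarrow>\<^sub>0 'r) \<times> (nat \<Rightarrow>\<^sub>0 'r) \<Rightarrow>\<^sub>0 'r) set"
  where "specht_comb n \<alpha> =
    (\<Oplus>\<^bsub>specht n\<^esub> p \<in> specht_idx n. \<alpha> p \<odot>\<^bsub>specht n\<^esub> specht_b n p)"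

definition S1_set :: "nat \<Rightarrow> ((nat \<Rightarrow>\<^sub>0 z2adic) \<times> (nat \<Rightarrow>\<^sub>0 z2adic) \<Rightarrow>\<^sub>0 z2adic) set set"
  where "S1_set n = {specht_comb n \<alpha> | \<alpha>. 2 dvd (\<Sum>p \<in> specht_idx n. \<alpha> p)}"

definition S2_set :: "nat \<Rightarrow> ((nat \<Rightarrow>\<^sub>0 z2adic) \<times> (nat \<Rightarrow>\<^sub>0 z2adic) \<Rightarrow>\<^sub>0 z2adic) set set"
  where "S2_set n =
    {specht_comb n \<alpha> | \<alpha>. \<forall>p \<in> specht_idx n. 2 dvd (\<alpha> p - \<alpha> (n - 1, n))}"


section \<open>Forms\<close>

definition is_Z2_form :: "('g, 'b) monoid_scheme \<Rightarrow> (q2adic, 'g, 'v) gmod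
    \<Rightarrow> (z2adic, 'g, 'm) gmod \<Rightarrow> bool"
  where "is_Z2_form G V M \<longleftrightarrow> gmodule class_ring G M \<and>
    fin_gen class_ring M \<and> (\<exists>B. is_basis class_ring M B) \<and>
    gmod_iso class_ring G (extend_scalars M) V"

end

theory Submission
  imports Defs "HOL-Computational_Algebra.Polynomial_Factorial" "HOL-Number_Theory.Cong"
    "HOL-Library.Function_Algebras"
begin

text \<open>The exterior square \<open>S\<close> is the lattice of alternating \<open>n \<times> n\<close> matrices with zero row sums, on which
  permutations act by permuting rows and columns; modulo 2 these are the graphs on \<open>n\<close> vertices with
  even degrees. Applying \<open>(1 - (s t)) (1 - (u w))\<close> to a matrix \<open>x\<close> gives a multiple of the oriented
  4-cycle through \<open>u, s, w, t\<close>, the factor being the alternating sum of \<open>x\<close> over the square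
  \<open>{u, w} \<times> {s, t}\<close>; and the 4-cycles span \<open>S1\<close>. If \<open>x\<close> is not in \<open>S2\<close>, some factor is odd, so an invariant
  lattice not contained in \<open>S2\<close> contains \<open>S1\<close>, which has index 2 in \<open>S\<close>. If \<open>x\<close> is in \<open>S2\<close> but not in
  \<open>2 S\<close>, its off-diagonal entries are odd and antisymmetry makes some factor twice a unit. An
  invariant lattice containing \<open>x\<close> then contains \<open>2 S1\<close>, and even \<open>2 S\<close> because \<open>x - (2 3) x = 2 y\<close>
  with \<open>y\<close> outside \<open>S1\<close>; so if it lies in \<open>S2\<close>, it equals \<open>S2\<close>.

  Every form embeds into the rational matrices and, after scaling, becomes an invariant sublattice of
  \<open>S\<close> not contained in \<open>2 S\<close>. Equivariant maps between the three lattices are scalars, whence they are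
  pairwise non-isomorphic.\<close>

section \<open>Arithmetic of the 2-adic integers\<close>

text \<open>That \<open>n\<close> is odd is what makes \<open>S2\<close> invariant. In a row
  \<open>i >= 2\<close> the \<open>n - 2\<close> entries outside columns 1 and \<open>i\<close>
  share a parity; as their number is odd, the zero row sum forces this parity on column 1 too. So
  \<open>S2\<close> consists of the matrices whose off-diagonal entries are all even or all odd, a
  condition that treats all vertices alike. The same count \<open>n - 2\<close> yields the odd
  factor for a matrix outside \<open>S2\<close>; the factor that is twice a unit comes from three
  squares on the vertices 1, 2, 3, 4.

  Exterior squares and tensor products are cosets in free modules on very large sets, where it is
  hard to see that an element is nonzero. In both cases an explicit linear map to matrices kills the
  relations, and a normal form modulo the relations shows that it kills nothing else. For an
  abstract form, the basis makes x -> 1 \<otimes> x injective, and finite generation provides a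
  common denominator.

  An isomorphism between two of the lattices is defined on a sublattice only; since 2 S lies in all
  three, composing it with multiplication by 2 gives an endomorphism of S, which is a
  scalar.\<close>

lemma residue_range: "0 \<le> residue x k" "residue x k < 2 ^ k"
  using residue[of x] by auto

lemma residue_le_mod: "k \<le> l \<Longrightarrow> residue x l mod 2 ^ k = residue x k"
  using residue_add_mod[of x k "l - k"] by simp

lemma z2adic_of_residues:
  assumes "\<And>k. x k \<in> {0..<2 ^ k}" "\<And>k. x (Suc k) mod 2 ^ k = x k"
  obtains y where "\<And>k. residue y k = x k"
proof
  show "residue (Abs_z2adic x) k = x k" for k
    using assms by (subst Abs_z2adic_inverse) auto
qed

lemma two_z2adic: "residue 2 k = 2 mod 2 ^ k"
proof -
  have "residue (1 + 1) k = 2 mod 2 ^ k"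
    by (simp only: plus_z2adic.rep_eq one_z2adic.rep_eq mod_simps) simp
  then show ?thesis by (simp only: one_add_one)
qed

text \<open>Halving an even residue modulo \<open>2 ^ (k + 1)\<close> gives a residue modulo
  \<open>2 ^ k\<close>, and the halves are again coherent, so they define the quotient by 2.\<close>

lemma two_dvd_iff_residue: "2 dvd (x :: z2adic) \<longleftrightarrow> residue x 1 = 0"
proof
  assume "2 dvd x"
  then show "residue x 1 = 0" by (auto simp: times_z2adic.rep_eq two_z2adic)
next
  assume 0: "residue x 1 = 0"
  have 1: "residue x (Suc k) div 2 \<in> {0..<2 ^ k}" for k
    using residue_range[of x "Suc k"] by auto
  have 2: "residue x (Suc (Suc k)) div 2 mod 2 ^ k = residue x (Suc k) div 2" for k
  proof -
    have "residue x (Suc k) = residue x (Suc (Suc k)) mod (2 * 2 ^ k)"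
      using residue_Suc[of x "Suc k"] by simp
    then show ?thesis by (simp add: zmod_zmult2_eq)
  qed
  obtain y where y: "\<And>k. residue y k = residue x (Suc k) div 2"
    using z2adic_of_residues[of "\<lambda>k. residue x (Suc k) div 2"] 1 2 by blast
  have ev: "even (residue x (Suc k))" for k
    using residue_le_mod[of 1 "Suc k" x] 0 by auto
  have "x = 2 * y"
  proof (rule z2adic_eqI)
    fix k
    show "residue x k = residue (2 * y) k"
      using ev[of k] residue_Suc[of x k]
      by (simp add: times_z2adic.rep_eq two_z2adic y mod_simps)
  qed
  then show "2 dvd x" by simp
qed

lemma residue_1_cases: "residue x 1 = 0 \<or> residue x 1 = 1"
  using residue_range[of x 1] by auto

text \<open>The residue field has two elements, so parity behaves as for integers and divisibility
  by 2 becomes propositional logic.\<close>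

lemma two_dvd_add_iff: "2 dvd (x + y :: z2adic) \<longleftrightarrow> (2 dvd x \<longleftrightarrow> 2 dvd y)"
  using residue_1_cases[of x] residue_1_cases[of y]
  by (auto simp: two_dvd_iff_residue plus_z2adic.rep_eq)

lemma two_dvd_diff_iff: "2 dvd (x - y :: z2adic) \<longleftrightarrow> (2 dvd x \<longleftrightarrow> 2 dvd y)"
  using residue_1_cases[of x] residue_1_cases[of y]
  by (auto simp: two_dvd_iff_residue minus_z2adic.rep_eq)

lemma two_dvd_mult_iff: "2 dvd (x * y :: z2adic) \<longleftrightarrow> 2 dvd x \<or> 2 dvd y"
  using residue_1_cases[of x] residue_1_cases[of y]
  by (auto simp: two_dvd_iff_residue times_z2adic.rep_eq)

lemma not_two_dvd_one: "\<not> 2 dvd (1 :: z2adic)"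
  by (simp add: two_dvd_iff_residue one_z2adic.rep_eq)

lemmas two_dvd_simps = two_dvd_add_iff two_dvd_diff_iff two_dvd_mult_iff not_two_dvd_one

lemma two_z2adic_nonzero: "(2 :: z2adic) \<noteq> 0"
proof
  assume "(2 :: z2adic) = 0"
  then have "residue 2 2 = residue 0 2" by simp
  then show False by (simp add: two_z2adic zero_z2adic.rep_eq)
qed

text \<open>An odd residue is invertible modulo each \<open>2 ^ k\<close>; inverses are unique, so
  those of consecutive levels are coherent and define a 2-adic inverse.\<close>

lemma odd_z2adic_unit:
  assumes "\<not> 2 dvd (x :: z2adic)"
  obtains y where "x * y = 1"
proof -
  have "coprime (residue x k) (2 ^ k)" for k
  proof (cases "k = 0")
    case False
    then have "odd (residue x k)"
      using residue_le_mod[of 1 k x] assms residue_1_cases[of x]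
      by (auto simp: two_dvd_iff_residue odd_iff_mod_2_eq_one)
    then show ?thesis by simp
  qed simp
  then have "\<exists>y. residue x k * y mod 2 ^ k = 1 mod 2 ^ k" for k
    using cong_solve_coprime_int[of "residue x k" "2 ^ k"] by (auto simp: cong_def)
  then obtain y0 where y0: "\<And>k. residue x k * y0 k mod 2 ^ k = 1 mod 2 ^ k" by metis
  define z where "z k = y0 k mod 2 ^ k" for k
  have z: "residue x k * z k mod 2 ^ k = 1 mod 2 ^ k" for k
    using y0[of k] by (simp add: z_def mod_simps)
  have "z (Suc k) mod 2 ^ k = z k" for k
  proof -
    have "residue x (Suc k) * z (Suc k) mod 2 ^ k = 1 mod 2 ^ k"
      using z[of "Suc k"] by (metis mod_mod_power_Suc power_Suc)
    then have "residue x k * z (Suc k) mod 2 ^ k = 1 mod 2 ^ k"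
      by (metis mod_mult_left_eq residue_Suc)
    then have a: "[residue x k * z (Suc k) = residue x k * z k] (mod 2 ^ k)"
      using z[of k] by (simp add: cong_def)
    then have "[z (Suc k) = z k] (mod 2 ^ k)"
      using cong_mult_lcancel[OF \<open>coprime (residue x k) (2 ^ k)\<close>] by blast
    then show ?thesis by (simp add: cong_def z_def)
  qed
  moreover have "z k \<in> {0..<2 ^ k}" for k by (simp add: z_def)
  ultimately obtain w where w: "\<And>k. residue w k = z k"
    using z2adic_of_residues[of z] by blast
  have "x * w = 1"
    by (rule z2adic_eqI) (simp add: times_z2adic.rep_eq one_z2adic.rep_eq w z)
  then show ?thesis using that by blast
qed

lemma residue_two_power_mult: "residue (2 ^ k * x) k = 0"
proof -
  have "residue (2 ^ l) k = 2 ^ l mod 2 ^ k" for l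
    by (induction l) (simp_all add: times_z2adic.rep_eq one_z2adic.rep_eq two_z2adic mod_simps)
  then show ?thesis by (simp add: times_z2adic.rep_eq)
qed

lemma z2adic_bounded_two_power_dvd:
  assumes "(x :: z2adic) \<noteq> 0"
  shows "\<exists>k. \<not> 2 ^ k dvd x"
proof -
  obtain k where "residue x k \<noteq> 0"
    using assms z2adic_eqI[of x 0] by (auto simp: zero_z2adic.rep_eq)
  then have "\<not> 2 ^ k dvd x" by (auto simp: residue_two_power_mult)
  then show ?thesis by blast
qed

section \<open>Transport of structure\<close>

definition gmod_hom :: "('r, 'a) ring_scheme \<Rightarrow> ('g, 'b) monoid_scheme
    \<Rightarrow> ('r, 'g, 'm) gmod \<Rightarrow> ('r, 'g, 'n) gmod \<Rightarrow> ('m \<Rightarrow> 'n) \<Rightarrow> bool"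
  where "gmod_hom R G M N f \<longleftrightarrow> f \<in> LinearCombinations.module_hom R M N \<and>
    (\<forall>g \<in> carrier G. \<forall>x \<in> carrier M. f (act M g x) = act N g (f x))"

lemma gmod_iso_iff:
  "gmod_iso R G M N \<longleftrightarrow> (\<exists>f. gmod_hom R G M N f \<and> bij_betw f (carrier M) (carrier N))"
  unfolding gmod_iso_def gmod_hom_def by auto

lemma gmod_homI:
  assumes "\<And>x. x \<in> carrier M \<Longrightarrow> f x \<in> carrier N"
    and "\<And>x y. x \<in> carrier M \<Longrightarrow> y \<in> carrier M \<Longrightarrow> f (x \<oplus>\<^bsub>M\<^esub> y) = f x \<oplus>\<^bsub>N\<^esub> f y"
    and "\<And>r x. r \<in> carrier R \<Longrightarrow> x \<in> carrier M \<Longrightarrow> f (r \<odot>\<^bsub>M\<^esub> x) = r \<odot>\<^bsub>N\<^esub> f x"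
    and "\<And>g x. g \<in> carrier G \<Longrightarrow> x \<in> carrier M \<Longrightarrow> f (act M g x) = act N g (f x)"
  shows "gmod_hom R G M N f"
  unfolding gmod_hom_def LinearCombinations.module_hom_def using assms by auto

lemma gmod_homD:
  assumes "gmod_hom R G M N f"
  shows "x \<in> carrier M \<Longrightarrow> f x \<in> carrier N"
    and "x \<in> carrier M \<Longrightarrow> y \<in> carrier M \<Longrightarrow> f (x \<oplus>\<^bsub>M\<^esub> y) = f x \<oplus>\<^bsub>N\<^esub> f y"
    and "r \<in> carrier R \<Longrightarrow> x \<in> carrier M \<Longrightarrow> f (r \<odot>\<^bsub>M\<^esub> x) = r \<odot>\<^bsub>N\<^esub> f x"
    and "g \<in> carrier G \<Longrightarrow> x \<in> carrier M \<Longrightarrow> f (act M g x) = act N g (f x)"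
  using assms unfolding gmod_hom_def LinearCombinations.module_hom_def by auto

lemma gmod_hom_comp:
  "gmod_hom R G M N f \<Longrightarrow> gmod_hom R G N P h \<Longrightarrow> gmod_hom R G M P (h \<circ> f)"
  by (rule gmod_homI) (simp_all add: gmod_homD)

lemma gmodule_closed:
  assumes "gmodule R G M"
  shows "x \<in> carrier M \<Longrightarrow> y \<in> carrier M \<Longrightarrow> x \<oplus>\<^bsub>M\<^esub> y \<in> carrier M"
    and "r \<in> carrier R \<Longrightarrow> x \<in> carrier M \<Longrightarrow> r \<odot>\<^bsub>M\<^esub> x \<in> carrier M"
    and "g \<in> carrier G \<Longrightarrow> x \<in> carrier M \<Longrightarrow> act M g x \<in> carrier M"
    and "\<zero>\<^bsub>M\<^esub> \<in> carrier M"
proof -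
  interpret M: gmodule R G M by fact
  show "x \<in> carrier M \<Longrightarrow> y \<in> carrier M \<Longrightarrow> x \<oplus>\<^bsub>M\<^esub> y \<in> carrier M" by simp
  show "r \<in> carrier R \<Longrightarrow> x \<in> carrier M \<Longrightarrow> r \<odot>\<^bsub>M\<^esub> x \<in> carrier M" by simp
  show "g \<in> carrier G \<Longrightarrow> x \<in> carrier M \<Longrightarrow> act M g x \<in> carrier M"
    using M.act_linear[of g] by (auto simp: LinearCombinations.module_hom_def)
  show "\<zero>\<^bsub>M\<^esub> \<in> carrier M" by simp
qed

lemma gmodule_act:
  assumes "gmodule R G M" "g \<in> carrier G"
  shows "x \<in> carrier M \<Longrightarrow> y \<in> carrier M \<Longrightarrow> act M g (x \<oplus>\<^bsub>M\<^esub> y) = act M g x \<oplus>\<^bsub>M\<^esub> act M g y"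
    and "r \<in> carrier R \<Longrightarrow> x \<in> carrier M \<Longrightarrow> act M g (r \<odot>\<^bsub>M\<^esub> x) = r \<odot>\<^bsub>M\<^esub> act M g x"
  using gmodule.act_linear[OF assms] by (auto simp: LinearCombinations.module_hom_def)

lemma gmod_iso_trans:
  "gmod_iso R G M N \<Longrightarrow> gmod_iso R G N P \<Longrightarrow> gmod_iso R G M P"
  unfolding gmod_iso_iff using gmod_hom_comp bij_betw_trans by metis

lemma gmod_iso_sym:
  assumes M: "gmodule R G M" and "gmod_iso R G M N"
  shows "gmod_iso R G N M"
proof -
  obtain f where hom: "gmod_hom R G M N f" and bij: "bij_betw f (carrier M) (carrier N)"
    using assms(2) by (auto simp: gmod_iso_iff)
  note f = gmod_homD[OF hom] bij
  define h where "h = inv_into (carrier M) f"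
  have hM: "h y \<in> carrier M" if "y \<in> carrier N" for y
    using f(5) that unfolding h_def by (metis bij_betw_imp_surj_on inv_into_into)
  have hf: "h (f x) = x" if "x \<in> carrier M" for x
    using f(5) that unfolding h_def by (metis bij_betw_inv_into_left)
  have fh: "f (h y) = y" if "y \<in> carrier N" for y
    using f(5) that unfolding h_def by (metis bij_betw_inv_into_right)
  note cl = gmodule_closed[OF M]
  have "gmod_hom R G N M h"
  proof (rule gmod_homI)
    show "h (x \<oplus>\<^bsub>N\<^esub> y) = h x \<oplus>\<^bsub>M\<^esub> h y" if "x \<in> carrier N" "y \<in> carrier N" for x y
      using that by (metis cl(1) f(2) fh hf hM)
    show "h (r \<odot>\<^bsub>N\<^esub> x) = r \<odot>\<^bsub>M\<^esub> h x" if "r \<in> carrier R" "x \<in> carrier N" for r x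
      using that by (metis cl(2) f(3) fh hf hM)
    show "h (act N g x) = act M g (h x)" if "g \<in> carrier G" "x \<in> carrier N" for g x
      using that by (metis cl(3) f(4) fh hf hM)
  qed (use hM in auto)
  moreover have "bij_betw h (carrier N) (carrier M)"
    unfolding h_def using f(5) by (rule bij_betw_inv_into)
  ultimately show ?thesis by (auto simp: gmod_iso_iff)
qed

text \<open>Each axiom can be checked after applying the injective map \<open>f\<close>. This spares
  verifying the axioms on cosets: the Specht lattice inherits them from matrices, and sublattices
  from the ambient module with \<open>f\<close> the identity.\<close>

lemma gmodule_transport:
  assumes N: "gmodule R G N"
    and hom: "gmod_hom R G M N f"
    and inj: "inj_on f (carrier M)"
    and zero: "f \<zero>\<^bsub>M\<^esub> = \<zero>\<^bsub>N\<^esub>"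
    and zero_closed: "\<zero>\<^bsub>M\<^esub> \<in> carrier M"
    and add_closed: "\<And>x y. x \<in> carrier M \<Longrightarrow> y \<in> carrier M \<Longrightarrow> x \<oplus>\<^bsub>M\<^esub> y \<in> carrier M"
    and smult_closed: "\<And>r x. r \<in> carrier R \<Longrightarrow> x \<in> carrier M \<Longrightarrow> r \<odot>\<^bsub>M\<^esub> x \<in> carrier M"
    and act_closed: "\<And>g x. g \<in> carrier G \<Longrightarrow> x \<in> carrier M \<Longrightarrow> act M g x \<in> carrier M"
  shows "gmodule R G M"
proof -
  interpret N: gmodule R G N by fact
  note cl = zero_closed add_closed smult_closed act_closed
  note hom = zero gmod_homD[OF hom]
  have eqI: "x = y" if "f x = f y" "x \<in> carrier M" "y \<in> carrier M" for x y
    using that inj by (auto dest: inj_onD)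
  have "Module.module R M"
  proof (rule module_criteria)
    show "cring R" by (rule N.R.is_cring)
    show "\<forall>v \<in> carrier M. \<exists>w \<in> carrier M. v \<oplus>\<^bsub>M\<^esub> w = \<zero>\<^bsub>M\<^esub>"
    proof
      fix v assume v: "v \<in> carrier M"
      \<comment> \<open>The additive inverse is obtained as a scalar multiple, because scalar
        multiplication is already known to stay in \<open>M\<close>.\<close>
      have "v \<oplus>\<^bsub>M\<^esub> (\<ominus>\<^bsub>R\<^esub> \<one>\<^bsub>R\<^esub> \<odot>\<^bsub>M\<^esub> v) = \<zero>\<^bsub>M\<^esub>"
        by (rule eqI) (simp_all add: v cl hom N.smult_l_minus N.M.r_neg)
      then show "\<exists>w \<in> carrier M. v \<oplus>\<^bsub>M\<^esub> w = \<zero>\<^bsub>M\<^esub>" using v by (metis smult_closed N.R.one_closed N.R.add.inv_closed)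
    qed
  qed (auto intro!: eqI simp: cl hom N.M.a_ac N.smult_assoc1 N.smult_l_distr N.smult_r_distr)
  then show ?thesis
  proof (rule gmodule.intro)
    show "group G" by (rule N.G.is_group)
    show "gmodule_axioms R G M"
    proof
      show "act M g \<in> LinearCombinations.module_hom R M M" if "g \<in> carrier G" for g
        using that unfolding LinearCombinations.module_hom_def
        by (auto intro!: eqI simp: cl hom gmodule_act[OF N])
      show "act M \<one>\<^bsub>G\<^esub> x = x" if "x \<in> carrier M" for x
        by (rule eqI) (simp_all add: that cl hom N.act_one)
      show "act M (g \<otimes>\<^bsub>G\<^esub> h) x = act M g (act M h x)"
        if "g \<in> carrier G" "h \<in> carrier G" "x \<in> carrier M" for g h x
        by (rule eqI) (simp_all add: that cl hom N.act_mult)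
    qed
  qed
qed

lemma gmodule_gsublattice:
  assumes "gmodule R G M" "gsublattice R G M X"
  shows "gmodule R G (M\<lparr>carrier := X\<rparr>)"
proof -
  have X: "LinearCombinations.submodule R X M" and a: "\<And>g x. g \<in> carrier G \<Longrightarrow> x \<in> X \<Longrightarrow> act M g x \<in> X"
    using assms(2) by (auto simp: gsublattice_def)
  interpret LinearCombinations.submodule R X M by (rule X)
  show ?thesis
    by (rule gmodule_transport[OF assms(1), of _ "\<lambda>x. x"])
      (use subset a in \<open>auto intro!: gmod_homI\<close>)
qed

lemma gsublatticeI:
  assumes "gmodule R G M" "X \<subseteq> carrier M" "\<zero>\<^bsub>M\<^esub> \<in> X"
    and "\<And>x y. x \<in> X \<Longrightarrow> y \<in> X \<Longrightarrow> x \<oplus>\<^bsub>M\<^esub> y \<in> X"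
    and "\<And>r x. r \<in> carrier R \<Longrightarrow> x \<in> X \<Longrightarrow> r \<odot>\<^bsub>M\<^esub> x \<in> X"
    and "\<And>g x. g \<in> carrier G \<Longrightarrow> x \<in> X \<Longrightarrow> act M g x \<in> X"
  shows "gsublattice R G M X"
  using assms gmodule.axioms(1)[OF assms(1)]
  unfolding gsublattice_def LinearCombinations.submodule_def by auto

section \<open>Bases from coordinate functions\<close>

text \<open>Functions \<open>c\<close> that are dual to the family \<open>e\<close> and separate
  points yield a finite basis at once, so no lattice below needs its own treatment of linear
  combinations.\<close>

locale coordinates = Module.module class_ring M
  for M :: "('r::comm_ring_1, 'm, 'c) module_scheme" +
  fixes I :: "'i set" and e :: "'i \<Rightarrow> 'm" and c :: "'m \<Rightarrow> 'i \<Rightarrow> 'r"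
  assumes finite_index: "finite I"
    and e_closed: "p \<in> I \<Longrightarrow> e p \<in> carrier M"
    and c_add: "x \<in> carrier M \<Longrightarrow> y \<in> carrier M \<Longrightarrow> p \<in> I \<Longrightarrow> c (x \<oplus>\<^bsub>M\<^esub> y) p = c x p + c y p"
    and c_smult: "x \<in> carrier M \<Longrightarrow> p \<in> I \<Longrightarrow> c (r \<odot>\<^bsub>M\<^esub> x) p = r * c x p"
    and c_e: "p \<in> I \<Longrightarrow> q \<in> I \<Longrightarrow> c (e p) q = (if p = q then 1 else 0)"
    and c_inj: "x \<in> carrier M \<Longrightarrow> (\<And>p. p \<in> I \<Longrightarrow> c x p = 0) \<Longrightarrow> x = \<zero>\<^bsub>M\<^esub>"
begin

lemma c_zero: "p \<in> I \<Longrightarrow> c \<zero>\<^bsub>M\<^esub> p = 0"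
  using c_add[of "\<zero>\<^bsub>M\<^esub>" "\<zero>\<^bsub>M\<^esub>" p] by simp

lemma c_finsum:
  assumes "q \<in> I" "finite A" "\<And>p. p \<in> A \<Longrightarrow> g p \<in> carrier M"
  shows "c (\<Oplus>\<^bsub>M\<^esub> p \<in> A. g p) q = (\<Sum>p \<in> A. c (g p) q)"
  using assms(2,3)
proof (induction A rule: finite_induct)
  case (insert p A)
  then have "(\<Oplus>\<^bsub>M\<^esub> p \<in> insert p A. g p) = g p \<oplus>\<^bsub>M\<^esub> (\<Oplus>\<^bsub>M\<^esub> p \<in> A. g p)"
    by (subst M.finsum_insert) auto
  with insert assms(1) show ?case
    by (simp add: c_add M.finsum_closed Pi_iff)
qed (simp add: c_zero assms(1))

lemma inj_e: "inj_on e I"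
proof
  fix p q assume *: "p \<in> I" "q \<in> I" "e p = e q"
  then have "(if p = p then 1 else 0 :: 'r) = (if q = p then 1 else 0)"
    using c_e[of p p] c_e[of q p] by simp
  then show "p = q" by (auto split: if_splits)
qed

lemma c_eqI:
  assumes x: "x \<in> carrier M" and y: "y \<in> carrier M" and "\<And>p. p \<in> I \<Longrightarrow> c x p = c y p"
  shows "x = y"
proof -
  have m: "(- 1) \<odot>\<^bsub>M\<^esub> y \<in> carrier M" using y by (intro smult_closed) auto
  have "x \<oplus>\<^bsub>M\<^esub> (- 1) \<odot>\<^bsub>M\<^esub> y = \<zero>\<^bsub>M\<^esub>"
    by (rule c_inj) (use assms m in \<open>auto simp: c_add c_smult\<close>)
  moreover have "y \<oplus>\<^bsub>M\<^esub> (- 1) \<odot>\<^bsub>M\<^esub> y = \<zero>\<^bsub>M\<^esub>"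
    by (rule c_inj) (use assms m in \<open>auto simp: c_add c_smult\<close>)
  ultimately show ?thesis using x y m by (metis M.add.m_comm M.add.inv_equality M.minus_minus)
qed

lemma c_comb: "q \<in> I \<Longrightarrow> c (\<Oplus>\<^bsub>M\<^esub> p \<in> I. a p \<odot>\<^bsub>M\<^esub> e p) q = a q"
  using finite_index e_closed
  by (simp add: c_finsum c_smult c_e if_distrib sum.delta cong: if_cong)

lemma comb_closed: "(\<Oplus>\<^bsub>M\<^esub> p \<in> I. a p \<odot>\<^bsub>M\<^esub> e p) \<in> carrier M"
  by (intro M.finsum_closed) (use e_closed in auto)

lemma expansion:
  assumes "x \<in> carrier M"
  shows "x = (\<Oplus>\<^bsub>M\<^esub> p \<in> I. c x p \<odot>\<^bsub>M\<^esub> e p)"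
  by (rule c_eqI) (simp_all add: assms comb_closed c_comb)

lemma span_e: "span (e ` I) = carrier M"
proof
  show "span (e ` I) \<subseteq> carrier M"
    using e_closed by (intro span_is_subset2) auto
  show "carrier M \<subseteq> span (e ` I)"
  proof
    fix x assume x: "x \<in> carrier M"
    define a where "a v = c x (inv_into I e v)" for v
    have "lincomb a (e ` I) = (\<Oplus>\<^bsub>M\<^esub> p \<in> I. a (e p) \<odot>\<^bsub>M\<^esub> e p)"
      unfolding lincomb_def
      by (rule M.add.finprod_reindex) (use e_closed inj_e in auto)
    also have "\<dots> = (\<Oplus>\<^bsub>M\<^esub> p \<in> I. c x p \<odot>\<^bsub>M\<^esub> e p)"
      by (rule M.finsum_cong') (use e_closed inj_e in \<open>auto simp: a_def\<close>)
    finally have "x = lincomb a (e ` I)" using expansion[OF x] by simp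
    then show "x \<in> span (e ` I)"
      unfolding span_def using finite_index by auto
  qed
qed

lemma lin_indpt_e: "lin_indpt (e ` I)"
proof
  assume "lin_dep (e ` I)"
  then obtain A a v where A: "finite A" "A \<subseteq> e ` I" "lincomb a A = \<zero>\<^bsub>M\<^esub>" "v \<in> A" "a v \<noteq> 0"
    unfolding lin_dep_def by auto
  obtain p where p: "p \<in> I" "v = e p" using A by auto
  have cl: "\<And>w. w \<in> A \<Longrightarrow> w \<in> carrier M" using A(2) e_closed by auto
  have "0 = c (lincomb a A) p" using A(3) p c_zero by simp
  also have "\<dots> = (\<Sum>w \<in> A. a w * c w p)"
    unfolding lincomb_def using A(1) p cl by (simp add: c_finsum c_smult)
  also have "\<dots> = (\<Sum>w \<in> A. if w = v then a v else 0)"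
    by (rule sum.cong) (use A(2) p inj_e in \<open>auto simp: c_e inj_on_eq_iff\<close>)
  also have "\<dots> = a v" using A by simp
  finally show False using A(5) by simp
qed

lemma is_basis_e: "is_basis class_ring M (e ` I)"
  unfolding is_basis_def using lin_indpt_e span_e e_closed by auto

lemma fin_gen_e: "fin_gen class_ring M"
  unfolding fin_gen_def using span_e e_closed finite_index by (intro exI[of _ "e ` I"]) auto

end

lemma coordinates_transport:
  fixes M :: "('r::comm_ring_1, 'g, 'm) gmod"
  assumes "coordinates N I e c" "Module.module class_ring M" "gmod_iso class_ring G M N"
  shows "\<exists>e c. coordinates M I e c"
proof -
  interpret N: coordinates N I e c by fact
  obtain f where hom: "gmod_hom class_ring G M N f" and bij: "bij_betw f (carrier M) (carrier N)"
    using assms(3) by (auto simp: gmod_iso_iff)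
  note f = gmod_homD(1-3)[OF hom] bij
  interpret M: Module.module class_ring M by fact
  have fi: "f (inv_into (carrier M) f y) = y" "inv_into (carrier M) f y \<in> carrier M"
    if "y \<in> carrier N" for y
    using that f(4) by (metis bij_betw_inv_into_right, metis bij_betw_imp_surj_on inv_into_into)
  have "coordinates M I (\<lambda>p. inv_into (carrier M) f (e p)) (\<lambda>x. c (f x))"
  proof
    fix x assume x: "x \<in> carrier M" "\<And>p. p \<in> I \<Longrightarrow> c (f x) p = 0"
    have "f x = \<zero>\<^bsub>N\<^esub>" by (rule N.c_inj) (use x f in auto)
    moreover have "f \<zero>\<^bsub>M\<^esub> = \<zero>\<^bsub>N\<^esub>"
      using f(1)[of "\<zero>\<^bsub>M\<^esub>"] f(2)[of "\<zero>\<^bsub>M\<^esub>" "\<zero>\<^bsub>M\<^esub>"] by simp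
    ultimately show "x = \<zero>\<^bsub>M\<^esub>" using f(4) x by (metis M.M.zero_closed bij_betw_def inj_onD)
  qed (use N.finite_index N.e_closed N.c_add N.c_smult N.c_e f fi in auto)
  then show ?thesis by blast
qed

section \<open>Free modules and their quotients\<close>

abbreviation scale :: "'r::comm_ring_1 \<Rightarrow> ('x \<Rightarrow>\<^sub>0 'r) \<Rightarrow> ('x \<Rightarrow>\<^sub>0 'r)"
  where "scale r \<equiv> Poly_Mapping.map ((*) r)"

lemma lookup_scale: "Poly_Mapping.lookup (scale r f) x = r * Poly_Mapping.lookup f x"
  by (simp add: map.rep_eq when_def)

lemma scale_simps [simp]:
  "scale r (Poly_Mapping.single x s) = Poly_Mapping.single x (r * s)"
  "scale r (f + g) = scale r f + scale r g"
  "scale r (f - g) = scale r f - scale r g"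
  "scale r (- f) = - scale r f"
  "scale r 0 = 0"
  "scale 1 f = f"
  "scale (- 1) f = - f"
  "scale r (scale s f) = scale (r * s) f"
  "scale (r + s) f = scale r f + scale s f"
  by (auto intro!: poly_mapping_eqI
      simp: lookup_scale lookup_add lookup_minus lookup_single when_def algebra_simps)

lemma keys_scale: "Poly_Mapping.keys (scale r f) \<subseteq> Poly_Mapping.keys f"
  by (auto simp: in_keys_iff lookup_scale)

lemma keys_add_subset: "Poly_Mapping.keys f \<subseteq> X \<Longrightarrow> Poly_Mapping.keys g \<subseteq> X \<Longrightarrow> Poly_Mapping.keys (f + g) \<subseteq> X"
  using keys_add[of f g] by auto

lemma keys_diff_subset:
  fixes f g :: "'x \<Rightarrow>\<^sub>0 'r::ab_group_add"
  shows "Poly_Mapping.keys f \<subseteq> X \<Longrightarrow> Poly_Mapping.keys g \<subseteq> X \<Longrightarrow> Poly_Mapping.keys (f - g) \<subseteq> X"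
  using keys_diff[of f g] by auto

lemma keys_single_subset: "x \<in> X \<Longrightarrow> Poly_Mapping.keys (Poly_Mapping.single x r) \<subseteq> X"
  by auto

lemmas keys_subset_intros = keys_add_subset keys_diff_subset keys_single_subset

lemma poly_mapping_expansion:
  "f = (\<Sum>x \<in> Poly_Mapping.keys f. Poly_Mapping.single x (Poly_Mapping.lookup f x))"
  by (rule poly_mapping_eqI)
    (auto simp: lookup_sum lookup_single when_def in_keys_iff sum.delta cong: if_cong)

lemma free_induct [consumes 1, case_names zero single add]:
  fixes f :: "'x \<Rightarrow>\<^sub>0 'r::comm_ring_1"
  assumes "Poly_Mapping.keys f \<subseteq> X" and "P 0"
    and "\<And>x r. x \<in> X \<Longrightarrow> P (Poly_Mapping.single x r)"
    and "\<And>f g. Poly_Mapping.keys f \<subseteq> X \<Longrightarrow> Poly_Mapping.keys g \<subseteq> X \<Longrightarrow> P f \<Longrightarrow> P g \<Longrightarrow> P (f + g)"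
  shows "P f"
proof -
  have "P (\<Sum>x \<in> A. Poly_Mapping.single x (c x)) \<and>
      Poly_Mapping.keys (\<Sum>x \<in> A. Poly_Mapping.single x (c x)) \<subseteq> X"
    if "finite A" "A \<subseteq> X" for A and c
    using that
  proof (induction A rule: finite_induct)
    case (insert x A)
    then show ?case
      using assms(3)[of x] by (auto intro!: assms(4) keys_add_subset del: subsetI)
  qed (simp add: assms(2))
  then show ?thesis
    using assms(1) by (subst poly_mapping_expansion) auto
qed

text \<open>Here \<open>h x r\<close> is the value on \<open>r\<close> times the basis element \<open>x\<close>.\<close>

definition free_ext :: "('x \<Rightarrow> 'r \<Rightarrow> 'c) \<Rightarrow> ('x \<Rightarrow>\<^sub>0 'r::comm_ring_1) \<Rightarrow> 'c::ab_group_add"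
  where "free_ext h f = (\<Sum>x \<in> Poly_Mapping.keys f. h x (Poly_Mapping.lookup f x))"

locale free_extension =
  fixes h :: "'x \<Rightarrow> 'r::comm_ring_1 \<Rightarrow> 'c::ab_group_add"
  assumes h_add: "h x (r + s) = h x r + h x s"
begin

lemma h_zero: "h x 0 = 0"
  using h_add[of x 0 0] by simp

lemma ext_superset:
  assumes "finite A" "Poly_Mapping.keys f \<subseteq> A"
  shows "free_ext h f = (\<Sum>x \<in> A. h x (Poly_Mapping.lookup f x))"
  unfolding free_ext_def using assms h_zero
  by (intro sum.mono_neutral_left) (auto simp: in_keys_iff)

lemma ext_zero: "free_ext h 0 = 0"
  by (simp add: free_ext_def)

lemma ext_single: "free_ext h (Poly_Mapping.single x r) = h x r"
  by (simp add: free_ext_def h_zero)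

lemma ext_add: "free_ext h (f + g) = free_ext h f + free_ext h g"
proof -
  let ?A = "Poly_Mapping.keys f \<union> Poly_Mapping.keys g"
  have "free_ext h (f + g) = (\<Sum>x \<in> ?A. h x (Poly_Mapping.lookup (f + g) x))"
    by (rule ext_superset) (auto dest: subsetD[OF keys_add])
  then show ?thesis
    by (simp add: ext_superset[of ?A] lookup_add h_add sum.distrib)
qed

lemma ext_diff: "free_ext h (f - g) = free_ext h f - free_ext h g"
  using ext_add[of "f - g" g] by (simp add: eq_diff_eq)

lemma ext_scale:
  assumes u: "\<And>a b. u (a + b) = u a + u b" and "\<And>x s. h x (r * s) = u (h x s)"
  shows "free_ext h (scale r f) = u (free_ext h f)"
proof -
  have "u 0 = 0" using u[of 0 0] by simp
  with subset_UNIV show ?thesis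
    by (induction f rule: free_induct) (simp_all add: ext_zero ext_single ext_add assms)
qed

lemma ext_mem:
  assumes "Poly_Mapping.keys f \<subseteq> X" "0 \<in> A" "\<And>a b. a \<in> A \<Longrightarrow> b \<in> A \<Longrightarrow> a + b \<in> A"
    and "\<And>x r. x \<in> X \<Longrightarrow> h x r \<in> A"
  shows "free_ext h f \<in> A"
  using assms by (induction f rule: free_induct) (simp_all add: ext_zero ext_single ext_add)

end

interpretation free_map: free_extension "\<lambda>x. Poly_Mapping.single (\<phi> x)"
  rewrites "free_ext (\<lambda>x. Poly_Mapping.single (\<phi> x)) = free_map \<phi>"
  by unfold_locales (simp_all add: single_add free_map_def free_ext_def fun_eq_iff)

lemma free_map_scale: "free_map \<phi> (scale r f) = scale r (free_map \<phi> f)"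
  by (rule free_map.ext_scale) simp_all

lemma keys_free_map:
  assumes "Poly_Mapping.keys f \<subseteq> X" "\<And>x. x \<in> X \<Longrightarrow> \<phi> x \<in> Y"
  shows "Poly_Mapping.keys (free_map \<phi> f) \<subseteq> Y"
  using free_map.ext_mem[OF assms(1), of "{f. Poly_Mapping.keys f \<subseteq> Y}" \<phi>] assms(2)
  by (simp add: keys_add_subset)

lemma (in free_extension) ext_free_map:
  assumes "Poly_Mapping.keys f \<subseteq> X" and u: "\<And>a b. u (a + b) = u a + u b"
    and "\<And>x r. x \<in> X \<Longrightarrow> h (\<phi> x) r = u (h x r)"
  shows "free_ext h (free_map \<phi> f) = u (free_ext h f)"
proof -
  have "u 0 = 0" using u[of 0 0] by simp
  with assms(1) show ?thesis
    by (induction f rule: free_induct)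
      (simp_all add: free_map.ext_zero free_map.ext_single free_map.ext_add ext_zero ext_single ext_add assms)
qed

lemma free_mod_simps:
  "carrier (free_mod X) = {f. Poly_Mapping.keys f \<subseteq> X}" "\<zero>\<^bsub>free_mod X\<^esub> = 0"
  "f \<oplus>\<^bsub>free_mod X\<^esub> g = f + g" "r \<odot>\<^bsub>free_mod X\<^esub> f = scale r f"
  by (simp_all add: free_mod_def)

lemma free_mod_module: "Module.module class_ring (free_mod X)"
proof (rule module_criteria)
  show "\<forall>v \<in> carrier (free_mod X). \<exists>w \<in> carrier (free_mod X). v \<oplus>\<^bsub>free_mod X\<^esub> w = \<zero>\<^bsub>free_mod X\<^esub>"
  proof
    fix v assume "v \<in> carrier (free_mod X)"
    then show "\<exists>w \<in> carrier (free_mod X). v \<oplus>\<^bsub>free_mod X\<^esub> w = \<zero>\<^bsub>free_mod X\<^esub>"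
      by (intro bexI[of _ "- v"]) (auto simp: free_mod_simps)
  qed
qed (auto simp: free_mod_simps class_cring.is_cring add_ac
    dest: subsetD[OF keys_add] subsetD[OF keys_scale])

text \<open>Common ground of the exterior square and the tensor product, which differ only in the
  index set \<open>X\<close> and the relations \<open>Rl\<close>.\<close>

locale free_quotient =
  fixes X :: "'x set" and Rl :: "('x \<Rightarrow>\<^sub>0 'r::comm_ring_1) set" and K :: "('x \<Rightarrow>\<^sub>0 'r) set"
  assumes relations: "\<And>f. f \<in> Rl \<Longrightarrow> Poly_Mapping.keys f \<subseteq> X"
    and K_span: "K = LinearCombinations.module.span class_ring (free_mod X) Rl"
begin

sublocale F: Module.module class_ring "free_mod X :: ('r, 'x \<Rightarrow>\<^sub>0 'r) module"
  by (rule free_mod_module)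

lemma Rl_subset: "Rl \<subseteq> carrier (free_mod X)"
  using relations by (auto simp: free_mod_simps)

lemma K_submodule: "LinearCombinations.submodule class_ring K (free_mod X)"
  unfolding K_span by (rule F.span_is_submodule[OF Rl_subset])

lemma K_zero: "0 \<in> K"
  using K_submodule unfolding LinearCombinations.submodule_def by (auto simp: free_mod_simps)

lemma K_add: "f \<in> K \<Longrightarrow> g \<in> K \<Longrightarrow> f + g \<in> K"
  using K_submodule unfolding LinearCombinations.submodule_def by (auto simp: free_mod_simps)

lemma K_scale: "f \<in> K \<Longrightarrow> scale r f \<in> K"
  using K_submodule unfolding LinearCombinations.submodule_def by (auto simp: free_mod_simps)

lemma K_minus: "f \<in> K \<Longrightarrow> - f \<in> K"
  using K_scale[of f "- 1"] by simp

lemma K_diff: "f \<in> K \<Longrightarrow> g \<in> K \<Longrightarrow> f - g \<in> K"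
  using K_add[of f "- g"] K_minus[of g] by simp

lemma K_rel: "f \<in> Rl \<Longrightarrow> f \<in> K"
  unfolding K_span using F.in_own_span[OF Rl_subset] by auto

text \<open>The elements of the free module that satisfy \<open>P\<close> form a submodule
  containing \<open>Rl\<close>, and the span is the least such.\<close>

lemma K_induct [consumes 1, case_names zero rel add scale]:
  assumes "f \<in> K" "P 0" "\<And>f. f \<in> Rl \<Longrightarrow> P f"
    and "\<And>f g. P f \<Longrightarrow> P g \<Longrightarrow> P (f + g)" "\<And>r f. P f \<Longrightarrow> P (scale r f)"
  shows "P f"
proof -
  have "LinearCombinations.submodule class_ring {f \<in> carrier (free_mod X). P f} (free_mod X)"
    unfolding LinearCombinations.submodule_def using free_mod_module assms(2,4,5)
    by (auto simp: free_mod_simps dest: subsetD[OF keys_add] subsetD[OF keys_scale])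
  moreover have "Rl \<subseteq> {f \<in> carrier (free_mod X). P f}"
    using Rl_subset assms(3) by auto
  ultimately have "K \<subseteq> {f \<in> carrier (free_mod X). P f}"
    unfolding K_span by (rule F.span_is_subset[rotated])
  then show ?thesis using assms(1) by auto
qed

definition cls :: "('x \<Rightarrow>\<^sub>0 'r) \<Rightarrow> ('x \<Rightarrow>\<^sub>0 'r) set"
  where "cls f = a_r_coset (free_mod X) K f"

lemma mem_cls: "g \<in> cls f \<longleftrightarrow> g - f \<in> K"
  unfolding cls_def a_r_coset_def' by (auto simp: free_mod_simps intro: bexI[of _ "g - f"])

lemma cls_self: "f \<in> cls f"
  by (simp add: mem_cls K_zero)

lemma cls_eq_iff: "cls f = cls g \<longleftrightarrow> f - g \<in> K"
proof
  assume "cls f = cls g"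
  then show "f - g \<in> K" using cls_self[of f] mem_cls by blast
next
  assume *: "f - g \<in> K"
  have "h - f \<in> K \<longleftrightarrow> h - g \<in> K" for h
    using K_add[OF _ *, of "h - f"] K_diff[OF _ *, of "h - g"] by auto
  then show "cls f = cls g" by (auto simp: mem_cls)
qed

lemma cls_zero: "cls 0 = K"
  by (auto simp: mem_cls)

lemma carrier_quot: "a_rcosets\<^bsub>free_mod X\<^esub> K = cls ` {f. Poly_Mapping.keys f \<subseteq> X}"
  unfolding A_RCOSETS_def' cls_def by (auto simp: free_mod_simps)

lemma set_add_cls: "set_add (free_mod X) (cls f) (cls g) = cls (f + g)"
proof (intro Set.set_eqI iffI)
  fix h assume "h \<in> set_add (free_mod X) (cls f) (cls g)"
  then obtain a b where "h = a + b" "a - f \<in> K" "b - g \<in> K"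
    unfolding set_add_def' by (auto simp: free_mod_simps mem_cls)
  then show "h \<in> cls (f + g)"
    using K_add[of "a - f" "b - g"] by (simp add: mem_cls algebra_simps)
next
  fix h assume "h \<in> cls (f + g)"
  then have "h - g \<in> cls f" by (simp add: mem_cls algebra_simps)
  then show "h \<in> set_add (free_mod X) (cls f) (cls g)"
    unfolding set_add_def' using cls_self[of g]
    by (intro UN_I[of "h - g"] UN_I[of g]) (simp_all add: free_mod_simps)
qed

text \<open>All members of a coset have images in one and the same coset, so the union in
  \<open>coset_map\<close> runs over equal sets.\<close>

lemma coset_map_cls:
  assumes "\<And>f g. \<phi> (f - g) = \<phi> f - \<phi> g" "\<And>f. f \<in> K \<Longrightarrow> \<phi> f \<in> K"
  shows "coset_map (free_mod X) K \<phi> (cls f) = cls (\<phi> f)"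
proof -
  have "cls (\<phi> g) = cls (\<phi> f)" if "g \<in> cls f" for g
    using that assms(2)[of "g - f"] by (simp add: mem_cls cls_eq_iff assms(1))
  moreover have "f \<in> cls f" by (rule cls_self)
  ultimately show ?thesis unfolding coset_map_def cls_def[symmetric] by blast
qed

lemma coset_map_scale: "coset_map (free_mod X) K (\<lambda>x. r \<odot>\<^bsub>free_mod X\<^esub> x) (cls f) = cls (scale r f)"
  unfolding free_mod_simps by (rule coset_map_cls) (simp_all add: K_scale)

lemma free_map_K:
  assumes "\<And>f. f \<in> Rl \<Longrightarrow> free_map \<phi> f \<in> K"
  shows "f \<in> K \<Longrightarrow> free_map \<phi> f \<in> K"
  by (induction f rule: K_induct) (simp_all add: free_map.ext_zero free_map.ext_add free_map_scale K_zero K_add K_scale assms)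

lemma coset_map_free_map:
  assumes "\<And>f. f \<in> Rl \<Longrightarrow> free_map \<phi> f \<in> K"
  shows "coset_map (free_mod X) K (free_map \<phi>) (cls f) = cls (free_map \<phi> f)"
  by (rule coset_map_cls) (simp_all add: free_map.ext_diff free_map_K assms)

text \<open>An arbitrary representative is chosen; \<open>descend_cls\<close> removes the choice for
  maps that are constant on cosets.\<close>

definition descend :: "(('x \<Rightarrow>\<^sub>0 'r) \<Rightarrow> 'c) \<Rightarrow> ('x \<Rightarrow>\<^sub>0 'r) set \<Rightarrow> 'c"
  where "descend \<Phi> C = \<Phi> (SOME f. f \<in> C)"

lemma descend_cls:
  assumes "\<And>f g. f - g \<in> K \<Longrightarrow> \<Phi> f = \<Phi> g"
  shows "descend \<Phi> (cls f) = \<Phi> f"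
  unfolding descend_def using someI[of "\<lambda>g. g \<in> cls f" f] cls_self[of f]
  by (intro assms) (simp add: mem_cls)

end

section \<open>Alternating matrices with zero row sums\<close>

abbreviation pinv :: "(nat \<Rightarrow> nat) \<Rightarrow> nat \<Rightarrow> nat"
  where "pinv \<equiv> inv_into UNIV"

definition msc :: "'r::comm_ring_1 \<Rightarrow> (nat \<Rightarrow> nat \<Rightarrow> 'r) \<Rightarrow> nat \<Rightarrow> nat \<Rightarrow> 'r"
  where "msc r a = (\<lambda>i j. r * a i j)"

text \<open>The inverses make this a left action: a permutation \<open>g\<close> carries the entry
  at \<open>(i, j)\<close> to \<open>(g i, g j)\<close>.\<close>

definition mact :: "(nat \<Rightarrow> nat) \<Rightarrow> (nat \<Rightarrow> nat \<Rightarrow> 'r) \<Rightarrow> nat \<Rightarrow> nat \<Rightarrow> 'r"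
  where "mact g a = (\<lambda>i j. a (pinv g i) (pinv g j))"

text \<open>The exterior square of the permutation lattice consists of the alternating matrices, \<open>x \<and> y\<close>
  corresponding to \<open>x y\<^sup>T - y x\<^sup>T\<close>; zero row sums single out the exterior square of the natural
  Specht lattice.\<close>

definition alt_set :: "nat \<Rightarrow> (nat \<Rightarrow> nat \<Rightarrow> 'r::comm_ring_1) set"
  where "alt_set n = {a. (\<forall>i j. a i j = - a j i) \<and> (\<forall>i. a i i = 0) \<and>
    (\<forall>i j. i \<notin> {1..n} \<longrightarrow> a i j = 0) \<and> (\<forall>i. (\<Sum>j = 1..n. a i j) = 0)}"

definition alt_mod :: "nat \<Rightarrow> ('r::comm_ring_1, nat \<Rightarrow> nat, nat \<Rightarrow> nat \<Rightarrow> 'r) gmod"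
  where "alt_mod n = \<lparr> carrier = alt_set n, monoid.mult = undefined, one = undefined,
    zero = 0, add = (+), smult = msc, act = mact \<rparr>"

lemma alt_mod_simps [simp]:
  "carrier (alt_mod n) = alt_set n" "\<zero>\<^bsub>alt_mod n\<^esub> = 0" "add (alt_mod n) = (+)"
  "smult (alt_mod n) = msc" "act (alt_mod n) = mact"
  by (simp_all add: alt_mod_def)

lemma zero_matrix_apply [simp]: "(0 :: nat \<Rightarrow> nat \<Rightarrow> 'r::zero) i j = 0"
  by (simp add: zero_fun_def)

lemma add_matrix_apply [simp]: "((a :: nat \<Rightarrow> nat \<Rightarrow> 'r::plus) + b) i j = a i j + b i j"
  by (simp add: plus_fun_def)

lemma diff_matrix_apply [simp]: "((a :: nat \<Rightarrow> nat \<Rightarrow> 'r::minus) - b) i j = a i j - b i j"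
  by (simp add: fun_diff_def)

lemma minus_matrix_apply [simp]: "(- (a :: nat \<Rightarrow> nat \<Rightarrow> 'r::uminus)) i j = - a i j"
  by (simp add: fun_Compl_def)

lemma sum_matrix_apply: "(\<Sum>x \<in> A. h x :: nat \<Rightarrow> nat \<Rightarrow> 'r::comm_monoid_add) i j = (\<Sum>x \<in> A. h x i j)"
  by (induction A rule: infinite_finite_induct) simp_all

lemma msc_apply: "msc r a i j = r * a i j"
  by (simp add: msc_def)

lemma mact_apply: "mact g a i j = a (pinv g i) (pinv g j)"
  by (simp add: mact_def)

lemma matrix_eqI: "(\<And>i j. a i j = b i j) \<Longrightarrow> a = (b :: nat \<Rightarrow> nat \<Rightarrow> 'r)"
  by (simp add: fun_eq_iff)

lemma msc_simps [simp]:
  "msc 1 a = a" "msc r 0 = 0" "msc 0 a = 0" "msc (- 1) a = - a" "msc r (msc s a) = msc (r * s) a"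
  by (auto intro!: matrix_eqI simp: msc_apply mult.assoc)

lemma msc_add: "msc r (a + b) = msc r a + msc r b"
  by (rule matrix_eqI) (simp add: msc_apply algebra_simps)

lemma msc_add_left: "msc (r + s) a = msc r a + msc s a"
  by (rule matrix_eqI) (simp add: msc_apply algebra_simps)

lemma alt_setD:
  assumes "a \<in> alt_set n"
  shows "a i j = - a j i" "a i i = 0" "i \<notin> {1..n} \<Longrightarrow> a i j = 0" "j \<notin> {1..n} \<Longrightarrow> a i j = 0"
    "(\<Sum>j = 1..n. a i j) = 0"
proof -
  have *: "(\<forall>i j. a i j = - a j i) \<and> (\<forall>i. a i i = 0) \<and>
      (\<forall>i j. i \<notin> {1..n} \<longrightarrow> a i j = 0) \<and> (\<forall>i. (\<Sum>j = 1..n. a i j) = 0)"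
    using assms unfolding alt_set_def by (rule CollectD)
  show anti: "a i j = - a j i" for i j by (rule conjunct1[OF *, rule_format])
  show "a i i = 0" by (rule conjunct1[OF conjunct2[OF *], rule_format])
  show zero: "a i j = 0" if "i \<notin> {1..n}" for i j
    by (rule conjunct1[OF conjunct2[OF conjunct2[OF *]], rule_format, OF that])
  show "(\<Sum>j = 1..n. a i j) = 0" by (rule conjunct2[OF conjunct2[OF conjunct2[OF *]], rule_format])
  show "a i j = 0" if "j \<notin> {1..n}"
    using zero[OF that, of i] anti[of i j] by (simp only: minus_zero)
qed

lemma alt_setI:
  assumes "\<And>i j. a i j = - a j i" "\<And>i. a i i = 0" "\<And>i j. i \<notin> {1..n} \<Longrightarrow> a i j = 0"
    "\<And>i. i \<in> {1..n} \<Longrightarrow> (\<Sum>j = 1..n. a i j) = 0"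
  shows "a \<in> alt_set n"
  unfolding alt_set_def
proof (intro CollectI conjI allI impI)
  show "(\<Sum>j = 1..n. a i j) = 0" for i
    using assms(3)[of i] assms(4)[of i] by (cases "i \<in> {1..n}") simp_all
qed (rule assms; assumption)+

lemma alt_set_zero: "0 \<in> alt_set n"
  by (rule alt_setI) simp_all

lemma alt_set_add:
  assumes a: "a \<in> alt_set n" and b: "b \<in> alt_set n"
  shows "a + b \<in> alt_set n"
proof (rule alt_setI)
  show "(a + b) i j = - (a + b) j i" for i j
    using alt_setD(1)[OF a, of i j] alt_setD(1)[OF b, of i j] by simp
  show "(\<Sum>j = 1..n. (a + b) i j) = 0" for i
    by (simp only: add_matrix_apply sum.distrib alt_setD(5)[OF a] alt_setD(5)[OF b] add_0)
qed (simp_all add: alt_setD(2,3)[OF a] alt_setD(2,3)[OF b])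

lemma alt_set_msc:
  assumes a: "a \<in> alt_set n"
  shows "msc r a \<in> alt_set n"
proof (rule alt_setI)
  show "msc r a i j = - msc r a j i" for i j
    using alt_setD(1)[OF a, of i j] by (simp add: msc_apply)
  show "(\<Sum>j = 1..n. msc r a i j) = 0" for i
    by (simp only: msc_apply sum_distrib_left[symmetric] alt_setD(5)[OF a] mult_zero_right)
qed (simp_all add: msc_apply alt_setD(2,3)[OF a])

lemma alt_set_minus: "a \<in> alt_set n \<Longrightarrow> - a \<in> alt_set n"
  using alt_set_msc[of a n "- 1"] by simp

lemma alt_set_diff: "a \<in> alt_set n \<Longrightarrow> b \<in> alt_set n \<Longrightarrow> a - b \<in> alt_set n"
  using alt_set_add[of a n "- b"] alt_set_minus[of b n] by simp

lemma alt_set_mact: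
  assumes a: "a \<in> alt_set n" and g: "g permutes {1..n}"
  shows "mact g a \<in> alt_set n"
proof (rule alt_setI)
  have p: "pinv g permutes {1..n}" using g by (rule permutes_inv)
  fix i j
  show "mact g a i j = - mact g a j i" "mact g a i i = 0"
    unfolding mact_apply by (rule alt_setD[OF a])+
  show "mact g a i j = 0" if "i \<notin> {1..n}"
    using that alt_setD(3)[OF a] permutes_not_in[OF p that] by (simp add: mact_apply)
  have "(\<Sum>j = 1..n. a (pinv g i) (pinv g j)) = (\<Sum>j = 1..n. a (pinv g i) j)"
    using sum.permute[OF p, of "a (pinv g i)"] by (simp add: comp_def)
  then show "(\<Sum>j = 1..n. mact g a i j) = 0"
    using alt_setD(5)[OF a] by (simp add: mact_apply)
qed

lemma mact_simps:
  "mact g (a + b) = mact g a + mact g b" "mact g (a - b) = mact g a - mact g b"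
  "mact g (- a) = - mact g a"
  "mact g (msc r a) = msc r (mact g a)" "mact g 0 = 0"
  by (auto intro!: matrix_eqI simp: mact_apply msc_apply)

lemma alt_mod_gmodule:
  "gmodule class_ring (sym_group n) (alt_mod n :: ('r::comm_ring_1, nat \<Rightarrow> nat, nat \<Rightarrow> nat \<Rightarrow> 'r) gmod)"
  (is "gmodule _ _ ?M")
proof (rule gmodule.intro)
  show "Module.module class_ring ?M"
  proof (rule module_criteria)
    show "\<forall>v \<in> carrier ?M. \<exists>w \<in> carrier ?M. v \<oplus>\<^bsub>?M\<^esub> w = \<zero>\<^bsub>?M\<^esub>"
    proof
      fix v :: "nat \<Rightarrow> nat \<Rightarrow> 'r" assume "v \<in> carrier ?M"
      then show "\<exists>w \<in> carrier ?M. v \<oplus>\<^bsub>?M\<^esub> w = \<zero>\<^bsub>?M\<^esub>"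
        by (intro bexI[of _ "- v"]) (auto simp: alt_set_minus)
    qed
  qed (auto simp: class_cring.is_cring alt_set_zero alt_set_add alt_set_msc add_ac msc_add msc_add_left)
  show "group (sym_group n)" by (rule sym_group_is_group)
  show "gmodule_axioms class_ring (sym_group n) ?M"
  proof
    show "act ?M g \<in> LinearCombinations.module_hom class_ring ?M ?M"
      if "g \<in> carrier (sym_group n)" for g
      using that by (auto simp: LinearCombinations.module_hom_def alt_set_mact sym_group_carrier mact_simps)
    show "act ?M \<one>\<^bsub>sym_group n\<^esub> x = x" for x :: "nat \<Rightarrow> nat \<Rightarrow> 'r"
      by (rule matrix_eqI) (simp add: sym_group_one mact_apply)
    show "act ?M (g \<otimes>\<^bsub>sym_group n\<^esub> h) x = act ?M g (act ?M h x)"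
      if "g \<in> carrier (sym_group n)" "h \<in> carrier (sym_group n)" for g h and x :: "nat \<Rightarrow> nat \<Rightarrow> 'r"
    proof -
      have "bij g" "bij h" using that by (auto simp: sym_group_carrier permutes_bij)
      then show ?thesis
        by (intro matrix_eqI) (simp add: sym_group_mult mact_apply o_inv_distrib)
    qed
  qed
qed

section \<open>Arcs, triangles and 4-cycles\<close>

definition arc :: "nat \<Rightarrow> nat \<Rightarrow> nat \<Rightarrow> nat \<Rightarrow> 'r::comm_ring_1"
  where "arc u v = (\<lambda>i j. (if i = u \<and> j = v then 1 else 0) - (if i = v \<and> j = u then 1 else 0))"

text \<open>\<open>arc u v\<close> is the matrix of \<open>u \<and> v\<close>, and \<open>tri 1 i j\<close> that of \<open>b(i, j)\<close>.\<close>

definition tri :: "nat \<Rightarrow> nat \<Rightarrow> nat \<Rightarrow> nat \<Rightarrow> nat \<Rightarrow> 'r::comm_ring_1"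
  where "tri u v w = arc u v + arc v w + arc w u"

text \<open>The closed walk u, s, w, t, u; \<open>u\<close> and \<open>w\<close> are opposite
  corners, as are \<open>s\<close> and \<open>t\<close>, in accordance with the two transpositions
  of \<open>sq_cyc\<close>.\<close>

definition cyc :: "nat \<Rightarrow> nat \<Rightarrow> nat \<Rightarrow> nat \<Rightarrow> nat \<Rightarrow> nat \<Rightarrow> 'r::comm_ring_1"
  where "cyc u s w t = arc u s + arc s w + arc w t + arc t u"

text \<open>An arc is a unit flow, and row sums measure its divergence; hence closed walks such as
  \<open>tri\<close> and \<open>cyc\<close> have zero row sums.\<close>

lemma arc_row_sum:
  assumes "u \<in> {1..n}" "v \<in> {1..n}"
  shows "(\<Sum>j = 1..n. arc u v i j :: 'r::comm_ring_1) = (if i = u then 1 else 0) - (if i = v then 1 else 0)"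
proof -
  have "(\<Sum>j = 1..n. arc u v i j :: 'r) =
      (\<Sum>j = 1..n. if j = v then (if i = u then 1 else 0) else 0) -
      (\<Sum>j = 1..n. if j = u then (if i = v then 1 else 0) else 0)"
    unfolding sum_subtractf[symmetric] by (rule sum.cong) (auto simp: arc_def)
  then show ?thesis using assms by simp
qed

lemma arc_anti: "arc u v i j = - arc u v j i"
  by (simp add: arc_def conj_commute)

lemma arc_diag: "arc u v i i = 0"
  by (simp add: arc_def conj_commute)

lemma arc_outside: "i \<noteq> u \<Longrightarrow> i \<noteq> v \<Longrightarrow> arc u v i j = 0"
  by (simp add: arc_def)

lemma arc_swap: "arc u v = - arc v u"
  by (rule matrix_eqI) (simp add: arc_def)

lemma tri_alt:
  assumes "{u, v, w} \<subseteq> {1..n}"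
  shows "tri u v w \<in> alt_set n"
proof (rule alt_setI)
  fix i j
  show "tri u v w i j = - tri u v w j i"
    by (simp add: tri_def arc_anti[of _ _ i j])
  show "tri u v w i i = 0" by (simp add: tri_def arc_diag)
  show "tri u v w i j = 0" if "i \<notin> {1..n}"
  proof -
    have "i \<noteq> u" "i \<noteq> v" "i \<noteq> w" using that assms by auto
    then show ?thesis by (simp add: tri_def arc_outside)
  qed
  have "u \<in> {1..n}" "v \<in> {1..n}" "w \<in> {1..n}" using assms by blast+
  then show "(\<Sum>j = 1..n. tri u v w i j) = 0"
    by (simp only: tri_def add_matrix_apply sum.distrib arc_row_sum) simp
qed

text \<open>The two triangles share the side between \<open>w\<close> and \<open>u\<close>, which
  cancels. Read backwards, this exchanges a vertex of a triangle modulo 4-cycles, as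
  \<open>alt1_subset\<close> needs.\<close>

lemma cyc_eq_tri: "cyc u s w t = tri u s w - tri u t w"
  by (simp add: cyc_def tri_def arc_swap[of u t] arc_swap[of t w])

lemma cyc_alt: "{u, s, w, t} \<subseteq> {1..n} \<Longrightarrow> cyc u s w t \<in> alt_set n"
  unfolding cyc_eq_tri by (intro alt_set_diff tri_alt) auto

lemma tri_rotate: "tri u v w = tri v w u"
  by (simp add: tri_def add_ac)

lemma tri_swap: "tri u v w = - tri v u w"
  by (simp add: tri_def arc_swap[of v u] arc_swap[of u w] arc_swap[of w v])

lemma mact_arc:
  assumes "g permutes A"
  shows "mact g (arc u v) = arc (g u) (g v)"
proof (rule matrix_eqI)
  fix i j
  have "pinv g i = w \<longleftrightarrow> i = g w" for i w
    using permutes_inv_eq[OF assms, of i w] by auto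
  then show "mact g (arc u v) i j = arc (g u) (g v) i j"
    by (simp only: mact_apply arc_def)
qed

lemma mact_tri: "g permutes A \<Longrightarrow> mact g (tri u v w) = tri (g u) (g v) (g w)"
  by (simp add: tri_def mact_simps mact_arc)

lemma mact_cyc: "g permutes A \<Longrightarrow> mact g (cyc u s w t) = cyc (g u) (g s) (g w) (g t)"
  by (simp add: cyc_def mact_simps mact_arc)

section \<open>Coordinates with respect to the triangles through vertex 1\<close>

lemma specht_idx_iff: "(i, j) \<in> specht_idx n \<longleftrightarrow> 2 \<le> i \<and> i < j \<and> j \<le> n"
  by (simp add: specht_idx_def)

lemma finite_specht_idx: "finite (specht_idx n)"
  by (rule finite_subset[of _ "{..n} \<times> {..n}"]) (auto simp: specht_idx_def)

definition coord :: "(nat \<Rightarrow> nat \<Rightarrow> 'r) \<Rightarrow> nat \<times> nat \<Rightarrow> 'r"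
  where "coord a p = a (fst p) (snd p)"

definition btri :: "nat \<times> nat \<Rightarrow> nat \<Rightarrow> nat \<Rightarrow> 'r::comm_ring_1"
  where "btri p = tri 1 (fst p) (snd p)"

lemma coord_simps [simp]:
  "coord (a + b) p = coord a p + coord b p" "coord (a - b) p = coord a p - coord b p"
  "coord (msc r a) p = r * coord a p" "coord 0 p = 0"
  by (simp_all add: coord_def msc_apply)

lemma alt_set_zero_sym: "a \<in> alt_set n \<Longrightarrow> a j i = 0 \<Longrightarrow> a i j = 0"
  using alt_setD(1)[of a n i j] by (simp only: minus_zero)

text \<open>Antisymmetry recovers the entries below the diagonal from those above it, zero row sums
  then give column 1, and antisymmetry once more gives row 1.\<close>

lemma alt_set_zeroI:
  assumes a: "a \<in> alt_set n" and 0: "\<And>p. p \<in> specht_idx n \<Longrightarrow> coord a p = 0"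
  shows "a = 0"
proof -
  have lt: "a i j = 0" if "2 \<le> i" "i < j" for i j
  proof (cases "j \<le> n")
    case True
    then show ?thesis using 0[of "(i, j)"] that by (simp add: specht_idx_iff coord_def)
  next
    case False
    then show ?thesis by (intro alt_setD(4)[OF a]) simp
  qed
  have ge2: "a i j = 0" if "2 \<le> i" "2 \<le> j" for i j
  proof (cases i j rule: linorder_cases)
    case less
    with that show ?thesis by (intro lt)
  next
    case equal
    then show ?thesis using alt_setD(2)[OF a] by simp
  next
    case greater
    with that show ?thesis by (blast intro: alt_set_zero_sym[OF a lt])
  qed
  have one: "a i 1 = 0" if "2 \<le> i" for i
  proof (cases "i \<in> {1..n}")
    case True
    have "0 = (\<Sum>j = 1..n. a i j)" using alt_setD(5)[OF a] by simp
    also have "\<dots> = (\<Sum>j = 1..n. if j = 1 then a i 1 else 0)"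
      using ge2[OF \<open>2 \<le> i\<close>] by (intro sum.cong) auto
    also have "\<dots> = a i 1" using True by auto
    finally show ?thesis by simp
  qed (rule alt_setD(3)[OF a])
  have one': "a i j = 0" if "2 \<le> i" "j = 1" for i j
    using one[OF that(1)] that(2) by simp
  have small: "i = 1" if "\<not> 2 \<le> i" "i \<in> {1..n}" for i using that by auto
  have "a i j = 0" for i j
  proof (cases "i \<in> {1..n} \<and> j \<in> {1..n}")
    case False
    then show ?thesis using alt_setD(3,4)[OF a] by blast
  next
    case True
    show ?thesis
    proof (cases "2 \<le> i"; cases "2 \<le> j")
      assume "2 \<le> i" "2 \<le> j" then show ?thesis by (rule ge2)
    next
      assume "2 \<le> i" "\<not> 2 \<le> j" then show ?thesis using small True by (blast intro: one')
    next
      assume *: "\<not> 2 \<le> i" "2 \<le> j"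
      have "a j i = 0" using * small True by (blast intro: one')
      then show ?thesis by (rule alt_set_zero_sym[OF a])
    next
      assume "\<not> 2 \<le> i" "\<not> 2 \<le> j" 
      then have "i = j" using small True by metis
      then show ?thesis using alt_setD(2)[OF a] by simp
    qed
  qed
  then show ?thesis by (intro matrix_eqI) simp
qed

lemma btri_alt: "p \<in> specht_idx n \<Longrightarrow> btri p \<in> alt_set n"
  unfolding btri_def by (rule tri_alt) (auto simp: specht_idx_def)

text \<open>The two sides through vertex 1 have no entry at an index pair avoiding 1, and
  \<open>k < l\<close> excludes the reversed entry of the third side. So coordinates are plain
  matrix entries.\<close>

lemma coord_btri:
  assumes "p \<in> specht_idx n" "q \<in> specht_idx n"
  shows "coord (btri p) q = (if p = q then 1 else 0)"
proof -
  obtain i j k l where pq: "p = (i, j)" "q = (k, l)" by (cases p, cases q)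
  with assms have "2 \<le> i" "i < j" "2 \<le> k" "k < l" by (auto simp: specht_idx_iff)
  then have arcs: "arc 1 i k l = 0" "arc j 1 k l = 0" "arc i j k l = (if i = k \<and> j = l then 1 else 0)"
    by (auto simp: arc_def)
  show ?thesis
    unfolding pq coord_def btri_def tri_def fst_conv snd_conv add_matrix_apply arcs by simp
qed

lemma alt_coordinates: "coordinates (alt_mod n) (specht_idx n) btri coord"
proof -
  interpret gmodule class_ring "sym_group n" "alt_mod n" by (rule alt_mod_gmodule)
  show ?thesis
    by (unfold_locales) (use alt_set_zeroI in \<open>auto simp: finite_specht_idx btri_alt coord_btri\<close>)
qed

lemma alt_set_eqI:
  "a \<in> alt_set n \<Longrightarrow> b \<in> alt_set n \<Longrightarrow> (\<And>p. p \<in> specht_idx n \<Longrightarrow> coord a p = coord b p) \<Longrightarrow> a = b"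
  using alt_set_zeroI[of "a - b" n] alt_set_diff[of a n b] by simp

lemma alt_set_sum: "(\<And>x. x \<in> A \<Longrightarrow> h x \<in> alt_set n) \<Longrightarrow> (\<Sum>x \<in> A. h x) \<in> alt_set n"
  by (induction A rule: infinite_finite_induct) (auto simp: alt_set_zero alt_set_add)

lemma coord_sum: "coord (\<Sum>x \<in> A. h x) p = (\<Sum>x \<in> A. coord (h x) p)"
  by (simp add: coord_def sum_matrix_apply)

lemma comb_alt: "(\<Sum>p \<in> specht_idx n. msc (\<alpha> p) (btri p)) \<in> alt_set n"
  by (intro alt_set_sum alt_set_msc btri_alt)

lemma coord_comb:
  "q \<in> specht_idx n \<Longrightarrow> coord (\<Sum>p \<in> specht_idx n. msc (\<alpha> p) (btri p)) q = \<alpha> q"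
  by (simp add: coord_sum coord_btri finite_specht_idx if_distrib sum.delta cong: if_cong)

lemma alt_expansion:
  "a \<in> alt_set n \<Longrightarrow> a = (\<Sum>p \<in> specht_idx n. msc (coord a p) (btri p))"
  by (rule alt_set_eqI) (auto simp: comb_alt coord_comb)

lemma comb_induct:
  assumes "finite A" "P 0" "\<And>x. x \<in> A \<Longrightarrow> P (h x)" "\<And>a b. P a \<Longrightarrow> P b \<Longrightarrow> P (a + b)"
  shows "P (\<Sum>x \<in> A. h x)"
  using assms(1,3) by (induction A rule: finite_induct) (auto simp: assms)

lemma alt_induct [consumes 1, case_names zero btri add msc]:
  assumes "a \<in> alt_set n" and "P 0" and "\<And>p. p \<in> specht_idx n \<Longrightarrow> P (btri p)"
    and "\<And>a b. a \<in> alt_set n \<Longrightarrow> b \<in> alt_set n \<Longrightarrow> P a \<Longrightarrow> P b \<Longrightarrow> P (a + b)"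
    and "\<And>r a. a \<in> alt_set n \<Longrightarrow> P a \<Longrightarrow> P (msc r a)"
  shows "P a"
proof -
  have "P (\<Sum>p \<in> specht_idx n. msc (coord a p) (btri p)) \<and>
      (\<Sum>p \<in> specht_idx n. msc (coord a p) (btri p)) \<in> alt_set n"
    by (rule comb_induct[where P = "\<lambda>x. P x \<and> x \<in> alt_set n"]) (auto simp: assms finite_specht_idx alt_set_zero alt_set_add alt_set_msc btri_alt)
  then show ?thesis using alt_expansion[OF assms(1)] by simp
qed

text \<open>Multiple transitivity of the symmetric group: a permutation that is right on the tails
  is corrected at the head by one transposition.\<close>

lemma permutes_list_exists:
  assumes "distinct xs" "distinct ys" "length xs = length ys" "set xs \<subseteq> A" "set ys \<subseteq> A"
  shows "\<exists>p. p permutes A \<and> map p xs = ys"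
  using assms
proof (induction xs arbitrary: ys)
  case Nil
  then show ?case by (auto intro: permutes_id)
next
  case (Cons x xs)
  then obtain y zs where ys: "ys = y # zs" by (cases ys) auto
  obtain p where p: "p permutes A" "map p xs = zs"
    using Cons.IH[of zs] Cons.prems ys by auto
  let ?q = "Transposition.transpose (p x) y \<circ> p"
  have "?q permutes A"
    using Cons.prems ys p(1) permutes_in_image[OF p(1)]
    by (intro permutes_compose[OF p(1)] permutes_swap_id) auto
  \<comment> \<open>The transposition moves only \<open>p x\<close> and \<open>y\<close>, and
    neither of them occurs in \<open>zs\<close>.\<close>
  moreover have "map ?q xs = zs"
  proof -
    have "?q x' = p x'" if "x' \<in> set xs" for x'
    proof -
      have "p x' \<noteq> p x" using that Cons.prems permutes_inj[OF p(1)] by (auto dest: injD)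
      moreover have "p x' \<noteq> y" using that p(2) Cons.prems ys by auto
      ultimately show ?thesis by (simp add: transpose_apply_other)
    qed
    then show ?thesis using p(2) by auto
  qed
  ultimately show ?case using ys by (intro exI[of _ ?q]) (simp del: o_apply, simp)
qed

section \<open>Invariant lattices of alternating 2-adic matrices\<close>

type_synonym z2matrix = "nat \<Rightarrow> nat \<Rightarrow> z2adic"

section \<open>The parity of the coordinate sum\<close>

text \<open>Being a sum of matrix entries, this also makes sense for \<open>arc\<close>, which has
  nonzero row sums; the parity on a triangle can thus be found side by side.\<close>

definition psum :: "nat \<Rightarrow> z2matrix \<Rightarrow> z2adic"
  where "psum n a = (\<Sum>p \<in> specht_idx n. coord a p)"

definition alt1 :: "nat \<Rightarrow> z2matrix set"
  where "alt1 n = {a \<in> alt_set n. 2 dvd psum n a}"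

definition alt2 :: "nat \<Rightarrow> z2matrix set"
  where "alt2 n = {a \<in> alt_set n. \<forall>p \<in> specht_idx n. 2 dvd coord a p - coord a (n - 1, n)}"

text \<open>The matrix version of \<open>gsublattice\<close>, see
  \<open>gsublattice_lattice\<close>.\<close>

definition inv_lattice :: "nat \<Rightarrow> z2matrix set \<Rightarrow> bool"
  where "inv_lattice n X \<longleftrightarrow> X \<subseteq> alt_set n \<and> 0 \<in> X \<and> (\<forall>a \<in> X. \<forall>b \<in> X. a + b \<in> X) \<and>
    (\<forall>r. \<forall>a \<in> X. msc r a \<in> X) \<and> (\<forall>g. g permutes {1..n} \<longrightarrow> (\<forall>a \<in> X. mact g a \<in> X))"

lemma latticeD:
  assumes "inv_lattice n X"
  shows "a \<in> X \<Longrightarrow> a \<in> alt_set n" "0 \<in> X" "a \<in> X \<Longrightarrow> b \<in> X \<Longrightarrow> a + b \<in> X"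
    "a \<in> X \<Longrightarrow> msc r a \<in> X" "g permutes {1..n} \<Longrightarrow> a \<in> X \<Longrightarrow> mact g a \<in> X"
    "a \<in> X \<Longrightarrow> - a \<in> X" "a \<in> X \<Longrightarrow> b \<in> X \<Longrightarrow> a - b \<in> X"
proof -
  show *: "a \<in> X \<Longrightarrow> a \<in> alt_set n" "0 \<in> X" "a \<in> X \<Longrightarrow> b \<in> X \<Longrightarrow> a + b \<in> X"
    "a \<in> X \<Longrightarrow> msc r a \<in> X" "g permutes {1..n} \<Longrightarrow> a \<in> X \<Longrightarrow> mact g a \<in> X" for a b r g
    using assms unfolding inv_lattice_def by blast+
  show "a \<in> X \<Longrightarrow> - a \<in> X" for a using *(4)[of a "- 1"] by simp
  then show "a \<in> X \<Longrightarrow> b \<in> X \<Longrightarrow> a - b \<in> X" using *(3)[of a "- b"] by simp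
qed

lemma psum_simps:
  "psum n 0 = 0" "psum n (a + b) = psum n a + psum n b" "psum n (a - b) = psum n a - psum n b"
  "psum n (msc r a) = r * psum n a"
  by (simp_all add: psum_def sum.distrib sum_subtractf sum_distrib_left)

lemma psum_minus: "psum n (- a) = - psum n a"
  using psum_simps(4)[of n "- 1" a] by simp

lemma psum_arc_lt:
  assumes "2 \<le> u" "u < v" "v \<le> n"
  shows "psum n (arc u v) = 1"
proof -
  have "coord (arc u v) p = (if p = (u, v) then 1 else 0 :: z2adic)" if "p \<in> specht_idx n" for p
  proof (cases p)
    case (Pair i j)
    then have "i < j" using that by (simp add: specht_idx_iff)
    then have "\<not> (i = v \<and> j = u)" using assms by auto
    then show ?thesis by (simp add: Pair coord_def arc_def)
  qed
  then have "psum n (arc u v) = (\<Sum>p \<in> specht_idx n. if p = (u, v) then 1 else 0)"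
    unfolding psum_def by (intro sum.cong refl)
  also have "\<dots> = 1" using assms by (simp add: finite_specht_idx specht_idx_iff)
  finally show ?thesis .
qed

lemma psum_arc_1:
  assumes "u = 1 \<or> v = 1"
  shows "psum n (arc u v) = 0"
  unfolding psum_def
proof (rule sum.neutral, rule ballI)
  fix p assume "p \<in> specht_idx n"
  then have "fst p \<noteq> 1" "snd p \<noteq> 1" by (cases p; simp add: specht_idx_iff)+
  then have "\<not> (fst p = u \<and> snd p = v)" "\<not> (fst p = v \<and> snd p = u)" using assms by metis+
  then show "coord (arc u v) p = (0 :: z2adic)" by (simp only: coord_def arc_def if_False diff_self)
qed

lemma psum_arc_parity:
  assumes "u \<in> {1..n}" "v \<in> {1..n}" "u \<noteq> v"
  shows "2 dvd psum n (arc u v) \<longleftrightarrow> u = 1 \<or> v = 1"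
proof (cases "u = 1 \<or> v = 1")
  case False
  have "\<not> 2 dvd psum n (arc u v)"
  proof (cases "u < v")
    case True
    then show ?thesis using False assms by (subst psum_arc_lt) (auto simp: not_two_dvd_one)
  next
    case gt: False
    have "psum n (arc v u) = 1" using False gt assms by (intro psum_arc_lt) auto
    then have "psum n (arc u v) = - 1" by (subst arc_swap) (simp only: psum_minus)
    then show ?thesis by (simp add: not_two_dvd_one)
  qed
  with False show ?thesis by simp
qed (simp add: psum_arc_1)

text \<open>A side counts as odd exactly when it avoids vertex 1. A triangle has three such sides
  or, if it passes through 1, exactly one.\<close>

lemma psum_tri_odd:
  assumes "distinct [u, v, w]" "{u, v, w} \<subseteq> {1..n}"
  shows "\<not> 2 dvd psum n (tri u v w)"
proof -
  have arcs: "2 dvd psum n (arc u v) \<longleftrightarrow> u = 1 \<or> v = 1" "2 dvd psum n (arc v w) \<longleftrightarrow> v = 1 \<or> w = 1"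
    "2 dvd psum n (arc w u) \<longleftrightarrow> w = 1 \<or> u = 1"
    using assms by (intro psum_arc_parity; simp)+
  show ?thesis
    unfolding tri_def psum_simps two_dvd_add_iff arcs using assms(1) by auto
qed

lemma btri_odd: "p \<in> specht_idx n \<Longrightarrow> \<not> 2 dvd psum n (btri p)"
  unfolding btri_def by (rule psum_tri_odd) (auto simp: specht_idx_def)

text \<open>Permutations map triangles to triangles, and all triangles have odd coordinate sum; by
  linearity this is enough.\<close>

lemma psum_mact:
  assumes "a \<in> alt_set n" and g: "g permutes {1..n}"
  shows "2 dvd psum n (mact g a) \<longleftrightarrow> 2 dvd psum n a"
  using assms(1)
proof (induction a rule: alt_induct)
  case zero
  show ?case unfolding mact_simps ..
next
  case (add a b)
  then show ?case unfolding mact_simps psum_simps two_dvd_add_iff by blast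
next
  case (msc r a)
  then show ?case unfolding mact_simps psum_simps two_dvd_mult_iff by blast
next
  case (btri p)
  have "\<not> 2 dvd psum n (mact g (btri p))"
    unfolding btri_def mact_tri[OF g]
  proof (rule psum_tri_odd)
    have "{1, fst p, snd p} \<subseteq> {1..n}" "distinct [1, fst p, snd p]"
      using btri by (auto simp: specht_idx_def)
    then show "distinct [g 1, g (fst p), g (snd p)]" "{g 1, g (fst p), g (snd p)} \<subseteq> {1..n}"
      using permutes_in_image[OF g] permutes_inj[OF g] by (auto dest: injD)
  qed
  with btri_odd[OF btri] show ?case by simp
qed

lemma lattice_alt: "inv_lattice n (alt_set n)"
  unfolding inv_lattice_def using alt_set_zero alt_set_add alt_set_msc alt_set_mact by blast

lemma lattice_alt1: "inv_lattice n (alt1 n)"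
  unfolding inv_lattice_def alt1_def
  by (auto simp: psum_simps psum_mact alt_set_zero alt_set_add alt_set_msc alt_set_mact)

section \<open>Matrices of uniform parity\<close>

lemma parity_sum:
  assumes "finite A" "\<And>x. x \<in> A \<Longrightarrow> 2 dvd (f x :: z2adic) \<longleftrightarrow> q"
  shows "2 dvd (\<Sum>x \<in> A. f x) \<longleftrightarrow> q \<or> even (card A)"
  using assms by (induction A rule: finite_induct) (auto simp: two_dvd_add_iff)

lemma parity_sym: "a \<in> alt_set n \<Longrightarrow> 2 dvd (a i j :: z2adic) \<longleftrightarrow> 2 dvd a j i"
  using alt_setD(1)[of a n i j] by (metis dvd_minus_iff)

text \<open>Unlike the condition in \<open>alt2\<close>, this one involves vertex 1 on the same
  footing as the others, so its invariance is visible. A true \<open>q\<close> stands for even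
  entries.\<close>

definition unif :: "nat \<Rightarrow> z2matrix \<Rightarrow> bool \<Rightarrow> bool"
  where "unif n a q \<longleftrightarrow>
    (\<forall>i j. i \<in> {1..n} \<longrightarrow> j \<in> {1..n} \<longrightarrow> i \<noteq> j \<longrightarrow> (2 dvd a i j \<longleftrightarrow> q))"

lemma unifD: "unif n a q \<Longrightarrow> i \<in> {1..n} \<Longrightarrow> j \<in> {1..n} \<Longrightarrow> i \<noteq> j \<Longrightarrow> 2 dvd a i j \<longleftrightarrow> q"
  unfolding unif_def by simp

lemma unifI: "(\<And>i j. i \<in> {1..n} \<Longrightarrow> j \<in> {1..n} \<Longrightarrow> i \<noteq> j \<Longrightarrow> 2 dvd a i j \<longleftrightarrow> q) \<Longrightarrow> unif n a q"
  unfolding unif_def by simp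

text \<open>Only the entries in row and column 1 are not governed by the coordinates. Their parity
  follows from the zero row sums, because the \<open>n - 2\<close> other off-diagonal entries of a
  row are odd in number.\<close>

lemma alt2_iff:
  assumes "n \<ge> 5" "odd n"
  shows "a \<in> alt2 n \<longleftrightarrow> a \<in> alt_set n \<and> (\<exists>q. unif n a q)"
proof
  assume "a \<in> alt_set n \<and> (\<exists>q. unif n a q)"
  then obtain q where a: "a \<in> alt_set n" and "unif n a q" by blast
  note q = unifD[OF this(2)]
  have "2 dvd coord a p \<longleftrightarrow> q" if "p \<in> specht_idx n" for p
    using that unfolding coord_def by (intro q) (auto simp: specht_idx_def)
  moreover have "(n - 1, n) \<in> specht_idx n" using assms by (auto simp: specht_idx_iff)
  ultimately show "a \<in> alt2 n" using a by (simp add: alt2_def two_dvd_diff_iff)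
next
  assume "a \<in> alt2 n"
  then have a: "a \<in> alt_set n" and p: "\<And>p. p \<in> specht_idx n \<Longrightarrow> 2 dvd coord a p \<longleftrightarrow> 2 dvd coord a (n - 1, n)"
    by (auto simp: alt2_def two_dvd_diff_iff)
  define q where "q \<longleftrightarrow> 2 dvd coord a (n - 1, n)"
  have lt: "2 dvd a i j \<longleftrightarrow> q" if "2 \<le> i" "i < j" "j \<le> n" for i j
    using p[of "(i, j)"] that by (simp add: specht_idx_iff coord_def q_def)
  have ge2: "2 dvd a i j \<longleftrightarrow> q" if "2 \<le> i" "i \<le> n" "2 \<le> j" "j \<le> n" "i \<noteq> j" for i j
    using lt[of i j] lt[of j i] that parity_sym[OF a, of i j] by (cases "i < j") auto
  have one: "2 dvd a i 1 \<longleftrightarrow> q" if "2 \<le> i" "i \<le> n" for i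
  proof -
    have set: "{1..n} = insert 1 (insert i ({2..n} - {i}))" using that by auto
    have "(\<Sum>j \<in> {1..n}. a i j) = a i 1 + (a i i + (\<Sum>j \<in> {2..n} - {i}. a i j))"
      unfolding set using that by (subst sum.insert, simp, simp, subst sum.insert) simp_all
    then have "0 = a i 1 + (a i i + (\<Sum>j \<in> {2..n} - {i}. a i j))"
      using alt_setD(5)[OF a, of i] by metis
    moreover have "2 dvd (\<Sum>j \<in> {2..n} - {i}. a i j) \<longleftrightarrow> q \<or> even (card ({2..n} - {i}))"
      using that by (intro parity_sum ge2) auto
    moreover have "card ({2..n} - {i}) = n - 2" using that by (simp add: card_Diff_singleton)
    moreover have "odd (n - 2)" using assms by simp
    ultimately show ?thesis using two_dvd_add_iff[of "a i 1" "\<Sum>j \<in> {2..n} - {i}. a i j"] alt_setD(2)[OF a]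
      by (metis add_0 dvd_0_right)
  qed
  have "unif n a q"
  proof (rule unifI)
    fix i j assume ij: "i \<in> {1..n}" "j \<in> {1..n}" "i \<noteq> j"
    show "2 dvd a i j \<longleftrightarrow> q"
    proof (cases "i = 1")
      case True
      then show ?thesis using one[of j] parity_sym[OF a, of i j] ij by auto
    next
      case False
      then show ?thesis using one[of i] ge2[of i j] ij by (cases "j = 1") auto
    qed
  qed
  with a show "a \<in> alt_set n \<and> (\<exists>q. unif n a q)" by blast
qed

lemma lattice_alt2:
  assumes "n \<ge> 5" "odd n"
  shows "inv_lattice n (alt2 n)"
  unfolding inv_lattice_def
proof (intro conjI ballI allI impI)
  show "alt2 n \<subseteq> alt_set n" by (auto simp: alt2_def)
  show "0 \<in> alt2 n" by (simp add: alt2_def alt_set_zero)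
  show "msc r a \<in> alt2 n" if "a \<in> alt2 n" for r a
    using that by (auto simp: alt2_def alt_set_msc right_diff_distrib[symmetric])
  show "a + b \<in> alt2 n" if "a \<in> alt2 n" "b \<in> alt2 n" for a b
    using that by (auto simp: alt2_def alt_set_add two_dvd_simps)
  show "mact g a \<in> alt2 n" if g: "g permutes {1..n}" and a2: "a \<in> alt2 n" for g a
  proof -
    obtain q where a: "a \<in> alt_set n" and q: "unif n a q"
      using a2 alt2_iff[OF assms] by metis
    have "unif n (mact g a) q"
    proof (rule unifI)
      fix i j assume "i \<in> {1..n}" "j \<in> {1..n}" "i \<noteq> j"
      then show "2 dvd mact g a i j \<longleftrightarrow> q"
        unfolding mact_apply using permutes_in_image[OF permutes_inv[OF g]] permutes_inj[OF permutes_inv[OF g]]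
        by (intro unifD[OF q]) (auto dest: injD simp del: atLeastAtMost_iff)
    qed
    then show ?thesis using alt2_iff[OF assms] alt_set_mact[OF a g] by metis
  qed
qed

section \<open>Squares and the 4-cycles they produce\<close>

definition sq :: "z2matrix \<Rightarrow> nat \<Rightarrow> nat \<Rightarrow> nat \<Rightarrow> nat \<Rightarrow> z2adic"
  where "sq x u w s t = x u s - x w s - x u t + x w t"

abbreviation tp :: "nat \<Rightarrow> nat \<Rightarrow> nat \<Rightarrow> nat"
  where "tp \<equiv> Transposition.transpose"

lemma pinv_tp: "pinv (tp u w) = tp u w"
  by (simp add: inv_equality)

text \<open>\<open>1 - (u w)\<close> kills the entries outside rows and columns \<open>u\<close>,
  \<open>w\<close>, and \<open>1 - (s t)\<close> then kills those whose position it fixes. Up to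
  antisymmetry only the positions in \<open>{u, w} \<times> {s, t}\<close> survive, with values
  equal up to a sign that alternates around the cycle.\<close>

lemma sq_cyc:
  assumes x: "x \<in> alt_set n" and d: "distinct [u, w, s, t]"
  defines "y \<equiv> x - mact (tp u w) x"
  shows "y - mact (tp s t) y = msc (sq x u w s t) (cyc u s w t)"
proof (rule matrix_eqI)
  fix i j
  have anti: "x s u = - x u s" "x s w = - x w s" "x t u = - x u t" "x t w = - x w t"
    "x w u = - x u w" "x t s = - x s t"
    by (rule alt_setD[OF x])+
  have diag: "x k k = 0" for k by (rule alt_setD[OF x])
  have a2: "x i k = - x k i" for k by (rule alt_setD[OF x])
  have y: "y k l = x k l - x (tp u w k) (tp u w l)" for k l
    by (simp add: y_def mact_apply pinv_tp)
  have ne: "u \<noteq> w" "u \<noteq> s" "u \<noteq> t" "w \<noteq> s" "w \<noteq> t" "s \<noteq> t" using d by auto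
  note ne' = ne ne[symmetric]
  have lhs: "(y - mact (tp s t) y) i j = x i j - x (tp u w i) (tp u w j)
      - (x (tp s t i) (tp s t j) - x (tp u w (tp s t i)) (tp u w (tp s t j)))"
    by (simp add: y mact_apply pinv_tp)
  \<comment> \<open>Each index is one of the four vertices or none of them, which makes 25
    cases.\<close>
  have cases: "k = u \<or> k = w \<or> k = s \<or> k = t \<or> (k \<noteq> u \<and> k \<noteq> w \<and> k \<noteq> s \<and> k \<noteq> t)" for k by blast
  show "(y - mact (tp s t) y) i j = msc (sq x u w s t) (cyc u s w t) i j"
    using cases[of i] cases[of j] unfolding lhs
    by (elim disjE conjE)
      (simp_all add: msc_apply sq_def cyc_def arc_def Transposition.transpose_def ne' anti diag algebra_simps)
qed

text \<open>A row \<open>v\<close> with different parities at \<open>u\<close> and \<open>w\<close>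
  makes \<open>d v\<close> odd. All \<open>d t\<close> sum to 0 and \<open>d u + d w\<close> is
  even, so the remaining terms have an even sum; being \<open>n - 2\<close>, an odd number, they are
  not all odd. An even \<open>d t\<close> supplies the fourth vertex.\<close>

lemma sq_odd_exists:
  assumes n: "n \<ge> 5" "odd n" and x: "x \<in> alt_set n" and nx: "x \<notin> alt2 n"
  obtains u w s t where "distinct [u, w, s, t]" "{u, w, s, t} \<subseteq> {1..n}" "\<not> 2 dvd sq x u w s t"
proof -
  define P where "P i j \<longleftrightarrow> 2 dvd x i j" for i j
  have P_sym: "P i j \<longleftrightarrow> P j i" for i j unfolding P_def by (rule parity_sym[OF x])
  \<comment> \<open>If each row had one parity off the diagonal, the symmetry of parity would make
    all rows agree and put \<open>x\<close> into \<open>alt2 n\<close>.\<close>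
  have "\<exists>v \<in> {1..n}. \<exists>u \<in> {1..n}. \<exists>w \<in> {1..n}. distinct [v, u, w] \<and> P v u \<noteq> P v w"
  proof (rule ccontr)
    assume "\<not> ?thesis"
    then have *: "P v u = P v w" if "v \<in> {1..n}" "u \<in> {1..n}" "w \<in> {1..n}" "distinct [v, u, w]" for u v w
      using that by metis
    have eq: "P v u = P v w" if "v \<in> {1..n}" "u \<in> {1..n}" "w \<in> {1..n}" "v \<noteq> u" "v \<noteq> w" for u v w
    proof (cases "u = w")
      case False
      show ?thesis by (rule *) (use that False in simp_all)
    qed simp
    have r: "1 \<in> {1..n}" "2 \<in> {1..n}" using n by auto
    have "P i j = P 1 2" if "i \<in> {1..n}" "j \<in> {1..n}" "i \<noteq> j" for i j
    proof (cases "i = 1")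
      case True
      then show ?thesis using eq[of 1 j 2] that r by auto
    next
      case False
      then have "P i j = P i 1" using that r by (intro eq) auto
      also have "\<dots> = P 1 i" by (rule P_sym)
      also have "\<dots> = P 1 2" using that r False by (intro eq) auto
      finally show ?thesis .
    qed
    then have "unif n x (P 1 2)" unfolding P_def by (intro unifI)
    then show False using nx x alt2_iff[OF n] by metis
  qed
  then obtain v u w where vuw: "v \<in> {1..n}" "u \<in> {1..n}" "w \<in> {1..n}" "distinct [v, u, w]"
    and ne: "P v u \<noteq> P v w" by blast
  define d where "d t = x u t - x w t" for t
  let ?T = "{1..n} - {u, w}"
  have dv: "\<not> 2 dvd d v"
    using ne P_sym[of u v] P_sym[of w v] unfolding d_def P_def two_dvd_diff_iff by metis
  have split: "(\<Sum>t = 1..n. d t) = d u + (d w + (\<Sum>t \<in> ?T. d t))"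
  proof -
    have set: "{1..n} = insert u (insert w ?T)" using vuw by auto
    have "(\<Sum>t \<in> insert u (insert w ?T). d t) = d u + (d w + (\<Sum>t \<in> ?T. d t))"
      using vuw by (subst sum.insert, simp, simp, subst sum.insert) simp_all
    then show ?thesis using set by metis
  qed
  have "(\<Sum>t = 1..n. d t) = 0"
    unfolding d_def sum_subtractf alt_setD(5)[OF x] by simp
  moreover have "d u + d w = 2 * x u w"
    using alt_setD(1)[OF x, of w u] alt_setD(2)[OF x] by (simp add: d_def)
  ultimately have "(\<Sum>t \<in> ?T. d t) = - (2 * x u w)"
    using split by (metis add.assoc add_eq_0_iff)
  then have ev: "2 dvd (\<Sum>t \<in> ?T. d t)" by simp
  have "\<exists>t \<in> ?T. 2 dvd d t"
  proof (rule ccontr)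
    assume "\<not> ?thesis"
    then have "2 dvd (\<Sum>t \<in> ?T. d t) \<longleftrightarrow> False \<or> even (card ?T)"
      by (intro parity_sum) auto
    moreover have "card ?T = n - 2" using vuw by (simp add: card_Diff_subset)
    moreover have "odd (n - 2)" using n by simp
    ultimately show False using ev by metis
  qed
  then obtain t where t: "t \<in> ?T" "2 dvd d t" by blast
  have "sq x u w v t = d v - d t" by (simp add: sq_def d_def algebra_simps)
  then have "\<not> 2 dvd sq x u w v t" using dv t(2) by (simp add: two_dvd_diff_iff)
  moreover have "v \<noteq> t" using dv t by auto
  ultimately show ?thesis using that[of u w v t] vuw t by auto
qed

text \<open>A square has four odd entries, so its value is even. In the sum of three squares
  obtained by rotating 1, 2, 3, the entries at vertex 4 cancel and antisymmetry doubles the others: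
  the sum is twice \<open>x 1 2 + x 2 3 + x 3 1\<close>, which is odd. So one of the three halves is
  odd.\<close>

lemma sq_half_odd_exists:
  assumes n: "n \<ge> 5" "odd n" and x: "x \<in> alt_set n" and odd: "unif n x False"
  obtains u w s t e where "distinct [u, w, s, t]" "{u, w, s, t} \<subseteq> {1..n}" "sq x u w s t = 2 * e" "\<not> 2 dvd e"
proof -
  have r: "1 \<in> {1..n}" "2 \<in> {1..n}" "3 \<in> {1..n}" "4 \<in> {1..n}" using n by auto
  have ev: "2 dvd sq x u w s t" if "distinct [u, w, s, t]" "{u, w, s, t} \<subseteq> {1..n}" for u w s t
  proof -
    have "\<not> 2 dvd x u s" "\<not> 2 dvd x w s" "\<not> 2 dvd x u t" "\<not> 2 dvd x w t"
      using that unifD[OF odd] by auto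
    then show ?thesis by (simp add: sq_def two_dvd_simps)
  qed
  let ?q1 = "sq x 1 3 2 4" and ?q2 = "sq x 2 1 3 4" and ?q3 = "sq x 3 2 1 4"
  have d: "distinct [1, 3, 2, 4 :: nat]" "distinct [2, 1, 3, 4 :: nat]" "distinct [3, 2, 1, 4 :: nat]" by auto
  have s: "{1, 3, 2, 4} \<subseteq> {1..n}" "{2, 1, 3, 4} \<subseteq> {1..n}" "{3, 2, 1, 4} \<subseteq> {1..n}" using n by auto
  obtain e1 e2 e3 where e: "?q1 = 2 * e1" "?q2 = 2 * e2" "?q3 = 2 * e3"
    using ev[OF d(1) s(1)] ev[OF d(2) s(2)] ev[OF d(3) s(3)] unfolding dvd_def by metis
  have "?q1 + ?q2 + ?q3 = 2 * (x 1 2 + x 2 3 + x 3 1)"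
    using alt_setD(1)[OF x, of 3 2] alt_setD(1)[OF x, of 1 3] alt_setD(1)[OF x, of 2 1]
    by (simp add: sq_def)
  then have "2 * (e1 + e2 + e3) = 2 * (x 1 2 + x 2 3 + x 3 1)"
    unfolding e by (simp only: distrib_left)
  then have sum: "e1 + e2 + e3 = x 1 2 + x 2 3 + x 3 1"
    using two_z2adic_nonzero by (simp only: mult_cancel_left) simp
  have "\<not> 2 dvd x 1 2" "\<not> 2 dvd x 2 3" "\<not> 2 dvd x 3 1" using r unifD[OF odd] by auto
  then have "\<not> 2 dvd e1 + e2 + e3" unfolding sum by (simp add: two_dvd_add_iff)
  then have "\<not> 2 dvd e1 \<or> \<not> 2 dvd e2 \<or> \<not> 2 dvd e3" by (auto simp: two_dvd_add_iff)
  then show ?thesis using that[OF d(1) s(1) e(1)] that[OF d(2) s(2) e(2)] that[OF d(3) s(3) e(3)] by blast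
qed

text \<open>Four distinct vertices can be moved to any other four, so a multiple of one 4-cycle in
  an invariant lattice brings the same multiple of all of them.\<close>

lemma cyc_all:
  assumes X: "inv_lattice n X" and "distinct [u, s, w, t]" "{u, s, w, t} \<subseteq> {1..n}" "msc r (cyc u s w t) \<in> X"
    and "distinct [u', s', w', t']" "{u', s', w', t'} \<subseteq> {1..n}"
  shows "msc r (cyc u' s' w' t') \<in> X"
proof -
  obtain g where g: "g permutes {1..n}" "map g [u, s, w, t] = [u', s', w', t']"
    using permutes_list_exists[of "[u, s, w, t]" "[u', s', w', t']" "{1..n}"] assms by auto
  have "mact g (msc r (cyc u s w t)) \<in> X" by (rule latticeD(5)[OF X g(1) assms(4)])
  then show ?thesis using g by (simp add: mact_simps mact_cyc)
qed

text \<open>Modulo 4-cycles all basis triangles agree, so \<open>a\<close> is congruent to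
  \<open>psum n a\<close> times a single one; twice a triangle is congruent to 0, which settles the
  case of an even sum.\<close>

lemma alt1_subset:
  assumes n: "n \<ge> 5" and X: "inv_lattice n X"
    and c: "\<And>u s w t. distinct [u, s, w, t] \<Longrightarrow> {u, s, w, t} \<subseteq> {1..n} \<Longrightarrow> cyc u s w t \<in> X"
  shows "alt1 n \<subseteq> X"
proof -
  have step: "tri u s w - tri u t w \<in> X" if "distinct [u, s, w, t]" "{u, s, w, t} \<subseteq> {1..n}" for u s w t
    using c[OF that] by (simp add: cyc_eq_tri)
  have trans: "a - c \<in> X" if "a - b \<in> X" "b - c \<in> X" for a b c
    using latticeD(3)[OF X that] by simp
  have change2: "tri u s w - tri u t w \<in> X"
    if "distinct [u, s, w]" "distinct [u, t, w]" "{u, s, w, t} \<subseteq> {1..n}" for u s w t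
    using step[of u s w t] that latticeD(2)[OF X] by (cases "s = t") auto
  have change3: "tri u w s - tri u w t \<in> X"
    if "distinct [u, w, s]" "distinct [u, w, t]" "{u, s, w, t} \<subseteq> {1..n}" for u s w t
  proof -
    have "tri w s u - tri w t u \<in> X" using that by (intro change2) auto
    then show ?thesis by (simp only: tri_rotate[of u w])
  qed
  \<comment> \<open>With a further vertex \<open>x\<close>, exchanging one vertex at a time leads
    from u v w through u v x and u w x to u w v, which is the negative of the first
    triangle.\<close>
  have twice: "tri u v w + tri u v w \<in> X" if "distinct [u, v, w]" "{u, v, w} \<subseteq> {1..n}" for u v w
  proof -
    have "\<not> {1..n} \<subseteq> {u, v, w}"
    proof
      assume "{1..n} \<subseteq> {u, v, w}"
      from card_mono[OF _ this] have "n \<le> card {u, v, w}" by simp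
      also have "\<dots> \<le> 3" by (rule card_insert_le_m1; simp add: card_insert_le_m1)
      finally show False using n by simp
    qed
    then obtain x where x: "x \<in> {1..n}" "x \<notin> {u, v, w}" by blast
    have "tri u v w - tri u v x \<in> X" using that x by (intro change3) auto
    moreover have "tri u v x - tri u w x \<in> X" using that x by (intro change2) auto
    moreover have "tri u w x - tri u w v \<in> X" using that x by (intro change3) auto
    ultimately have "tri u v w - tri u w v \<in> X" using trans by blast
    moreover have "tri u w v = - (tri u v w :: z2matrix)" using tri_swap[of w v u] tri_rotate[of u] by metis
    ultimately show ?thesis by (simp only: diff_minus_eq_add)
  qed
  have swap: "tri u v w - tri u w v \<in> X" if "distinct [u, v, w]" "{u, v, w} \<subseteq> {1..n}" for u v w
  proof -
    have "tri u w v = - (tri u v w :: z2matrix)" using tri_swap[of w v u] tri_rotate[of u] by metis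
    then show ?thesis using twice[OF that] by (simp only: diff_minus_eq_add)
  qed
  have in_range: "distinct [1, i, j]" "{1, i, j} \<subseteq> {1..n}" if "(i, j) \<in> specht_idx n" for i j
    using that by (auto simp: specht_idx_iff)
  have diff: "btri p - btri q \<in> X" if pq: "p \<in> specht_idx n" "q \<in> specht_idx n" for p q
  proof -
    obtain i j k l where [simp]: "p = (i, j)" "q = (k, l)" by (cases p, cases q)
    note ij = in_range[OF pq(1)[unfolded \<open>p = (i, j)\<close>]] and kl = in_range[OF pq(2)[unfolded \<open>q = (k, l)\<close>]]
    show ?thesis
    \<comment> \<open>The usual route passes through \<open>tri 1 k j\<close>, which degenerates for
      \<open>k = j\<close>; then the detour is \<open>tri 1 l j\<close>, followed by a change of
      orientation.\<close>
    proof (cases "k = j")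
      case True
      have "tri 1 i j - tri 1 l j \<in> X" using ij kl True by (intro change2) auto
      moreover have "tri 1 l j - tri 1 j l \<in> X" using kl True by (intro swap) auto
      ultimately have "tri 1 i j - tri 1 j l \<in> X" by (rule trans)
      then show ?thesis using True by (simp add: btri_def del: One_nat_def)
    next
      case False
      have "tri 1 i j - tri 1 k j \<in> X" using ij kl False by (intro change2) auto
      moreover have "tri 1 k j - tri 1 k l \<in> X" using ij kl False by (intro change3) auto
      ultimately have "tri 1 i j - tri 1 k l \<in> X" by (rule trans)
      then show ?thesis by (simp add: btri_def del: One_nat_def)
    qed
  qed
  define q where "q = (2 :: nat, 3 :: nat)"
  have q: "q \<in> specht_idx n" using n by (simp add: q_def specht_idx_iff)
  show ?thesis
  proof
    fix a assume a1: "a \<in> alt1 n"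
    then have a: "a \<in> alt_set n" and "2 dvd psum n a" by (auto simp: alt1_def)
    then obtain r where r: "psum n a = 2 * r" by (auto elim: dvdE)
    have "a - msc (psum n a) (btri q) \<in> X"
      using a
    proof (induction a rule: alt_induct)
      case zero
      show ?case using latticeD(2)[OF X] by (simp only: psum_simps msc_simps diff_self)
    next
      case (btri p)
      have "psum n (btri p) = 1"
        unfolding psum_def using btri by (simp add: coord_btri finite_specht_idx)
      then show ?case using diff[OF btri q] by (simp only: msc_simps)
    next
      case (add a b)
      have "a + b - msc (psum n (a + b)) (btri q) =
          (a - msc (psum n a) (btri q)) + (b - msc (psum n b) (btri q))"
        by (simp add: psum_simps msc_add_left)
      then show ?case using latticeD(3)[OF X add.IH] by metis
    next
      case (msc r a)
      have "msc r a - msc (psum n (msc r a)) (btri q) = msc r (a - msc (psum n a) (btri q))"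
        by (rule matrix_eqI) (simp add: psum_simps msc_apply algebra_simps)
      then show ?case using latticeD(4)[OF X msc.IH] by metis
    qed
    moreover have "msc (psum n a) (btri q) \<in> X"
    proof -
      have "btri q + btri q \<in> X"
        unfolding btri_def q_def fst_conv snd_conv using n by (intro twice) auto
      moreover have "msc (psum n a) (btri q) = msc r (btri q + btri q)"
        by (rule matrix_eqI) (simp add: r msc_apply algebra_simps)
      ultimately show ?thesis using latticeD(4)[OF X] by metis
    qed
    ultimately have "a - msc (psum n a) (btri q) + msc (psum n a) (btri q) \<in> X" by (rule latticeD(3)[OF X])
    then show "a \<in> X" by simp
  qed
qed

text \<open>Two matrices outside \<open>alt1 n\<close> both have odd coordinate sum, so they differ
  by an element of \<open>alt1 n\<close>: the index is 2.\<close>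

lemma alt1_maximal:
  assumes X: "inv_lattice n X" and "alt1 n \<subseteq> X" and y: "y \<in> X" "y \<notin> alt1 n"
  shows "X = alt_set n"
proof
  show "X \<subseteq> alt_set n" using latticeD(1)[OF X] by blast
  have ya: "y \<in> alt_set n" using latticeD(1)[OF X y(1)] .
  then have yo: "\<not> 2 dvd psum n y" using y(2) by (simp add: alt1_def)
  show "alt_set n \<subseteq> X"
  proof
    fix z :: z2matrix assume z: "z \<in> alt_set n"
    show "z \<in> X"
    proof (cases "2 dvd psum n z")
      case True
      then show ?thesis using z assms(2) by (auto simp: alt1_def)
    next
      case False
      then have "z - y \<in> alt1 n" using yo z ya by (simp add: alt1_def alt_set_diff psum_simps two_dvd_diff_iff)
      then have "z - y + y \<in> X" using assms(2) y(1) latticeD(3)[OF X] by blast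
      then show ?thesis by simp
    qed
  qed
qed

lemma lattice_unit:
  assumes "inv_lattice n X" "msc (r * e) a \<in> X" "\<not> 2 dvd e"
  shows "msc r a \<in> X"
proof -
  obtain f where f: "e * f = 1" using odd_z2adic_unit[OF assms(3)] .
  have "msc f (msc (r * e) a) \<in> X" using latticeD(4)[OF assms(1,2)] .
  moreover have "f * (r * e) = r" using f by (metis mult.assoc mult.commute mult_1_right)
  ultimately show ?thesis by simp
qed

lemma sq_cyc_mem:
  assumes X: "inv_lattice n X" and x: "x \<in> X" and d: "distinct [u, w, s, t]" "{u, w, s, t} \<subseteq> {1..n}"
  shows "msc (sq x u w s t) (cyc u s w t) \<in> X"
proof -
  have p: "tp u w permutes {1..n}" "tp s t permutes {1..n}"
    using d by (auto intro!: permutes_swap_id)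
  have "x - mact (tp u w) x \<in> X"
    using latticeD(7)[OF X x latticeD(5)[OF X p(1) x]] .
  then have "(x - mact (tp u w) x) - mact (tp s t) (x - mact (tp u w) x) \<in> X"
    using latticeD(7)[OF X _ latticeD(5)[OF X p(2)]] by metis
  then show ?thesis using sq_cyc[OF latticeD(1)[OF X x] d(1)] by simp
qed

text \<open>Division of a lattice by \<open>r\<close>. It turns an inclusion of \<open>r\<close>
  times a lattice into an inclusion between invariant lattices, to which \<open>alt1_subset\<close>
  and \<open>alt1_maximal\<close> apply.\<close>

lemma lattice_preimage:
  assumes X: "inv_lattice n X"
  shows "inv_lattice n {y \<in> alt_set n. msc r y \<in> X}" (is "inv_lattice n ?Y")
  unfolding inv_lattice_def
proof (intro conjI ballI allI impI)
  show "?Y \<subseteq> alt_set n" by auto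
  show "0 \<in> ?Y" using latticeD(2)[OF X] by (simp add: alt_set_zero)
  show "a + b \<in> ?Y" if "a \<in> ?Y" "b \<in> ?Y" for a b
    using that latticeD(3)[OF X] by (simp add: alt_set_add msc_add)
  show "msc c a \<in> ?Y" if "a \<in> ?Y" for c a
    using that latticeD(4)[OF X, of "msc r a" c] by (simp add: alt_set_msc mult.commute)
  show "mact g a \<in> ?Y" if "g permutes {1..n}" "a \<in> ?Y" for g a
    using that latticeD(5)[OF X, of g "msc r a"] by (simp add: alt_set_mact mact_simps)
qed

text \<open>Needed with \<open>r = 1\<close> outside \<open>alt2 n\<close> and with
  \<open>r = 2\<close> inside it; the odd factor \<open>e\<close> is a unit and can be stripped
  off.\<close>

lemma alt1_subset_of_odd_sq:
  assumes n: "n \<ge> 5" and X: "inv_lattice n X" and x: "x \<in> X"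
    and d: "distinct [u, w, s, t]" "{u, w, s, t} \<subseteq> {1..n}" and e: "sq x u w s t = r * e" "\<not> 2 dvd e"
  shows "msc r ` alt1 n \<subseteq> X"
proof -
  define Y where "Y = {y \<in> alt_set n. msc r y \<in> X}"
  have Y: "inv_lattice n Y" unfolding Y_def by (rule lattice_preimage[OF X])
  have "msc r (cyc u s w t) \<in> X"
    using sq_cyc_mem[OF X x d] unfolding e(1) by (rule lattice_unit[OF X _ e(2)])
  then have "msc 1 (cyc u s w t) \<in> Y" using d by (simp add: Y_def cyc_alt)
  moreover have d': "distinct [u, s, w, t]" "{u, s, w, t} \<subseteq> {1..n}" using d by auto
  ultimately have "msc 1 (cyc u' s' w' t') \<in> Y"
    if "distinct [u', s', w', t']" "{u', s', w', t'} \<subseteq> {1..n}" for u' s' w' t'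
    using cyc_all[OF Y d'] that by blast
  then have "alt1 n \<subseteq> Y" using n Y by (intro alt1_subset) simp_all
  then show ?thesis by (auto simp: Y_def)
qed

section \<open>Halving and matrices with odd off-diagonal entries\<close>

definition half :: "z2adic \<Rightarrow> z2adic"
  where "half x = (SOME y. 2 * y = x)"

lemma two_half: "2 dvd x \<Longrightarrow> 2 * half x = x"
  unfolding half_def by (rule someI_ex) (auto elim: dvdE)

lemma half_eqI: "2 * y = x \<Longrightarrow> half x = y"
  using two_half[of x] two_z2adic_nonzero by auto

text \<open>The defining equations are linear and homogeneous, so a nonzero factor can be cancelled
  from each of them.\<close>

lemma alt_set_cancel:
  fixes a :: "nat \<Rightarrow> nat \<Rightarrow> 'r::idom"
  assumes a: "msc r a \<in> alt_set n" and "r \<noteq> 0"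
  shows "a \<in> alt_set n"
proof -
  have cancel: "x = y" if "r * x = r * y" for x y :: 'r
    using that assms(2) by simp
  show ?thesis
  proof (rule alt_setI)
    fix i j
    show "a i j = - a j i"
      by (rule cancel) (use alt_setD(1)[OF a, of i j] in \<open>simp only: mult_minus_right msc_apply\<close>)
    show "a i i = 0"
      by (rule cancel) (use alt_setD(2)[OF a, of i] in \<open>simp only: mult_zero_right msc_apply\<close>)
    show "a i j = 0" if "i \<notin> {1..n}"
      by (rule cancel) (use alt_setD(3)[OF a that, of j] in \<open>simp only: mult_zero_right msc_apply\<close>)
    show "(\<Sum>j = 1..n. a i j) = 0"
      by (rule cancel) (use alt_setD(5)[OF a, of i] in \<open>simp only: mult_zero_right msc_apply sum_distrib_left\<close>)
  qed
qed

lemma halve_alt: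
  fixes a :: z2matrix
  assumes "a \<in> alt_set n" "\<And>i j. 2 dvd a i j"
  obtains b where "b \<in> alt_set n" "a = msc 2 b"
proof
  define b where "b = (\<lambda>i j. half (a i j))"
  show eq: "a = msc 2 b" by (intro matrix_eqI) (simp add: msc_apply b_def two_half[OF assms(2)])
  show "b \<in> alt_set n" using assms(1) two_z2adic_nonzero unfolding eq by (rule alt_set_cancel)
qed

lemma alt2_odd_entries:
  assumes n: "n \<ge> 5" "odd n" and x: "x \<in> alt2 n" "\<not> 2 dvd x i j"
  shows "unif n x False"
proof -
  obtain q where a: "x \<in> alt_set n" and q: "unif n x q" using x(1) alt2_iff[OF n] by metis
  have "i \<in> {1..n}" "j \<in> {1..n}" "i \<noteq> j"
    using x(2) alt_setD(2,3,4)[OF a] by (metis dvd_0_right)+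
  then have "\<not> q" using unifD[OF q] x(2) by metis
  then show ?thesis using q by (cases q) auto
qed

text \<open>A matrix \<open>x\<close> with odd off-diagonal entries and the transposition \<open>(2 3)\<close> produce twice a
  matrix outside \<open>alt1 n\<close>: all terms but \<open>x 2 3\<close> cancel in its coordinate sum.\<close>

lemma alt2_two_alt:
  assumes n: "n \<ge> 5" "odd n" and X: "inv_lattice n X" and x: "x \<in> X" "unif n x False"
  obtains y where "y \<in> alt_set n" "y \<notin> alt1 n" "msc 2 y \<in> X"
proof -
  define z where "z = x - mact (tp 2 3) x"
  have p: "tp 2 3 permutes {1..n}" using n by (intro permutes_swap_id) auto
  have xa: "x \<in> alt_set n" using latticeD(1)[OF X x(1)] .
  have zX: "z \<in> X"
    unfolding z_def by (rule latticeD(7)[OF X x(1) latticeD(5)[OF X p x(1)]])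
  have za: "z \<in> alt_set n" using latticeD(1)[OF X zX] .
  have "unif n (mact (tp 2 3) x) False"
  proof (rule unifI)
    fix i j assume "i \<in> {1..n}" "j \<in> {1..n}" "i \<noteq> j"
    then show "2 dvd mact (tp 2 3) x i j \<longleftrightarrow> False"
      unfolding mact_apply pinv_tp 
      by (intro unifD[OF x(2)]) (simp_all only: permutes_in_image[OF p] inj_eq[OF permutes_inj[OF p]] not_False_eq_True)
  qed
  \<comment> \<open>Both terms of \<open>z\<close> have odd entries off the diagonal, so
    \<open>z\<close> can be halved.\<close>
  then have ev: "2 dvd z i j" if "i \<in> {1..n}" "j \<in> {1..n}" "i \<noteq> j" for i j
    unfolding z_def diff_matrix_apply two_dvd_diff_iff using unifD[OF x(2) that] unifD[OF _ that] by metis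
  have "2 dvd z i j" for i j
    using ev[of i j] alt_setD(2,3,4)[OF za] by (metis dvd_0_right)
  then obtain y where y: "y \<in> alt_set n" "z = msc 2 y" using halve_alt[OF za] by metis
  let ?I = "specht_idx n" and ?t = "\<lambda>p. (tp 2 3 (fst p), tp 2 3 (snd p))"
  have q: "(2, 3) \<in> ?I" using n by (simp add: specht_idx_iff)
  \<comment> \<open>Swapping 2 and 3 keeps the order in every index pair except
    \<open>(2, 3)\<close>, so it permutes the other pairs and their contributions cancel in
    \<open>psum n z\<close>.\<close>
  have t: "?t p \<in> ?I - {(2, 3)}" "?t (?t p) = p" if "p \<in> ?I - {(2, 3)}" for p
    using that by (auto simp: specht_idx_def Transposition.transpose_def)
  have "(\<Sum>p \<in> ?I - {(2, 3)}. coord (mact (tp 2 3) x) p) = (\<Sum>p \<in> ?I - {(2, 3)}. coord x p)"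
    by (rule sum.reindex_bij_witness[of _ ?t ?t]) (use t in \<open>simp_all add: coord_def mact_apply pinv_tp\<close>)
  moreover have "coord (mact (tp 2 3) x) (2, 3) = - x 2 3"
    using alt_setD(1)[OF xa, of 3 2] by (simp add: coord_def mact_apply pinv_tp)
  ultimately have "psum n z = 2 * x 2 3"
    unfolding z_def psum_simps psum_def sum.remove[OF finite_specht_idx q]
    by (simp add: coord_def sum_subtractf)
  then have "2 * psum n y = 2 * x 2 3" using y(2) by (simp add: psum_simps)
  then have "psum n y = x 2 3" using two_z2adic_nonzero by simp
  then have "\<not> 2 dvd psum n y" using unifD[OF x(2), of 2 3] n by simp
  then show ?thesis using that[of y] y zX by (simp add: alt1_def)
qed

text \<open>The odd entry of \<open>x\<close> says that \<open>X\<close> is not contained in 2 S;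
  this normalization excludes the proper multiples of the three lattices.\<close>

theorem lattice_classification:
  assumes n: "n \<ge> 5" "odd n" and X: "inv_lattice n X" and x: "x \<in> X" "\<not> 2 dvd x i j"
  shows "X = alt_set n \<or> X = alt1 n \<or> X = alt2 n"
proof (cases "X \<subseteq> alt2 n")
  case False
  then obtain z where z: "z \<in> X" "z \<notin> alt2 n" by blast
  obtain u w s t where d: "distinct [u, w, s, t]" "{u, w, s, t} \<subseteq> {1..n}" "\<not> 2 dvd sq z u w s t"
    using sq_odd_exists[OF n latticeD(1)[OF X z(1)] z(2)] .
  have "msc 1 ` alt1 n \<subseteq> X"
    using alt1_subset_of_odd_sq[OF n(1) X z(1) d(1,2) _ d(3), of 1] by simp
  then have "alt1 n \<subseteq> X" by auto
  then show ?thesis using alt1_maximal[OF X] by blast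
next
  case True
  have "x \<in> alt2 n" using True x(1) by (rule subsetD)
  from alt2_odd_entries[OF n this x(2)] have odd: "unif n x False" .
  obtain u w s t e where d: "distinct [u, w, s, t]" "{u, w, s, t} \<subseteq> {1..n}" "sq x u w s t = 2 * e" "\<not> 2 dvd e"
    using sq_half_odd_exists[OF n latticeD(1)[OF X x(1)] odd] .
  have "msc 2 ` alt1 n \<subseteq> X"
    using alt1_subset_of_odd_sq[OF n(1) X x(1) d] .
  \<comment> \<open>Dividing by 2 reduces 2 S \<subseteq> \<open>X\<close> to the maximality of
    \<open>alt1 n\<close>: \<open>Y\<close> contains it and also a matrix outside it.\<close>
  define Y where "Y = {y \<in> alt_set n. msc 2 y \<in> X}"
  have Y: "inv_lattice n Y" unfolding Y_def by (rule lattice_preimage[OF X])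
  have "alt1 n \<subseteq> Y" using \<open>msc 2 ` alt1 n \<subseteq> X\<close> by (auto simp: Y_def alt1_def)
  moreover obtain y where "y \<in> Y" "y \<notin> alt1 n"
    using alt2_two_alt[OF n X x(1) odd] unfolding Y_def by blast
  ultimately have "Y = alt_set n" by (intro alt1_maximal[OF Y])
  then have two: "msc 2 y \<in> X" if "y \<in> alt_set n" for y using that by (auto simp: Y_def)
  have "z \<in> X" if z: "z \<in> alt2 n" for z
  proof -
    have lift: "b \<in> X" if b: "b \<in> alt2 n" "unif n b True" for b
    proof -
      have ba: "b \<in> alt_set n" using b(1) by (simp add: alt2_def)
      have "2 dvd b i j" for i j
        using unifD[OF b(2), of i j] alt_setD(2,3,4)[OF ba] by (metis dvd_0_right)
      then obtain c where "c \<in> alt_set n" "b = msc 2 c" using halve_alt[OF ba] by metis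
      then show ?thesis using two by simp
    qed
    obtain q where q: "unif n z q" using z alt2_iff[OF n] by metis
    show ?thesis
    proof (cases q)
      case True
      then show ?thesis using lift[OF z] q by simp
    next
      case False
      \<comment> \<open>Both matrices are odd off the diagonal, so their difference lies in 2 S and
        hence in \<open>X\<close>.\<close>
      have "unif n (z - x) True"
        by (rule unifI) (use q odd False in \<open>simp add: unif_def two_dvd_diff_iff\<close>)
      moreover have "z - x \<in> alt2 n"
        using latticeD(7)[OF lattice_alt2[OF n] z] True x(1) by blast
      ultimately have "z - x + x \<in> X" using lift latticeD(3)[OF X _ x(1)] by blast
      then show ?thesis by simp
    qed
  qed
  with True show ?thesis by blast
qed

section \<open>Equivariant maps between the three lattices\<close>

abbreviation sublat :: "nat \<Rightarrow> z2matrix set \<Rightarrow> (z2adic, nat \<Rightarrow> nat, z2matrix) gmod"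
  where "sublat n X \<equiv> alt_mod n\<lparr>carrier := X\<rparr>"

lemma gsublattice_lattice: "inv_lattice n X \<Longrightarrow> gsublattice class_ring (sym_group n) (alt_mod n) X"
  by (rule gsublatticeI[OF alt_mod_gmodule]) (auto simp: latticeD sym_group_carrier)

lemma sublat_gmodule: "inv_lattice n X \<Longrightarrow> gmodule class_ring (sym_group n) (sublat n X)"
  by (rule gmodule_gsublattice[OF alt_mod_gmodule gsublattice_lattice])

text \<open>Up to scalars, \<open>tri 1 2 3\<close> is the only matrix negated by the transpositions of \<open>{1, 2, 3}\<close> and
  fixed by those of \<open>{4, \<dots>, n}\<close>, so every endomorphism multiplies it by a scalar.\<close>

lemma alt_endo_scalar:
  fixes f :: "z2matrix \<Rightarrow> z2matrix"
  assumes n: "n \<ge> 3" and hom: "gmod_hom class_ring (sym_group n) (alt_mod n) (alt_mod n) f"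
  obtains c where "\<And>a. a \<in> alt_set n \<Longrightarrow> f a = msc c a"
proof
  note h = gmod_homD[OF hom, simplified]
  have f_mact: "f (mact g a) = mact g (f a)" if "g permutes {1..n}" "a \<in> alt_set n" for g a
    using h(4) that by (simp add: sym_group_carrier)
  have f_minus: "f (- a) = - f a" if "a \<in> alt_set n" for a
    using h(3)[OF that, of "- 1"] by simp
  let ?d = "tri 1 2 3 :: z2matrix"
  define z where "z = f ?d"
  have d: "?d \<in> alt_set n" using n by (intro tri_alt) auto
  have z: "z \<in> alt_set n" unfolding z_def using h(1) d .
  have tp: "tp u v permutes {1..n}" if "u \<in> {1..n}" "v \<in> {1..n}" for u v
    using that by (rule permutes_swap_id)
  have act: "z (tp u v i) (tp u v j) = - z i j"
    if uv: "u \<in> {1..n}" "v \<in> {1..n}" and m: "mact (tp u v) ?d = - ?d" for u v i j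
  proof -
    have "mact (tp u v) z = - z"
      unfolding z_def using f_mact[OF tp[OF uv] d] f_minus[OF d] m by simp
    then show ?thesis by (metis mact_apply minus_matrix_apply pinv_tp)
  qed
  have r: "1 \<in> {1..n}" "2 \<in> {1..n}" "3 \<in> {1..n}" using n by auto
  have flip: "tri 2 1 3 = - ?d" "tri 1 3 2 = - ?d" "tri 3 2 1 = - ?d"
    using tri_swap[of 2 1 3] tri_swap[of 3 1 2] tri_swap[of 3 2 1] tri_rotate[of 1 2 3] tri_rotate[of 2 3 1]
      tri_rotate[of 3 1 2] tri_rotate[of 1 3 2] by metis+
  have m: "mact (tp 1 2) ?d = - ?d" "mact (tp 2 3) ?d = - ?d" "mact (tp 1 3) ?d = - ?d"
    unfolding mact_tri[OF tp[OF r(1,2)]] mact_tri[OF tp[OF r(2,3)]] mact_tri[OF tp[OF r(1,3)]]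
    using flip by simp_all
  note a12 = act[OF r(1,2) m(1)] and a23 = act[OF r(2,3) m(2)] and a13 = act[OF r(1,3) m(3)]
  define c where "c = z 1 2"
  have "z = msc c ?d"
  proof (rule alt_set_eqI[OF z alt_set_msc[OF d]])
    fix p assume "p \<in> specht_idx n"
    then obtain i j where p: "p = (i, j)" "2 \<le> i" "i < j" "j \<le> n"
      by (cases p) (simp add: specht_idx_iff)
    have cancel: "x = 0" if "x = - x" for x :: z2adic
    proof -
      have "2 * x = 0" using that by (metis add.right_inverse mult_2)
      then show ?thesis using two_z2adic_nonzero by simp
    qed
    have "z i j = c * ?d i j"
    proof (cases "j = 3")
      case True
      then have ij: "i = 2" "j = 3" using p by auto
      have "z 3 2 = - z 1 2" using a13[of 1 2] by (simp add: Transposition.transpose_def)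
      then have "z 2 3 = c" using alt_setD(1)[OF z, of 2 3] by (simp add: c_def)
      then show ?thesis using ij by (simp add: tri_def arc_def)
    next
      case j: False
      then have j4: "j \<ge> 4" using p by auto
      have "?d i j = 0" using j4 p by (simp add: tri_def arc_def)
      moreover have "z i j = 0"
      proof (cases "i \<le> 3")
        case True
        then have "i = 2 \<or> i = 3" using p by auto
        \<comment> \<open>As \<open>j\<close> lies outside the triangle, three sign changes around
          it make \<open>z 3 j\<close> its own negative.\<close>
        moreover have "z 2 j = - z 1 j" "z 3 j = - z 1 j" "z 3 j = - z 2 j"
          using a12[of 1 j] a13[of 1 j] a23[of 2 j] j4 by (simp_all add: Transposition.transpose_def)
        then have "z 2 j = 0" "z 3 j = 0" using cancel by (metis minus_minus)+
        ultimately show ?thesis by metis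
      next
        case False
        have pt: "tp i j permutes {1..n}" using p by (intro tp) auto
        have "tp i j 1 = 1" "tp i j 2 = 2" "tp i j 3 = 3"
          using False j4 by (auto simp: Transposition.transpose_def)
        \<comment> \<open>Both indices lie outside the triangle, so the transposition fixes it and
          \<open>z\<close> with it; a symmetric and antisymmetric entry vanishes.\<close>
        then have "mact (tp i j) ?d = ?d" unfolding mact_tri[OF pt] by metis
        then have "mact (tp i j) z = z"
          unfolding z_def by (simp only: f_mact[OF pt d, symmetric])
        then have "z j i = z i j" by (metis mact_apply pinv_tp transpose_apply_first transpose_apply_second)
        then show ?thesis using alt_setD(1)[OF z, of i j] cancel by metis
      qed
      ultimately show ?thesis by simp
    qed
    then show "coord z p = coord (msc c ?d) p" by (simp add: p coord_def msc_apply)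
  qed
  then have fd: "f ?d = msc c ?d" by (simp add: z_def)
  show "f a = msc c a" if "a \<in> alt_set n" for a
    using that
  proof (induction a rule: alt_induct)
    case zero
    show ?case using h(3)[OF d, of 0] by (simp only: msc_simps)
  next
    case (btri p)
    then obtain i j where p: "p = (i, j)" "2 \<le> i" "i < j" "j \<le> n"
      by (cases p) (simp add: specht_idx_iff)
    \<comment> \<open>Every basis triangle is an image of \<open>tri 1 2 3\<close>, so equivariance
      carries the scalar \<open>c\<close> to the whole basis.\<close>
    obtain g where g: "g permutes {1..n}" "map g [1, 2, 3] = [1, i, j]"
      using permutes_list_exists[of "[1, 2, 3]" "[1, i, j]" "{1..n}"] p n by auto
    have "g 1 = 1" "g 2 = i" "g 3 = j" using g(2) by simp_all
    then have "btri p = mact g ?d" unfolding mact_tri[OF g(1)] btri_def p fst_conv snd_conv by metis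
    then show ?case using f_mact[OF g(1) d] fd by (simp only: mact_simps)
  next
    case (add a b)
    then show ?case using h(2) by (simp only: msc_add)
  next
    case (msc r a)
    then show ?case using h(3) by (simp add: mult.commute)
  qed
qed

lemma ones_alt2:
  assumes "n \<ge> 5"
  obtains a where "a \<in> alt2 n" "\<not> 2 dvd a 2 3"
proof
  let ?a = "\<Sum>p \<in> specht_idx n. msc 1 (btri p) :: z2matrix"
  have c: "coord ?a p = 1" if "p \<in> specht_idx n" for p using coord_comb[OF that, of "\<lambda>_. 1"] by simp
  have idx: "(n - 1, n) \<in> specht_idx n" "(2, 3) \<in> specht_idx n" using assms by (auto simp: specht_idx_iff)
  have "2 dvd coord ?a p - coord ?a (n - 1, n)" if "p \<in> specht_idx n" for p
    unfolding c[OF that] c[OF idx(1)] by simp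
  then show "?a \<in> alt2 n" unfolding alt2_def using comb_alt[of "\<lambda>_. 1" n] by blast
  have "?a 2 3 = 1" using c[OF idx(2)] by (simp only: coord_def fst_conv snd_conv)
  then show "\<not> 2 dvd ?a 2 3" using not_two_dvd_one by metis
qed

lemma cyc_alt1:
  assumes "distinct [u, s, w, t]" "{u, s, w, t} \<subseteq> {1..n}"
  shows "cyc u s w t \<in> alt1 n"
proof -
  have "\<not> 2 dvd psum n (tri u s w)" "\<not> 2 dvd psum n (tri u t w)"
    using assms by (intro psum_tri_odd; simp)+
  then show ?thesis using assms by (simp add: alt1_def cyc_alt, simp add: cyc_eq_tri psum_simps two_dvd_diff_iff)
qed

text \<open>An isomorphism \<open>f\<close> is given on \<open>X\<close> only, but
  \<open>f (msc 2 a)\<close> is defined for all of S and is therefore a scalar \<open>c\<close>. The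
  cycle in \<open>X\<close> has an entry 1, which forces \<open>c\<close> to be even, and
  \<open>f\<close> itself is multiplication by half of it.\<close>

lemma iso_scalar:
  assumes n: "n \<ge> 5" and two: "\<And>a. a \<in> alt_set n \<Longrightarrow> msc 2 a \<in> X"
    and X: "X \<subseteq> alt_set n" "cyc 1 2 3 4 \<in> X" and Y: "Y \<subseteq> alt_set n"
    and iso: "gmod_iso class_ring (sym_group n) (sublat n X) (sublat n Y)"
  obtains e where "Y = msc e ` X"
proof -
  obtain f where f: "gmod_hom class_ring (sym_group n) (sublat n X) (sublat n Y) f" "bij_betw f X Y"
    using iso by (auto simp: gmod_iso_iff)
  note h = gmod_homD[OF f(1), simplified]
  have "gmod_hom class_ring (sym_group n) (alt_mod n) (alt_mod n) (\<lambda>a. f (msc 2 a))"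
  proof (rule gmod_homI)
    fix a b :: z2matrix and r g assume "a \<in> carrier (alt_mod n)"
    then have a: "msc 2 a \<in> X" using two by simp
    show "f (msc 2 a) \<in> carrier (alt_mod n)" using h(1)[OF a] Y by auto
    show "f (msc 2 (r \<odot>\<^bsub>alt_mod n\<^esub> a)) = r \<odot>\<^bsub>alt_mod n\<^esub> f (msc 2 a)"
      using h(3)[OF a, of r] by (simp add: mult.commute)
    show "f (msc 2 (act (alt_mod n) g a)) = act (alt_mod n) g (f (msc 2 a))"
      if "g \<in> carrier (sym_group n)"
      using h(4)[OF that a] by (simp add: mact_simps)
    show "f (msc 2 (a \<oplus>\<^bsub>alt_mod n\<^esub> b)) = f (msc 2 a) \<oplus>\<^bsub>alt_mod n\<^esub> f (msc 2 b)"
      if "b \<in> carrier (alt_mod n)"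
      using h(2)[OF a two] that by (simp add: msc_add)
  qed
  then obtain c where c: "\<And>a. a \<in> alt_set n \<Longrightarrow> f (msc 2 a) = msc c a"
    using alt_endo_scalar[of n "\<lambda>a. f (msc 2 a)"] n by auto
  have fc: "2 * f a i j = c * a i j" if "a \<in> X" for a i j
  proof -
    have "msc 2 (f a) = msc c a" using c[of a] h(3)[OF that, of 2] X(1) that by auto
    then show ?thesis by (metis msc_apply)
  qed
  have "cyc 1 2 3 4 1 2 = (1 :: z2adic)" by (simp add: cyc_def arc_def)
  then have "c = 2 * f (cyc 1 2 3 4) 1 2" using fc[OF X(2), of 1 2] by simp
  then obtain e where e: "c = 2 * e" by blast
  have "f a = msc e a" if "a \<in> X" for a
  proof (rule matrix_eqI)
    fix i j
    have "2 * f a i j = 2 * (e * a i j)" using fc[OF that] by (simp only: e mult.assoc)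
    then show "f a i j = msc e a i j" using two_z2adic_nonzero by (simp add: msc_apply)
  qed
  then have "Y = msc e ` X" using f(2) unfolding bij_betw_def by (metis image_cong)
  then show ?thesis by (rule that)
qed

text \<open>A triangle has odd coordinate sum, so the scalar taking S into \<open>alt1 n\<close>
  must be even; but a 4-cycle, which has an entry 1, would then not be reached.\<close>

lemma not_iso_alt_alt1:
  assumes n: "n \<ge> 5"
  shows "\<not> gmod_iso class_ring (sym_group n) (sublat n (alt_set n)) (sublat n (alt1 n))"
proof
  assume iso: "gmod_iso class_ring (sym_group n) (sublat n (alt_set n)) (sublat n (alt1 n))"
  have C: "cyc 1 2 3 4 \<in> alt1 n" using n by (intro cyc_alt1) auto
  have sub: "alt1 n \<subseteq> alt_set n" by (auto simp: alt1_def)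
  obtain e where e: "alt1 n = msc e ` alt_set n"
    using iso_scalar[OF n alt_set_msc subset_refl subsetD[OF sub C] sub iso] .
  have "tri 1 2 3 \<in> alt_set n" using n by (intro tri_alt) auto
  then have "msc e (tri 1 2 3) \<in> alt1 n" unfolding e by (rule imageI)
  then have "2 dvd e * psum n (tri 1 2 3)" by (simp add: alt1_def psum_simps)
  moreover have "\<not> 2 dvd psum n (tri 1 2 3)" using n by (intro psum_tri_odd) auto
  ultimately have ev: "2 dvd e" by (simp add: two_dvd_mult_iff)
  obtain a where "cyc 1 2 3 4 = msc e a" using C unfolding e by blast
  then have "cyc 1 2 3 4 1 2 = e * a 1 2" by (simp add: msc_apply)
  moreover have "cyc 1 2 3 4 1 2 = (1 :: z2adic)" by (simp add: cyc_def arc_def)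
  ultimately show False using ev not_two_dvd_one by (metis dvd_mult2)
qed

text \<open>The multiple of the 4-cycle has the entries \<open>e\<close> and 0 off the diagonal, so
  uniform parity makes \<open>e\<close> even; but \<open>alt2 n\<close> contains a matrix with an
  odd entry.\<close>

lemma not_iso_alt2:
  assumes n: "n \<ge> 5" "odd n" and two: "\<And>a. a \<in> alt_set n \<Longrightarrow> msc 2 a \<in> X"
    and X: "X \<subseteq> alt_set n" "cyc 1 2 3 4 \<in> X"
  shows "\<not> gmod_iso class_ring (sym_group n) (sublat n X) (sublat n (alt2 n))"
proof
  assume iso: "gmod_iso class_ring (sym_group n) (sublat n X) (sublat n (alt2 n))"
  have sub: "alt2 n \<subseteq> alt_set n" by (auto simp: alt2_def)
  obtain e where e: "alt2 n = msc e ` X"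
    using iso_scalar[OF n(1) two X sub iso] by blast
  have "msc e (cyc 1 2 3 4) \<in> alt2 n" unfolding e using X(2) by (rule imageI)
  then obtain q where q: "unif n (msc e (cyc 1 2 3 4)) q" using alt2_iff[OF n] by metis
  have "msc e (cyc 1 2 3 4) 1 2 = e" "msc e (cyc 1 2 3 4) 1 3 = 0"
    by (simp_all add: msc_apply cyc_def arc_def)
  then have ev: "2 dvd e" using unifD[OF q, of 1 2] unifD[OF q, of 1 3] n by simp
  obtain b where b: "b \<in> alt2 n" "\<not> 2 dvd b 2 3" using ones_alt2[OF n(1)] .
  then obtain a where "b = msc e a" unfolding e by blast
  then show False using b(2) ev by (simp add: msc_apply)
qed

section \<open>Bases of the two proper sublattices\<close>

lemma half_add: "2 dvd x \<Longrightarrow> 2 dvd y \<Longrightarrow> half (x + y) = half x + half y"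
  by (rule half_eqI) (simp add: distrib_left two_half)

lemma half_mult: "2 dvd x \<Longrightarrow> half (r * x) = r * half x"
  by (rule half_eqI) (simp add: mult.left_commute two_half)

text \<open>The basis is twice one triangle \<open>btri q\<close> together with the differences of
  the others from it; half the coordinate sum is the coordinate at the first.\<close>

lemma alt1_coordinates:
  assumes n: "n \<ge> 5"
  shows "\<exists>e c. coordinates (sublat n (alt1 n)) (specht_idx n) e c"
proof -
  interpret gmodule class_ring "sym_group n" "sublat n (alt1 n)"
    by (rule sublat_gmodule[OF lattice_alt1])
  define q where "q = (2 :: nat, 3 :: nat)"
  have q: "q \<in> specht_idx n" using n by (simp add: q_def specht_idx_iff)
  define e :: "nat \<times> nat \<Rightarrow> z2matrix" where "e p = (if p = q then msc 2 (btri q) else btri p - btri q)" for p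
  define c :: "z2matrix \<Rightarrow> nat \<times> nat \<Rightarrow> z2adic" where "c a p = (if p = q then half (psum n a) else coord a p)" for a p
  have psum_btri: "psum n (btri p) = 1" if "p \<in> specht_idx n" for p
    unfolding psum_def using that by (simp add: coord_btri finite_specht_idx)
  have half: "half 0 = 0" "half 2 = 1" by (rule half_eqI; simp)+
  have "coordinates (sublat n (alt1 n)) (specht_idx n) e c"
  proof
    show "e p \<in> carrier (sublat n (alt1 n))" if "p \<in> specht_idx n" for p
      using that q by (simp add: e_def alt1_def btri_alt alt_set_diff alt_set_msc psum_simps psum_btri)
    show "c (x \<oplus>\<^bsub>sublat n (alt1 n)\<^esub> y) p = c x p + c y p"
      if "x \<in> carrier (sublat n (alt1 n))" "y \<in> carrier (sublat n (alt1 n))" for x y p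
      using that by (simp add: c_def psum_simps alt1_def half_add)
    show "c (r \<odot>\<^bsub>sublat n (alt1 n)\<^esub> x) p = r * c x p"
      if "x \<in> carrier (sublat n (alt1 n))" for x p r
      using that by (simp add: c_def psum_simps alt1_def half_mult)
    show "c (e p) p' = (if p = p' then 1 else 0)" if "p \<in> specht_idx n" "p' \<in> specht_idx n" for p p'
      using that q by (simp add: c_def e_def psum_simps psum_btri half coord_btri)
    show "x = \<zero>\<^bsub>sublat n (alt1 n)\<^esub>"
      if x: "x \<in> carrier (sublat n (alt1 n))" and 0: "\<And>p. p \<in> specht_idx n \<Longrightarrow> c x p = 0" for x
    proof -
      have ne: "coord x p = 0" if "p \<in> specht_idx n" "p \<noteq> q" for p
        using 0[OF that(1)] that(2) by (simp add: c_def)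
      have "2 dvd psum n x" using x by (simp add: alt1_def)
      then have "psum n x = 0" using 0[OF q] two_half by (simp add: c_def) (metis mult_zero_right)
      moreover have "psum n x = coord x q"
        unfolding psum_def sum.remove[OF finite_specht_idx q] using ne by simp
      ultimately have "coord x p = 0" if "p \<in> specht_idx n" for p using ne that by (cases "p = q") auto
      moreover have "x \<in> alt_set n" using x by (auto simp: alt1_def)
      ultimately have "x = 0" using alt_set_zeroI by blast
      then show ?thesis by simp
    qed
  qed (rule finite_specht_idx)
  then show ?thesis by blast
qed

text \<open>The basis consists of the matrix with all coordinates 1, placed at the reference index
  \<open>(n - 1, n)\<close>, and of twice the other triangles.\<close>

lemma alt2_coordinates:
  assumes n: "n \<ge> 5" "odd n"
  shows "\<exists>e c. coordinates (sublat n (alt2 n)) (specht_idx n) e c"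
proof -
  interpret gmodule class_ring "sym_group n" "sublat n (alt2 n)"
    by (rule sublat_gmodule[OF lattice_alt2[OF n]])
  define q where "q = (n - 1, n)"
  have q: "q \<in> specht_idx n" using n by (simp add: q_def specht_idx_iff)
  define ones where "ones = (\<Sum>p \<in> specht_idx n. msc 1 (btri p) :: z2matrix)"
  have ones: "ones \<in> alt_set n" "\<And>p. p \<in> specht_idx n \<Longrightarrow> coord ones p = 1"
    unfolding ones_def using comb_alt[of "\<lambda>_. 1" n] coord_comb[of _ n "\<lambda>_. 1"] by simp_all
  define e :: "nat \<times> nat \<Rightarrow> z2matrix" where "e p = (if p = q then ones else msc 2 (btri p))" for p
  define c :: "z2matrix \<Rightarrow> nat \<times> nat \<Rightarrow> z2adic" where "c a p = (if p = q then coord a q else half (coord a p - coord a q))" for a p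
  have half: "half 0 = 0" "half 2 = 1" by (rule half_eqI; simp)+
  have ev: "2 dvd coord x p - coord x q" if "x \<in> alt2 n" "p \<in> specht_idx n" for x p
    using that by (simp add: alt2_def q_def)
  have "coordinates (sublat n (alt2 n)) (specht_idx n) e c"
  proof
    show "e p \<in> carrier (sublat n (alt2 n))" if "p \<in> specht_idx n" for p
      using that q ones by (simp add: e_def alt2_def btri_alt alt_set_msc q_def)
    show "c (x \<oplus>\<^bsub>sublat n (alt2 n)\<^esub> y) p = c x p + c y p"
      if "x \<in> carrier (sublat n (alt2 n))" "y \<in> carrier (sublat n (alt2 n))" "p \<in> specht_idx n" for x y p
      using half_add[OF ev[of x p] ev[of y p]] that by (simp add: c_def algebra_simps)
    show "c (r \<odot>\<^bsub>sublat n (alt2 n)\<^esub> x) p = r * c x p"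
      if "x \<in> carrier (sublat n (alt2 n))" "p \<in> specht_idx n" for x p r
      using half_mult[OF ev[of x p], of r] that by (simp add: c_def right_diff_distrib)
    show "c (e p) p' = (if p = p' then 1 else 0)" if "p \<in> specht_idx n" "p' \<in> specht_idx n" for p p'
      using that q by (simp add: c_def e_def half coord_btri ones)
    show "x = \<zero>\<^bsub>sublat n (alt2 n)\<^esub>"
      if x: "x \<in> carrier (sublat n (alt2 n))" and 0: "\<And>p. p \<in> specht_idx n \<Longrightarrow> c x p = 0" for x
    proof -
      have xq: "coord x q = 0" using 0[OF q] by (simp add: c_def)
      have "coord x p = 0" if "p \<in> specht_idx n" for p
      proof (cases "p = q")
        case False
        then have "half (coord x p) = 0" using 0[OF that] xq by (simp add: c_def)
        moreover have "2 dvd coord x p" using ev[of x p] x that xq by simp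
        ultimately show ?thesis using two_half by (metis mult_zero_right)
      qed (simp add: xq)
      moreover have "x \<in> alt_set n" using x by (auto simp: alt2_def)
      ultimately have "x = 0" using alt_set_zeroI by blast
      then show ?thesis by simp
    qed
  qed (rule finite_specht_idx)
  then show ?thesis by blast
qed

section \<open>Quotients by bilinear relations\<close>

text \<open>\<open>Rl\<close> may exceed the bilinear relations, because the exterior square adds
  the relations for equal factors.\<close>

locale bilinear_quotient = free_quotient "carrier M \<times> carrier N" Rl K
  for M :: "('r::comm_ring_1, 'm, 'c) module_scheme" and N :: "('r, 'n, 'd) module_scheme"
    and Rl :: "('m \<times> 'n \<Rightarrow>\<^sub>0 'r) set" and K :: "('m \<times> 'n \<Rightarrow>\<^sub>0 'r) set" +
  assumes rels: "bilinear_rels M N \<subseteq> Rl"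
begin

abbreviation sing :: "'m \<Rightarrow> 'n \<Rightarrow> 'r \<Rightarrow> ('m \<times> 'n \<Rightarrow>\<^sub>0 'r)"
  where "sing x y \<equiv> Poly_Mapping.single (x, y)"

text \<open>The relations are given with coefficient 1; scaling them yields arbitrary coefficients,
  here and in the next three lemmas.\<close>

lemma K_add_left:
  assumes "x \<in> carrier M" "x' \<in> carrier M" "y \<in> carrier N"
  shows "sing (x \<oplus>\<^bsub>M\<^esub> x') y r - (sing x y r + sing x' y r) \<in> K"
proof -
  have "sing (x \<oplus>\<^bsub>M\<^esub> x') y 1 - sing x y 1 - sing x' y 1 \<in> bilinear_rels M N"
    unfolding bilinear_rels_def Let_def using assms by blast
  then have "scale r (sing (x \<oplus>\<^bsub>M\<^esub> x') y 1 - sing x y 1 - sing x' y 1) \<in> K"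
    using rels by (intro K_scale K_rel) blast
  then show ?thesis by (simp add: diff_diff_eq)
qed

lemma K_add_right:
  assumes "x \<in> carrier M" "y \<in> carrier N" "y' \<in> carrier N"
  shows "sing x (y \<oplus>\<^bsub>N\<^esub> y') r - (sing x y r + sing x y' r) \<in> K"
proof -
  have "sing x (y \<oplus>\<^bsub>N\<^esub> y') 1 - sing x y 1 - sing x y' 1 \<in> bilinear_rels M N"
    unfolding bilinear_rels_def Let_def using assms by blast
  then have "scale r (sing x (y \<oplus>\<^bsub>N\<^esub> y') 1 - sing x y 1 - sing x y' 1) \<in> K"
    using rels by (intro K_scale K_rel) blast
  then show ?thesis by (simp add: diff_diff_eq)
qed

lemma K_smult_left:
  assumes "x \<in> carrier M" "y \<in> carrier N"
  shows "sing (c \<odot>\<^bsub>M\<^esub> x) y r - sing x y (r * c) \<in> K"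
proof -
  have "sing (c \<odot>\<^bsub>M\<^esub> x) y 1 - sing x y c \<in> bilinear_rels M N"
    unfolding bilinear_rels_def Let_def using assms by blast
  then have "scale r (sing (c \<odot>\<^bsub>M\<^esub> x) y 1 - sing x y c) \<in> K"
    using rels by (intro K_scale K_rel) blast
  then show ?thesis by simp
qed

lemma K_smult_right:
  assumes "x \<in> carrier M" "y \<in> carrier N"
  shows "sing x (c \<odot>\<^bsub>N\<^esub> y) r - sing x y (r * c) \<in> K"
proof -
  have "sing x (c \<odot>\<^bsub>N\<^esub> y) 1 - sing x y c \<in> bilinear_rels M N"
    unfolding bilinear_rels_def Let_def using assms by blast
  then have "scale r (sing x (c \<odot>\<^bsub>N\<^esub> y) 1 - sing x y c) \<in> K"
    using rels by (intro K_scale K_rel) blast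
  then show ?thesis by simp
qed

lemma K_trans: "f - g \<in> K \<Longrightarrow> g - h \<in> K \<Longrightarrow> f - h \<in> K"
  using K_add[of "f - g" "g - h"] by simp

lemma K_sym: "f - g \<in> K \<Longrightarrow> g - f \<in> K"
  using K_minus[of "f - g"] by simp

lemma K_add_cong: "f - g \<in> K \<Longrightarrow> f' - g' \<in> K \<Longrightarrow> (f + f') - (g + g') \<in> K"
  using K_add[of "f - g" "f' - g'"] by (simp add: algebra_simps)

lemma K_sum_cong: "(\<And>x. x \<in> A \<Longrightarrow> h x - k x \<in> K) \<Longrightarrow> (\<Sum>x \<in> A. h x) - (\<Sum>x \<in> A. k x) \<in> K"
  by (induction A rule: infinite_finite_induct) (simp_all add: K_zero K_add_cong)

end

lemma bilinear_rels_keys: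
  assumes "\<And>x y. x \<in> carrier M \<Longrightarrow> y \<in> carrier M \<Longrightarrow> x \<oplus>\<^bsub>M\<^esub> y \<in> carrier M"
    and "\<And>r x. x \<in> carrier M \<Longrightarrow> r \<odot>\<^bsub>M\<^esub> x \<in> carrier M"
    and "\<And>x y. x \<in> carrier N \<Longrightarrow> y \<in> carrier N \<Longrightarrow> x \<oplus>\<^bsub>N\<^esub> y \<in> carrier N"
    and "\<And>r x. x \<in> carrier N \<Longrightarrow> r \<odot>\<^bsub>N\<^esub> x \<in> carrier N"
    and "f \<in> bilinear_rels M N"
  shows "Poly_Mapping.keys f \<subseteq> carrier M \<times> carrier N"
  using assms(5) unfolding bilinear_rels_def Let_def
  by (elim UnE CollectE exE conjE)
    (simp_all only:, (intro keys_subset_intros SigmaI assms; assumption)+)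

text \<open>\<open>h (x, y) r\<close> plays the part of \<open>r\<close> times a pairing of
  \<open>x\<close> and \<open>y\<close>; the assumptions express bilinearity.\<close>

lemma bilinear_rels_free_ext:
  fixes h :: "'m \<times> 'n \<Rightarrow> 'r::comm_ring_1 \<Rightarrow> 'c::ab_group_add"
  assumes "free_extension h"
    and "\<And>x x' y. x \<in> carrier M \<Longrightarrow> x' \<in> carrier M \<Longrightarrow> y \<in> carrier N \<Longrightarrow>
      h (x \<oplus>\<^bsub>M\<^esub> x', y) 1 = h (x, y) 1 + h (x', y) 1"
    and "\<And>x y y'. x \<in> carrier M \<Longrightarrow> y \<in> carrier N \<Longrightarrow> y' \<in> carrier N \<Longrightarrow>
      h (x, y \<oplus>\<^bsub>N\<^esub> y') 1 = h (x, y) 1 + h (x, y') 1"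
    and "\<And>r x y. x \<in> carrier M \<Longrightarrow> y \<in> carrier N \<Longrightarrow> h (r \<odot>\<^bsub>M\<^esub> x, y) 1 = h (x, y) r"
    and "\<And>r x y. x \<in> carrier M \<Longrightarrow> y \<in> carrier N \<Longrightarrow> h (x, r \<odot>\<^bsub>N\<^esub> y) 1 = h (x, y) r"
    and "f \<in> bilinear_rels M N"
  shows "free_ext h f = 0"
proof -
  interpret free_extension h by fact
  show ?thesis
    using assms(6) unfolding bilinear_rels_def Let_def
    by (elim UnE CollectE exE conjE) (simp_all add: ext_diff ext_single assms(2-5))
qed

section \<open>The Specht lattice as a lattice of matrices\<close>

lemma nat_specht_simps:
  "carrier (nat_specht n) = {f. Poly_Mapping.keys f \<subseteq> {1..n} \<and> (\<Sum>i = 1..n. Poly_Mapping.lookup f i) = 0}"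
  "add (nat_specht n) = (+)" "\<zero>\<^bsub>nat_specht n\<^esub> = 0" "smult (nat_specht n) = scale"
  "act (nat_specht n) = free_map"
  by (auto simp: nat_specht_def perm_lattice_def free_mod_def Module.module.defs fun_eq_iff)

lemma ext2_simps:
  "carrier (ext2 M) = a_rcosets\<^bsub>free_mod (carrier M \<times> carrier M)\<^esub> (ext2_kernel M)"
  "add (ext2 M) = set_add (free_mod (carrier M \<times> carrier M))"
  "\<zero>\<^bsub>ext2 M\<^esub> = ext2_kernel M"
  "smult (ext2 M) = (\<lambda>r. coset_map (free_mod (carrier M \<times> carrier M)) (ext2_kernel M)
    (\<lambda>x. r \<odot>\<^bsub>free_mod (carrier M \<times> carrier M)\<^esub> x))"
  "act (ext2 M) = (\<lambda>g. coset_map (free_mod (carrier M \<times> carrier M)) (ext2_kernel M)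
    (free_map (\<lambda>(x, y). (act M g x, act M g y))))"
  by (simp_all add: ext2_def quot_mod_def Let_def Module.module.defs)

section \<open>From formal sums of pairs to matrices\<close>

lemma lookup_free_map_perm:
  assumes "g permutes A"
  shows "Poly_Mapping.lookup (free_map g x) i = Poly_Mapping.lookup x (pinv g i)"
  using subset_UNIV
proof (induction x rule: free_induct)
  case (single k r)
  have "g k = i \<longleftrightarrow> k = pinv g i" using permutes_inv_eq[OF assms, of i k] by auto
  then show ?case by (simp add: free_map.ext_single lookup_single when_def)
qed (simp_all add: free_map.ext_zero free_map.ext_add lookup_add)

definition wmat :: "(nat \<Rightarrow>\<^sub>0 'r) \<Rightarrow> (nat \<Rightarrow>\<^sub>0 'r) \<Rightarrow> nat \<Rightarrow> nat \<Rightarrow> 'r::comm_ring_1"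
  where "wmat x y = (\<lambda>i j. Poly_Mapping.lookup x i * Poly_Mapping.lookup y j
    - Poly_Mapping.lookup x j * Poly_Mapping.lookup y i)"

definition beta :: "nat \<Rightarrow> nat \<Rightarrow>\<^sub>0 'r::comm_ring_1"
  where "beta i = Poly_Mapping.single i 1 - Poly_Mapping.single 1 1"

definition wmap :: "((nat \<Rightarrow>\<^sub>0 'r) \<times> (nat \<Rightarrow>\<^sub>0 'r) \<Rightarrow>\<^sub>0 'r) \<Rightarrow> nat \<Rightarrow> nat \<Rightarrow> 'r::comm_ring_1"
  where "wmap = free_ext (\<lambda>(x, y) r. msc r (wmat x y))"

interpretation wmap: free_extension "\<lambda>(x, y) r. msc r (wmat x y)"
  rewrites "free_ext (\<lambda>(x, y) r. msc r (wmat x y)) = wmap"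
  by unfold_locales (auto simp only: msc_add_left wmap_def split: prod.split)

lemma wmap_single: "wmap (Poly_Mapping.single (x, y) r) = msc r (wmat x y)"
  by (simp only: wmap.ext_single prod.case)

lemma wmap_scale: "wmap (scale r f) = msc r (wmap f)"
  by (rule wmap.ext_scale) (auto simp only: msc_add msc_simps split: prod.split)

lemma wmap_sum: "wmap (\<Sum>x \<in> A. h x) = (\<Sum>x \<in> A. wmap (h x))"
  by (induction A rule: infinite_finite_induct) (simp_all only: sum.infinite sum.empty sum.insert wmap.ext_zero wmap.ext_add not_False_eq_True)

lemma wmap_free_map:
  fixes f :: "(nat \<Rightarrow>\<^sub>0 'r) \<times> (nat \<Rightarrow>\<^sub>0 'r) \<Rightarrow>\<^sub>0 'r::comm_ring_1"
  assumes "g permutes A"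
  shows "wmap (free_map (\<lambda>(x, y). (free_map g x, free_map g y)) f) = mact g (wmap f)"
proof (rule wmap.ext_free_map[OF subset_UNIV])
  have "wmat (free_map g x) (free_map g y) = mact g (wmat x y)" for x y :: "nat \<Rightarrow>\<^sub>0 'r"
    by (rule matrix_eqI) (simp only: wmat_def mact_apply lookup_free_map_perm[OF assms])
  then show "(case case p of (x, y) \<Rightarrow> (free_map g x, free_map g y) of (x, y) \<Rightarrow> \<lambda>r. msc r (wmat x y)) r =
      mact g ((case p of (x, y) \<Rightarrow> \<lambda>r. msc r (wmat x y)) r)" for p :: "(nat \<Rightarrow>\<^sub>0 'r) \<times> (nat \<Rightarrow>\<^sub>0 'r)" and r
    by (cases p) (simp only: prod.case mact_simps)
qed (rule mact_simps)

lemma wmat_alt: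
  assumes "x \<in> carrier (nat_specht n)" "y \<in> carrier (nat_specht n)"
  shows "wmat x y \<in> alt_set n"
proof (rule alt_setI)
  have out: "Poly_Mapping.lookup x i = 0" "Poly_Mapping.lookup y i = 0" if "i \<notin> {1..n}" for i
    using assms that unfolding nat_specht_simps by (auto simp: in_keys_iff)
  fix i j
  show "wmat x y i j = - wmat x y j i" "wmat x y i i = 0" by (simp_all add: wmat_def mult.commute)
  show "wmat x y i j = 0" if "i \<notin> {1..n}" using out[OF that] by (simp add: wmat_def)
  have "(\<Sum>j = 1..n. wmat x y i j) = Poly_Mapping.lookup x i * (\<Sum>j = 1..n. Poly_Mapping.lookup y j)
      - (\<Sum>j = 1..n. Poly_Mapping.lookup x j) * Poly_Mapping.lookup y i"
    by (simp only: wmat_def sum_subtractf sum_distrib_left sum_distrib_right)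
  then show "(\<Sum>j = 1..n. wmat x y i j) = 0" using assms by (simp only: nat_specht_simps mem_Collect_eq mult_zero_left mult_zero_right diff_self)
qed

lemma wmap_alt:
  assumes "Poly_Mapping.keys f \<subseteq> carrier (nat_specht n) \<times> carrier (nat_specht n)"
  shows "wmap f \<in> alt_set n"
  using assms
  by (rule wmap.ext_mem) (auto intro: alt_set_zero alt_set_add alt_set_msc wmat_alt)

lemma lookup_beta:
  "Poly_Mapping.lookup (beta i) k = (if k = i then 1 else 0) - (if k = 1 then 1 else 0)"
  unfolding beta_def lookup_minus lookup_single when_def
  by (subst eq_commute[of i k], subst eq_commute[of 1 k]) (rule refl)

lemma wmat_beta: "wmat (beta i) (beta j) = (tri 1 i j :: nat \<Rightarrow> nat \<Rightarrow> 'r::comm_ring_1)"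
proof (rule matrix_eqI)
  fix k l
  \<comment> \<open>In terms of Kronecker deltas an arc is a 2 by 2 minor, and the claim becomes a
    polynomial identity.\<close>
  define d :: "nat \<Rightarrow> nat \<Rightarrow> 'r" where "d u v = (if u = v then 1 else 0)" for u v
  have arc: "arc u v k l = d k u * d l v - d k v * d l u" for u v
  proof -
    have "(if P \<and> Q then 1 else 0 :: 'r) = (if P then 1 else 0) * (if Q then 1 else 0)" for P Q
      by (cases P; cases Q) simp_all
    then show ?thesis by (simp only: arc_def d_def)
  qed
  have beta: "Poly_Mapping.lookup (beta u) v = d v u - d v 1" for u v
    by (simp only: lookup_beta d_def)
  show "wmat (beta i) (beta j) k l = (tri 1 i j k l :: 'r)"
    by (simp only: wmat_def tri_def add_matrix_apply arc beta) (simp only: algebra_simps)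
qed

lemma beta_closed:
  assumes "i \<in> {1..n}"
  shows "beta i \<in> carrier (nat_specht n)"
proof -
  have 1: "1 \<in> {1..n}" using assms by auto
  have "(\<Sum>k = 1..n. Poly_Mapping.lookup (beta i) k) = (\<Sum>k = 1..n. if k = i then 1 else 0) - (\<Sum>k = 1..n. if k = 1 then 1 else 0 :: 'a)"
    by (simp only: lookup_beta sum_subtractf)
  also have "\<dots> = 0" using assms 1 by simp
  finally show ?thesis
    unfolding nat_specht_simps beta_def using assms 1 by (auto intro!: keys_subset_intros del: subsetI)
qed

text \<open>The coefficients at indices from 2 on match directly, and the one at 1 is then fixed by
  the zero sum.\<close>

lemma beta_expansion:
  assumes "x \<in> carrier (nat_specht n)" "n \<ge> 1"
  shows "x = (\<Sum>i \<in> {2..n}. scale (Poly_Mapping.lookup x i) (beta i))"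
proof (rule poly_mapping_eqI)
  fix k
  have sum0: "(\<Sum>i = 1..n. Poly_Mapping.lookup x i) = 0" and keys: "Poly_Mapping.keys x \<subseteq> {1..n}"
    using assms by (simp_all add: nat_specht_simps)
  have "{1..n} = insert 1 {2..n}" using assms(2) by auto
  then have "Poly_Mapping.lookup x 1 + (\<Sum>i \<in> {2..n}. Poly_Mapping.lookup x i) = 0" using sum0 by simp
  then have one: "Poly_Mapping.lookup x 1 = - (\<Sum>i \<in> {2..n}. Poly_Mapping.lookup x i)" by (simp add: eq_neg_iff_add_eq_0)
  have "Poly_Mapping.lookup (\<Sum>i \<in> {2..n}. scale (Poly_Mapping.lookup x i) (beta i)) k =
      (\<Sum>i \<in> {2..n}. if i = k then Poly_Mapping.lookup x i else 0) -
      (\<Sum>i \<in> {2..n}. if k = 1 then Poly_Mapping.lookup x i else 0)"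
    unfolding lookup_sum sum_subtractf[symmetric]
    by (rule sum.cong) (auto simp: lookup_scale lookup_beta simp del: One_nat_def)
  also have "\<dots> = Poly_Mapping.lookup x k"
  proof (cases "k = 1")
    case True
    then show ?thesis using one by simp
  next
    case False
    then show ?thesis using keys by (auto simp: in_keys_iff)
  qed
  finally show "Poly_Mapping.lookup x k = Poly_Mapping.lookup (\<Sum>i \<in> {2..n}. scale (Poly_Mapping.lookup x i) (beta i)) k" ..
qed

section \<open>The exterior square by generators and relations\<close>

text \<open>The ring stays arbitrary, since both the 2-adic lattice and the rational module have to
  be identified with matrices.\<close>

locale specht_quotient =
  fixes n :: nat and Rl K :: "((nat \<Rightarrow>\<^sub>0 'r::comm_ring_1) \<times> (nat \<Rightarrow>\<^sub>0 'r) \<Rightarrow>\<^sub>0 'r) set"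
  assumes n_pos: "n \<ge> 1"
  defines "Rl \<equiv> bilinear_rels (nat_specht n) (nat_specht n) \<union>
      {Poly_Mapping.single (x, x) 1 | x. x \<in> carrier (nat_specht n)}"
    and "K \<equiv> ext2_kernel (nat_specht n)"
begin

abbreviation NN where "NN \<equiv> carrier (nat_specht n) \<times> carrier (nat_specht n)"

lemma nat_specht_closed:
  "x \<in> carrier (nat_specht n) \<Longrightarrow> y \<in> carrier (nat_specht n) \<Longrightarrow> x + y \<in> carrier (nat_specht n)"
  "x \<in> carrier (nat_specht n) \<Longrightarrow> scale r x \<in> carrier (nat_specht n)"
  "0 \<in> carrier (nat_specht n)"
  unfolding nat_specht_simps
  by (auto simp: lookup_add sum.distrib lookup_scale sum_distrib_left[symmetric]
      dest: subsetD[OF keys_add] subsetD[OF keys_scale])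

sublocale bilinear_quotient "nat_specht n" "nat_specht n" Rl K
proof
  show "Poly_Mapping.keys f \<subseteq> NN" if "f \<in> Rl" for f
    using that unfolding Rl_def
  proof
    assume "f \<in> bilinear_rels (nat_specht n) (nat_specht n)"
    then show ?thesis
      by (rule bilinear_rels_keys[rotated -1]) (simp_all only: nat_specht_simps(2,4) nat_specht_closed)
  qed auto
  show "K = LinearCombinations.module.span class_ring (free_mod NN) Rl"
    unfolding K_def ext2_kernel_def Rl_def ..
  show "bilinear_rels (nat_specht n) (nat_specht n) \<subseteq> Rl" by (simp add: Rl_def)
qed

lemma K_alternating: "x \<in> carrier (nat_specht n) \<Longrightarrow> sing x x r \<in> K"
  using K_scale[OF K_rel[of "sing x x 1"], of r] by (auto simp: Rl_def)

text \<open>Expand the relation for the pair \<open>x + y\<close>, \<open>x + y\<close> and remove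
  the two terms with equal factors.\<close>

lemma K_antisym:
  assumes x: "x \<in> carrier (nat_specht n)" and y: "y \<in> carrier (nat_specht n)"
  shows "sing x y r - sing y x (- r) \<in> K"
proof -
  have xy: "x + y \<in> carrier (nat_specht n)" using x y by (rule nat_specht_closed)
  have 1: "sing (x + y) (x + y) r - (sing x (x + y) r + sing y (x + y) r) \<in> K"
    using K_add_left[OF x y xy] by (simp only: nat_specht_simps)
  have 2: "sing x (x + y) r - (sing x x r + sing x y r) \<in> K"
    and 3: "sing y (x + y) r - (sing y x r + sing y y r) \<in> K"
    using K_add_right[OF x x y] K_add_right[OF y x y] by (simp_all only: nat_specht_simps)
  have "sing (x + y) (x + y) r - ((sing x x r + sing x y r) + (sing y x r + sing y y r)) \<in> K"
    by (rule K_trans[OF 1 K_add_cong[OF 2 3]])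
  from K_diff[OF K_alternating[OF xy, of r] this]
  have "(sing x x r + sing x y r) + (sing y x r + sing y y r) \<in> K"
    by (simp only: diff_diff_eq2 add_diff_cancel_left')
  from K_diff[OF K_diff[OF this K_alternating[OF x, of r]] K_alternating[OF y, of r]]
  have "(sing x x r + sing x y r) + (sing y x r + sing y y r) - sing x x r - sing y y r \<in> K" .
  then show ?thesis by (simp add: single_uminus algebra_simps)
qed

text \<open>Membership of the sum in the carrier is carried through the induction, because the
  additivity relation of the next step demands it.\<close>

lemma K_expand_left:
  fixes c :: "'i \<Rightarrow> 'r"
  assumes y: "y \<in> carrier (nat_specht n)" and "finite A" "\<And>i. i \<in> A \<Longrightarrow> v i \<in> carrier (nat_specht n)"
  shows "(\<Sum>i \<in> A. scale (c i) (v i)) \<in> carrier (nat_specht n) \<and>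
    sing (\<Sum>i \<in> A. scale (c i) (v i)) y r - (\<Sum>i \<in> A. sing (v i) y (r * c i)) \<in> K"
  using assms(2,3)
proof (induction A rule: finite_induct)
  case empty
  have "sing (0 + 0) y r - (sing 0 y r + sing 0 y r) \<in> K"
    using K_add_left[OF nat_specht_closed(3) nat_specht_closed(3) y] by (simp only: nat_specht_simps)
  then have "- (sing 0 y r) \<in> K" by simp
  then show ?case using K_minus nat_specht_closed(3) by fastforce
next
  case (insert i A)
  let ?S = "\<Sum>i \<in> A. scale (c i) (v i)"
  have vi: "v i \<in> carrier (nat_specht n)" using insert.prems by simp
  have cv: "scale (c i) (v i) \<in> carrier (nat_specht n)" using vi by (rule nat_specht_closed)
  have S: "?S \<in> carrier (nat_specht n)" "sing ?S y r - (\<Sum>i \<in> A. sing (v i) y (r * c i)) \<in> K"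
    using insert by auto
  have 1: "sing (scale (c i) (v i) + ?S) y r - (sing (scale (c i) (v i)) y r + sing ?S y r) \<in> K"
    using K_add_left[OF cv S(1) y] by (simp only: nat_specht_simps)
  have 2: "sing (scale (c i) (v i)) y r - sing (v i) y (r * c i) \<in> K"
    using K_smult_left[OF vi y] by (simp only: nat_specht_simps)
  have "sing (scale (c i) (v i) + ?S) y r - (sing (v i) y (r * c i) + (\<Sum>i \<in> A. sing (v i) y (r * c i))) \<in> K"
    by (rule K_trans[OF 1 K_add_cong[OF 2 S(2)]])
  then show ?case using insert.hyps nat_specht_closed(1)[OF cv S(1)] by simp
qed

lemma K_expand_right:
  fixes c :: "'i \<Rightarrow> 'r"
  assumes "x \<in> carrier (nat_specht n)" "finite A" "\<And>i. i \<in> A \<Longrightarrow> v i \<in> carrier (nat_specht n)"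
  shows "sing x (\<Sum>i \<in> A. scale (c i) (v i)) r - (\<Sum>i \<in> A. sing x (v i) (r * c i)) \<in> K"
proof -
  let ?S = "\<Sum>i \<in> A. scale (c i) (v i)"
  have "?S \<in> carrier (nat_specht n) \<and> sing ?S x (- r) - (\<Sum>i \<in> A. sing (v i) x (- r * c i)) \<in> K"
    by (rule K_expand_left[OF assms(1,2)]) (rule assms(3))
  then have S: "?S \<in> carrier (nat_specht n)" "sing ?S x (- r) - (\<Sum>i \<in> A. sing (v i) x (- r * c i)) \<in> K"
    by simp_all
  have 1: "sing x ?S r - sing ?S x (- r) \<in> K" by (rule K_antisym[OF assms(1) S(1)])
  have 2: "(\<Sum>i \<in> A. sing (v i) x (- r * c i)) - (\<Sum>i \<in> A. sing x (v i) (r * c i)) \<in> K"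
  proof (rule K_sum_cong, rule K_sym)
    fix i assume "i \<in> A"
    then show "sing x (v i) (r * c i) - sing (v i) x (- r * c i) \<in> K"
      using K_antisym[OF assms(1) assms(3), of i "r * c i"] by simp
  qed
  show ?thesis by (rule K_trans[OF K_trans[OF 1 S(2)] 2])
qed

definition comb :: "(nat \<times> nat \<Rightarrow> 'r) \<Rightarrow> ((nat \<Rightarrow>\<^sub>0 'r) \<times> (nat \<Rightarrow>\<^sub>0 'r) \<Rightarrow>\<^sub>0 'r)"
  where "comb \<alpha> = (\<Sum>p \<in> specht_idx n. sing (beta (fst p)) (beta (snd p)) (\<alpha> p))"

lemma comb_add: "comb \<alpha> + comb \<alpha>' = comb (\<lambda>p. \<alpha> p + \<alpha>' p)"
  by (simp add: comb_def single_add sum.distrib)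

lemma comb_single: "p \<in> specht_idx n \<Longrightarrow> comb (\<lambda>q. if q = p then r else 0) = sing (beta (fst p)) (beta (snd p)) r"
proof -
  assume p: "p \<in> specht_idx n"
  have "comb (\<lambda>q. if q = p then r else 0) = (\<Sum>q \<in> specht_idx n. if q = p then sing (beta (fst p)) (beta (snd p)) r else 0)"
    unfolding comb_def by (rule sum.cong) auto
  then show ?thesis using p by (simp add: finite_specht_idx)
qed

text \<open>Both factors of a generator are expanded in the \<open>beta i\<close>; then equal
  indices vanish and decreasing ones are swapped with a sign.\<close>

lemma normal_form:
  assumes "Poly_Mapping.keys f \<subseteq> NN"
  shows "\<exists>\<alpha>. f - comb \<alpha> \<in> K"
proof -
  define Q where "Q f \<longleftrightarrow> (\<exists>\<alpha>. f - comb \<alpha> \<in> K)" for f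
  have Q0: "Q f" if "f \<in> K" for f
    unfolding Q_def using that by (intro exI[of _ "\<lambda>_. 0"]) (simp add: comb_def)
  have Q_cong: "Q f" if "f - g \<in> K" "Q g" for f g
    using that K_trans unfolding Q_def by blast
  have Q_add: "Q (f + g)" if fg: "Q f" "Q g" for f g
  proof -
    obtain \<alpha> \<alpha>' where "f - comb \<alpha> \<in> K" "g - comb \<alpha>' \<in> K" using fg unfolding Q_def by blast
    from K_add_cong[OF this] show ?thesis unfolding Q_def comb_add by blast
  qed
  have Q_sum: "Q (\<Sum>x \<in> A. h x)" if "finite A" "\<And>x. x \<in> A \<Longrightarrow> Q (h x)" for A :: "nat set" and h
    by (rule comb_induct) (use that Q0[OF K_zero] Q_add in auto)
  have Q_lt: "Q (sing (beta i) (beta j) r)" if "2 \<le> i" "i < j" "j \<le> n" for i j r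
  proof -
    have "(i, j) \<in> specht_idx n" using that by (simp add: specht_idx_iff)
    from comb_single[OF this, of r] show ?thesis
      unfolding Q_def by (intro exI[of _ "\<lambda>q. if q = (i, j) then r else 0"]) (simp add: K_zero)
  qed
  have b: "beta i \<in> carrier (nat_specht n)" if "i \<in> {2..n}" for i
    using that by (intro beta_closed) auto
  have Q_beta: "Q (sing (beta i) (beta j) r)" if "i \<in> {2..n}" "j \<in> {2..n}" for i j r
  proof (cases i j rule: linorder_cases)
    case less
    then show ?thesis using that by (intro Q_lt) auto
  next
    case equal
    then show ?thesis using that b by (auto intro: Q0 K_alternating)
  next
    case greater
    then have "Q (sing (beta j) (beta i) (- r))" using that by (intro Q_lt) auto
    then show ?thesis by (rule Q_cong[OF K_antisym[OF b[OF that(1)] b[OF that(2)]]])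
  qed
  have Q_single: "Q (sing x y r)" if x: "x \<in> carrier (nat_specht n)" and y: "y \<in> carrier (nat_specht n)" for x y r
  proof -
    have "Q (sing (beta i) y s)" if i: "i \<in> {2..n}" for i s
    proof -
      have "sing (beta i) y s - (\<Sum>j \<in> {2..n}. sing (beta i) (beta j) (s * Poly_Mapping.lookup y j)) \<in> K"
        by (subst (1) beta_expansion[OF y n_pos], rule K_expand_right[OF b[OF i] finite_atLeastAtMost])
          (rule b)
      moreover have "Q (\<Sum>j \<in> {2..n}. sing (beta i) (beta j) (s * Poly_Mapping.lookup y j))"
        using i by (intro Q_sum Q_beta) simp_all
      ultimately show ?thesis by (rule Q_cong)
    qed
    then have "Q (\<Sum>i \<in> {2..n}. sing (beta i) y (r * Poly_Mapping.lookup x i))"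
      by (intro Q_sum) simp_all
    moreover have "sing x y r - (\<Sum>i \<in> {2..n}. sing (beta i) y (r * Poly_Mapping.lookup x i)) \<in> K"
      by (subst (1) beta_expansion[OF x n_pos],
          rule K_expand_left[OF y finite_atLeastAtMost, THEN conjunct2]) (rule b)
    ultimately show ?thesis by (rule Q_cong[rotated])
  qed
  have "Q f"
    using assms by (induction f rule: free_induct) (auto intro: Q0 K_zero Q_single Q_add)
  then show ?thesis by (simp add: Q_def)
qed

lemma wmap_comb: "wmap (comb \<alpha>) = (\<Sum>p \<in> specht_idx n. msc (\<alpha> p) (btri p))"
  by (simp only: comb_def wmap_sum wmap_single wmat_beta btri_def)

lemma wmap_K: "f \<in> K \<Longrightarrow> wmap f = 0"
proof (induction f rule: K_induct)
  case (rel f)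
  then show ?case unfolding Rl_def
  proof
    assume "f \<in> bilinear_rels (nat_specht n) (nat_specht n)"
    then show ?thesis unfolding wmap_def
      by (rule bilinear_rels_free_ext[OF wmap.free_extension_axioms, rotated -1])
        (auto intro!: matrix_eqI simp: nat_specht_simps msc_apply wmat_def lookup_add lookup_scale algebra_simps)
  next
    assume "f \<in> {Poly_Mapping.single (x, x) 1 | x. x \<in> carrier (nat_specht n)}"
    then obtain x where "f = Poly_Mapping.single (x, x) 1" by blast
    moreover have "wmat x x = 0" by (rule matrix_eqI) (simp add: wmat_def)
    ultimately show ?thesis by (simp only: wmap_single msc_simps)
  qed
qed (simp_all only: wmap.ext_zero wmap.ext_add wmap_scale msc_simps add_0)

text \<open>In normal form the coefficients are entries of the matrix, so a zero matrix leaves only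
  relations. This provides the independence of the \<open>specht_b n p\<close>, which is not visible
  from the presentation.\<close>

lemma wmap_eq_0_iff:
  assumes "Poly_Mapping.keys f \<subseteq> NN"
  shows "wmap f = 0 \<longleftrightarrow> f \<in> K"
proof
  assume 0: "wmap f = 0"
  obtain \<alpha> where \<alpha>: "f - comb \<alpha> \<in> K" using normal_form[OF assms] by blast
  then have "wmap (comb \<alpha>) = 0" using wmap_K[OF \<alpha>] 0 by (simp only: wmap.ext_diff) simp
  then have "\<alpha> p = 0" if "p \<in> specht_idx n" for p
    using coord_comb[OF that, of \<alpha>] by (simp only: wmap_comb coord_simps)
  then have "comb \<alpha> = 0" by (simp add: comb_def)
  then show "f \<in> K" using \<alpha> by simp
qed (rule wmap_K)

definition mat_of :: "((nat \<Rightarrow>\<^sub>0 'r) \<times> (nat \<Rightarrow>\<^sub>0 'r) \<Rightarrow>\<^sub>0 'r) set \<Rightarrow> nat \<Rightarrow> nat \<Rightarrow> 'r"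
  where "mat_of = descend wmap"

lemma mat_of_cls: "mat_of (cls f) = wmap f"
  unfolding mat_of_def
proof (rule descend_cls)
  fix f g assume "f - g \<in> K"
  then have "wmap f - wmap g = 0" using wmap_K by (simp only: wmap.ext_diff[symmetric])
  then show "wmap f = wmap g" by simp
qed

abbreviation SS :: "('r, nat \<Rightarrow> nat, ((nat \<Rightarrow>\<^sub>0 'r) \<times> (nat \<Rightarrow>\<^sub>0 'r) \<Rightarrow>\<^sub>0 'r) set) gmod"
  where "SS \<equiv> specht n"

lemma specht_carrier: "carrier SS = cls ` {f. Poly_Mapping.keys f \<subseteq> NN}"
  unfolding specht_def ext2_simps K_def[symmetric] by (rule carrier_quot)

lemma specht_ops:
  "cls f \<oplus>\<^bsub>SS\<^esub> cls g = cls (f + g)" "\<zero>\<^bsub>SS\<^esub> = cls 0"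
  "r \<odot>\<^bsub>SS\<^esub> cls f = cls (scale r f)"
  unfolding specht_def ext2_simps K_def[symmetric]
  by (simp_all only: set_add_cls cls_zero coset_map_scale)

lemma nat_specht_act_closed:
  assumes g: "g permutes {1..n}" and x: "x \<in> carrier (nat_specht n)"
  shows "free_map g x \<in> carrier (nat_specht n)"
proof -
  have "Poly_Mapping.keys (free_map g x) \<subseteq> {1..n}"
    using x permutes_in_image[OF g] unfolding nat_specht_simps by (intro keys_free_map[of x "{1..n}"]) blast+
  moreover have "(\<Sum>i = 1..n. Poly_Mapping.lookup (free_map g x) i) = (\<Sum>i = 1..n. Poly_Mapping.lookup x i)"
    unfolding lookup_free_map_perm[OF g]
    using sum.permute[OF permutes_inv[OF g], of "Poly_Mapping.lookup x"] by (simp add: comp_def)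
  ultimately show ?thesis using x unfolding nat_specht_simps by simp
qed

lemma specht_act:
  assumes g: "g permutes {1..n}"
  shows "act SS g (cls f) = cls (free_map (\<lambda>(x, y). (free_map g x, free_map g y)) f)"
  unfolding specht_def ext2_simps K_def[symmetric] nat_specht_simps(5)
proof (rule coset_map_free_map)
  fix f assume f: "f \<in> Rl"
  let ?\<phi> = "\<lambda>(x, y). (free_map g x, free_map g y)"
  have "Poly_Mapping.keys (free_map ?\<phi> f) \<subseteq> NN"
    using relations[OF f] by (rule keys_free_map) (auto intro: nat_specht_act_closed[OF g])
  \<comment> \<open>The image of a relation is recognized as an element of \<open>K\<close> by its
    zero matrix, so the kinds of relations need not be treated separately.\<close>
  moreover have "wmap (free_map ?\<phi> f) = 0"
    unfolding wmap_free_map[OF g] using wmap_K[OF K_rel[OF f]] by (simp only: mact_simps)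
  ultimately show "free_map ?\<phi> f \<in> K" using wmap_eq_0_iff by blast
qed

lemma mat_of_hom: "gmod_hom class_ring (sym_group n) (specht n) (alt_mod n) mat_of"
proof (rule gmod_homI)
  fix x assume "x \<in> carrier SS"
  then obtain f where f: "x = cls f" "Poly_Mapping.keys f \<subseteq> NN" by (auto simp: specht_carrier)
  show "mat_of x \<in> carrier (alt_mod n)" using f by (simp add: mat_of_cls wmap_alt)
  show "mat_of (r \<odot>\<^bsub>SS\<^esub> x) = r \<odot>\<^bsub>alt_mod n\<^esub> mat_of x" for r
    by (simp only: f(1) specht_ops mat_of_cls wmap_scale alt_mod_simps)
  show "mat_of (act SS g x) = act (alt_mod n) g (mat_of x)" if "g \<in> carrier (sym_group n)" for g
    using that unfolding sym_group_carrier f(1)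
    by (simp only: specht_act mat_of_cls wmap_free_map alt_mod_simps)
  show "mat_of (x \<oplus>\<^bsub>SS\<^esub> y) = mat_of x \<oplus>\<^bsub>alt_mod n\<^esub> mat_of y" if y: "y \<in> carrier SS" for y
  proof -
    obtain g where "y = cls g" using y unfolding specht_carrier by blast
    then show ?thesis by (simp only: f(1) specht_ops mat_of_cls wmap.ext_add alt_mod_simps)
  qed
qed

lemma mat_of_bij: "bij_betw mat_of (carrier SS) (carrier (alt_mod n))"
  unfolding bij_betw_def
proof
  show "inj_on mat_of (carrier SS)"
  proof
    fix x y assume "x \<in> carrier SS" "y \<in> carrier SS" and eq: "mat_of x = mat_of y"
    then obtain f g where fg: "x = cls f" "Poly_Mapping.keys f \<subseteq> NN" "y = cls g" "Poly_Mapping.keys g \<subseteq> NN"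
      by (auto simp: specht_carrier)
    have "wmap (f - g) = 0" using eq unfolding fg mat_of_cls wmap.ext_diff by simp
    then have "f - g \<in> K" using wmap_eq_0_iff[OF keys_diff_subset[OF fg(2,4)]] by blast
    then show "x = y" by (simp only: fg cls_eq_iff)
  qed
  show "mat_of ` carrier SS = carrier (alt_mod n)"
  proof
    show "mat_of ` carrier SS \<subseteq> carrier (alt_mod n)"
      using gmod_homD(1)[OF mat_of_hom] by blast
    show "carrier (alt_mod n) \<subseteq> mat_of ` carrier SS"
    proof
      fix a :: "nat \<Rightarrow> nat \<Rightarrow> 'r" assume "a \<in> carrier (alt_mod n)"
      then have "a = wmap (comb (coord a))" unfolding wmap_comb by (intro alt_expansion) simp
      moreover have "Poly_Mapping.keys (comb (coord a)) \<subseteq> NN"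
        unfolding comb_def
      proof (rule comb_induct[where P = "\<lambda>f. Poly_Mapping.keys f \<subseteq> NN"])
        fix p assume "p \<in> specht_idx n"
        then have "fst p \<in> {1..n}" "snd p \<in> {1..n}" by (auto simp: specht_idx_def)
        then show "Poly_Mapping.keys (sing (beta (fst p)) (beta (snd p)) (coord a p)) \<subseteq> NN"
          by (intro keys_single_subset SigmaI beta_closed)
      qed (simp_all only: finite_specht_idx keys_add_subset keys_zero empty_subsetI)
      ultimately show "a \<in> mat_of ` carrier SS"
        unfolding specht_carrier image_image mat_of_cls by blast
    qed
  qed
qed

lemma specht_gmodule: "gmodule class_ring (sym_group n) SS"
proof (rule gmodule_transport[OF alt_mod_gmodule mat_of_hom])
  show "inj_on mat_of (carrier SS)" using mat_of_bij by (simp add: bij_betw_def)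
  show "mat_of \<zero>\<^bsub>SS\<^esub> = \<zero>\<^bsub>alt_mod n\<^esub>"
    by (simp only: specht_ops mat_of_cls wmap.ext_zero alt_mod_simps)
  show "\<zero>\<^bsub>SS\<^esub> \<in> carrier SS"
    unfolding specht_ops specht_carrier by auto
  fix x assume "x \<in> carrier SS"
  then obtain f where f: "x = cls f" "Poly_Mapping.keys f \<subseteq> NN" by (auto simp: specht_carrier)
  show "r \<odot>\<^bsub>SS\<^esub> x \<in> carrier SS" for r
    unfolding f(1) specht_ops specht_carrier using subset_trans[OF keys_scale f(2)] by blast
  show "x \<oplus>\<^bsub>SS\<^esub> y \<in> carrier SS" if y: "y \<in> carrier SS" for y
  proof -
    obtain g where g: "y = cls g" "Poly_Mapping.keys g \<subseteq> NN" using y unfolding specht_carrier by blast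
    show ?thesis
      unfolding f(1) g(1) specht_ops specht_carrier using keys_add_subset[OF f(2) g(2)] by blast
  qed
  show "act SS g x \<in> carrier SS" if "g \<in> carrier (sym_group n)" for g
  proof -
    have g: "g permutes {1..n}" using that by (simp add: sym_group_carrier)
    have "Poly_Mapping.keys (free_map (\<lambda>(x, y). (free_map g x, free_map g y)) f) \<subseteq> NN"
      using f(2) by (rule keys_free_map) (auto intro: nat_specht_act_closed[OF g])
    then show ?thesis unfolding f(1) specht_act[OF g] specht_carrier by blast
  qed
qed

lemma specht_iso: "gmod_iso class_ring (sym_group n) (specht n) (alt_mod n :: ('r, _, _) gmod)"
  unfolding gmod_iso_iff using mat_of_hom mat_of_bij by blast

lemma specht_b_eq: "specht_b n p = cls (sing (beta (fst p)) (beta (snd p)) 1)"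
  by (cases p) (simp only: specht_b_def wedge_def cls_def beta_def prod.case fst_conv snd_conv, simp only: K_def)

lemma mat_of_b: "mat_of (specht_b n p) = btri p"
  by (simp only: specht_b_eq mat_of_cls wmap_single wmat_beta msc_simps btri_def)

lemma specht_coordinates: "coordinates (specht n) (specht_idx n) (specht_b n) (\<lambda>x. coord (mat_of x))"
proof -
  interpret gmodule class_ring "sym_group n" SS by (rule specht_gmodule)
  note h = gmod_homD[OF mat_of_hom]
  show ?thesis
  proof
    show "specht_b n p \<in> carrier SS" if "p \<in> specht_idx n" for p
      using that unfolding specht_b_eq specht_carrier
      by (intro imageI CollectI keys_single_subset SigmaI beta_closed) (auto simp: specht_idx_def)
    show "coord (mat_of (x \<oplus>\<^bsub>SS\<^esub> y)) p = coord (mat_of x) p + coord (mat_of y) p"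
      if "x \<in> carrier SS" "y \<in> carrier SS" for x y p
      unfolding h(2)[OF that] by simp
    show "coord (mat_of (r \<odot>\<^bsub>SS\<^esub> x)) p = r * coord (mat_of x) p"
      if "x \<in> carrier SS" for x p r
      using h(3)[OF _ that, of r] by simp
    show "coord (mat_of (specht_b n p)) q = (if p = q then 1 else 0)"
      if "p \<in> specht_idx n" "q \<in> specht_idx n" for p q
      unfolding mat_of_b using that by (rule coord_btri)
    show "x = \<zero>\<^bsub>SS\<^esub>"
      if x: "x \<in> carrier SS" and "\<And>p. p \<in> specht_idx n \<Longrightarrow> coord (mat_of x) p = 0" for x
    proof -
      have "mat_of x \<in> alt_set n" using h(1)[OF x] by simp
      then have "mat_of x = 0" using that(2) by (rule alt_set_zeroI)
      also have "0 = mat_of \<zero>\<^bsub>SS\<^esub>" by (simp only: specht_ops mat_of_cls wmap.ext_zero)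
      finally show ?thesis using mat_of_bij x M.zero_closed unfolding bij_betw_def by (metis inj_onD)
    qed
  qed (rule finite_specht_idx)
qed

end

section \<open>Extension of scalars\<close>

lemma gsublattice_preimage:
  assumes M: "gmodule R G M" and N: "gmodule R G N"
    and f: "gmod_hom R G M N f" "bij_betw f (carrier M) (carrier N)" and Y: "gsublattice R G N Y"
  defines "X \<equiv> {x \<in> carrier M. f x \<in> Y}"
  shows "gsublattice R G M X" and "gmod_iso R G (M\<lparr>carrier := X\<rparr>) (N\<lparr>carrier := Y\<rparr>)"
proof -
  interpret Y: LinearCombinations.submodule R Y N using Y by (simp add: gsublattice_def)
  interpret M: gmodule R G M by (rule M)
  interpret N: gmodule R G N by (rule N)
  note h = gmod_homD[OF f(1)]
  have zero: "f \<zero>\<^bsub>M\<^esub> = \<zero>\<^bsub>N\<^esub>"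
    using h(1)[of "\<zero>\<^bsub>M\<^esub>"] h(2)[of "\<zero>\<^bsub>M\<^esub>" "\<zero>\<^bsub>M\<^esub>"] by simp
  have Y_act: "act N g y \<in> Y" if "g \<in> carrier G" "y \<in> Y" for g y
    using Y that by (simp add: gsublattice_def)
  show X: "gsublattice R G M X"
  proof (rule gsublatticeI[OF M])
    show "\<zero>\<^bsub>M\<^esub> \<in> X" by (simp add: X_def zero)
    show "x \<oplus>\<^bsub>M\<^esub> y \<in> X" if "x \<in> X" "y \<in> X" for x y using that by (simp add: X_def h(2))
    show "r \<odot>\<^bsub>M\<^esub> x \<in> X" if "r \<in> carrier R" "x \<in> X" for r x using that by (simp add: X_def h(3))
    show "act M g x \<in> X" if "g \<in> carrier G" "x \<in> X" for g x
      using that gmodule_closed(3)[OF M] by (simp add: X_def h(4) Y_act)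
  qed (auto simp: X_def)
  have "gmod_hom R G (M\<lparr>carrier := X\<rparr>) (N\<lparr>carrier := Y\<rparr>) f"
    by (rule gmod_homI) (auto simp: X_def h)
  moreover have "bij_betw f X Y"
    unfolding bij_betw_def
  proof
    show "inj_on f X" using f(2) unfolding bij_betw_def by (rule inj_on_subset[OF conjunct1]) (auto simp: X_def)
    show "f ` X = Y"
    proof
      show "Y \<subseteq> f ` X"
      proof
        fix y assume y: "y \<in> Y"
        then have "y \<in> f ` carrier M" using f(2) Y.subset by (auto simp: bij_betw_def)
        then show "y \<in> f ` X" using y by (auto simp: X_def)
      qed
    qed (auto simp: X_def)
  qed
  ultimately show "gmod_iso R G (M\<lparr>carrier := X\<rparr>) (N\<lparr>carrier := Y\<rparr>)"
    by (auto simp: gmod_iso_iff)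
qed

section \<open>Tensor products with the field of fractions\<close>

lemma fract_mod_simps:
  "carrier fract_mod = UNIV" "x \<oplus>\<^bsub>fract_mod\<^esub> y = x + y" "r \<odot>\<^bsub>fract_mod\<^esub> x = to_fract r * x"
  by (simp_all add: fract_mod_def to_fract_def)

text \<open>Linear maps on the two factors take each relation to one of the same kind. This makes
  scalars and group elements act on the tensor product.\<close>

lemma bilinear_rels_free_map:
  fixes M :: "('r::comm_ring_1, 'm, 'c) module_scheme" and N :: "('r, 'n, 'd) module_scheme"
  assumes "\<And>x. x \<in> carrier M \<Longrightarrow> u x \<in> carrier M"
    and "\<And>x y. x \<in> carrier M \<Longrightarrow> y \<in> carrier M \<Longrightarrow> u (x \<oplus>\<^bsub>M\<^esub> y) = u x \<oplus>\<^bsub>M\<^esub> u y"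
    and "\<And>r x. x \<in> carrier M \<Longrightarrow> u (r \<odot>\<^bsub>M\<^esub> x) = r \<odot>\<^bsub>M\<^esub> u x"
    and "\<And>x. x \<in> carrier N \<Longrightarrow> v x \<in> carrier N"
    and "\<And>x y. x \<in> carrier N \<Longrightarrow> y \<in> carrier N \<Longrightarrow> v (x \<oplus>\<^bsub>N\<^esub> y) = v x \<oplus>\<^bsub>N\<^esub> v y"
    and "\<And>r x. x \<in> carrier N \<Longrightarrow> v (r \<odot>\<^bsub>N\<^esub> x) = r \<odot>\<^bsub>N\<^esub> v x"
    and "f \<in> bilinear_rels M N"
  shows "free_map (\<lambda>(x, y). (u x, v y)) f \<in> bilinear_rels M N"
  using assms(7) unfolding bilinear_rels_def Let_def
proof (elim UnE CollectE exE conjE, goal_cases)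
  case (1 x x' y)
  then show ?case
    by (intro UnI1 CollectI exI[of _ "u x"] exI[of _ "u x'"] exI[of _ "v y"])
      (simp add: free_map.ext_diff free_map.ext_single assms)
next
  case (2 x y y')
  then show ?case
    by (intro UnI1 UnI2[where A = "_ :: (_ \<Rightarrow>\<^sub>0 _) set"] CollectI exI[of _ "u x"] exI[of _ "v y"] exI[of _ "v y'"])
      (simp add: free_map.ext_diff free_map.ext_single assms)
next
  case (3 r x y)
  then show ?case
    by (intro UnI1 UnI2[where A = "_ :: (_ \<Rightarrow>\<^sub>0 _) set"] CollectI exI[of _ r] exI[of _ "u x"] exI[of _ "v y"])
      (simp add: free_map.ext_diff free_map.ext_single assms)
next
  case (4 r x y)
  then show ?case
    by (intro UnI2 CollectI exI[of _ r] exI[of _ "u x"] exI[of _ "v y"])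
      (simp add: free_map.ext_diff free_map.ext_single assms)
qed

locale scalar_extension = M: gmodule class_ring G M
  for G :: "('g, 'b) monoid_scheme" and M :: "('r::idom, 'g, 'm) gmod"
begin

abbreviation KK where "KK \<equiv> tensor_kernel (fract_mod :: ('r, 'r fract) module) M"
abbreviation QM where "QM \<equiv> carrier (fract_mod :: ('r, 'r fract) module) \<times> carrier M"

sublocale bilinear_quotient "fract_mod :: ('r, 'r fract) module" M "bilinear_rels fract_mod M" KK
proof
  show "Poly_Mapping.keys f \<subseteq> QM" if "f \<in> bilinear_rels fract_mod M" for f
    using that by (rule bilinear_rels_keys[rotated -1]) (simp_all add: fract_mod_simps)
  show "KK = LinearCombinations.module.span class_ring (free_mod QM) (bilinear_rels fract_mod M)"
    by (simp add: tensor_kernel_def)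
qed simp

lemma extend_carrier: "carrier (extend_scalars M) = cls ` {f. Poly_Mapping.keys f \<subseteq> QM}"
  unfolding carrier_quot[symmetric] by (simp add: extend_scalars_def Let_def tensor_mod_def quot_mod_def)

lemma extend_add: "cls f \<oplus>\<^bsub>extend_scalars M\<^esub> cls g = cls (f + g)"
  unfolding set_add_cls[symmetric] by (simp add: extend_scalars_def Let_def tensor_mod_def quot_mod_def)

lemma extend_smult: "q \<odot>\<^bsub>extend_scalars M\<^esub> cls f = cls (free_map (\<lambda>(a, x). (q * a, x)) f)"
proof -
  have "q \<odot>\<^bsub>extend_scalars M\<^esub> cls f = coset_map (free_mod QM) KK (free_map (\<lambda>(a, x). (q * a, x))) (cls f)"
    by (simp add: extend_scalars_def Let_def)
  also have "\<dots> = cls (free_map (\<lambda>(a, x). (q * a, x)) f)"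
    by (intro coset_map_free_map K_rel bilinear_rels_free_map)
      (simp_all add: fract_mod_simps algebra_simps)
  finally show ?thesis .
qed

lemma extend_act:
  assumes "g \<in> carrier G"
  shows "act (extend_scalars M) g (cls f) = cls (free_map (\<lambda>(a, x). (a, act M g x)) f)"
proof -
  have "act (extend_scalars M) g (cls f) = coset_map (free_mod QM) KK (free_map (\<lambda>(a, x). (a, act M g x))) (cls f)"
    by (simp add: extend_scalars_def Let_def)
  also have "\<dots> = cls (free_map (\<lambda>(a, x). (a, act M g x)) f)"
    by (intro coset_map_free_map K_rel bilinear_rels_free_map)
      (simp_all add: fract_mod_simps gmodule_act[OF M.gmodule_axioms assms] gmodule_closed(3)[OF M.gmodule_axioms assms])
  finally show ?thesis .
qed

lemma K_swap:
  assumes "x \<in> carrier M"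
  shows "sing q (c \<odot>\<^bsub>M\<^esub> x) r - sing (to_fract c * q) x r \<in> KK"
  using K_trans[OF K_smult_right[of q x c r] K_sym[OF K_smult_left[of q x c r]]] assms
  by (simp only: fract_mod_simps UNIV_I)

lemma K_coeff:
  assumes "x \<in> carrier M"
  shows "sing q x r - sing (to_fract r * q) x 1 \<in> KK"
  using K_sym[OF K_smult_left[of q x r 1]] assms by (simp only: fract_mod_simps UNIV_I mult_1_left)

lemma K_zero_right: "sing q \<zero>\<^bsub>M\<^esub> r \<in> KK"
proof -
  have "sing q (\<zero>\<^bsub>M\<^esub> \<oplus>\<^bsub>M\<^esub> \<zero>\<^bsub>M\<^esub>) r - (sing q \<zero>\<^bsub>M\<^esub> r + sing q \<zero>\<^bsub>M\<^esub> r) \<in> KK"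
    by (rule K_add_right) (simp_all add: fract_mod_simps)
  then have "- (sing q \<zero>\<^bsub>M\<^esub> r) \<in> KK" by simp
  from K_minus[OF this] show ?thesis by simp
qed

text \<open>Every tensor is a single pure tensor 1/d \<otimes> m: numerators move into the right
  factor, and sums are brought to a common denominator.\<close>

lemma fraction_form:
  assumes "Poly_Mapping.keys f \<subseteq> QM"
  shows "\<exists>d m. d \<noteq> 0 \<and> m \<in> carrier M \<and> f - sing (Fract 1 d) m 1 \<in> KK"
  using assms
proof (induction f rule: free_induct)
  case zero
  have "0 - sing (Fract 1 1) \<zero>\<^bsub>M\<^esub> 1 \<in> KK" by (rule K_diff[OF K_zero K_zero_right])
  then show ?case by (intro exI[of _ 1] exI[of _ "\<zero>\<^bsub>M\<^esub>"]) simp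
next
  case (single p r)
  obtain q m where p: "p = (q, m)" "m \<in> carrier M" using single by (cases p) auto
  obtain a d where q: "q = Fract a d" "d \<noteq> 0" by (cases q) auto
  have 1: "sing q m r - sing (to_fract r * q) m 1 \<in> KK" by (rule K_coeff[OF p(2)])
  have "to_fract (r * a) * Fract 1 d = to_fract r * q" by (simp add: q to_fract_def)
  then have "sing (Fract 1 d) ((r * a) \<odot>\<^bsub>M\<^esub> m) 1 - sing (to_fract r * q) m 1 \<in> KK"
    using K_swap[OF p(2), of "Fract 1 d" "r * a" 1] by (simp only:)
  from K_trans[OF 1 K_sym[OF this]] show ?case
    unfolding p(1) using q(2) p(2) by (intro exI[of _ d] exI[of _ "(r * a) \<odot>\<^bsub>M\<^esub> m"]) simp
next
  case (add f g)
  then obtain d m d' m' where f: "d \<noteq> 0" "m \<in> carrier M" "f - sing (Fract 1 d) m 1 \<in> KK"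
    and g: "d' \<noteq> 0" "m' \<in> carrier M" "g - sing (Fract 1 d') m' 1 \<in> KK" by blast
  let ?q = "Fract 1 (d * d')"
  have q: "to_fract d' * ?q = Fract 1 d" "to_fract d * ?q = Fract 1 d'"
    using f(1) g(1) by (simp_all add: to_fract_def eq_fract)
  have 1: "sing ?q (d' \<odot>\<^bsub>M\<^esub> m) 1 - sing (Fract 1 d) m 1 \<in> KK"
    using K_swap[OF f(2), of ?q d' 1] unfolding q .
  have 2: "sing ?q (d \<odot>\<^bsub>M\<^esub> m') 1 - sing (Fract 1 d') m' 1 \<in> KK"
    using K_swap[OF g(2), of ?q d 1] unfolding q .
  let ?m = "d' \<odot>\<^bsub>M\<^esub> m \<oplus>\<^bsub>M\<^esub> d \<odot>\<^bsub>M\<^esub> m'"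
  have 3: "sing ?q ?m 1 - (sing ?q (d' \<odot>\<^bsub>M\<^esub> m) 1 + sing ?q (d \<odot>\<^bsub>M\<^esub> m') 1) \<in> KK"
    using f(2) g(2) by (intro K_add_right) (simp_all add: fract_mod_simps)
  have 4: "sing ?q ?m 1 - (sing (Fract 1 d) m 1 + sing (Fract 1 d') m' 1) \<in> KK"
    by (rule K_trans[OF 3 K_add_cong[OF 1 2]])
  have "(f + g) - sing ?q ?m 1 \<in> KK"
    by (rule K_trans[OF K_add_cong[OF f(3) g(3)] K_sym[OF 4]])
  then show ?case using f(1,2) g(1,2) by (intro exI[of _ "d * d'"] exI[of _ ?m]) simp
qed

definition unit_cls :: "'m \<Rightarrow> ('r fract \<times> 'm \<Rightarrow>\<^sub>0 'r) set"
  where "unit_cls x = cls (sing 1 x 1)"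

lemma unit_cls:
  shows "x \<in> carrier M \<Longrightarrow> unit_cls x \<in> carrier (extend_scalars M)"
    and "x \<in> carrier M \<Longrightarrow> y \<in> carrier M \<Longrightarrow>
      unit_cls (x \<oplus>\<^bsub>M\<^esub> y) = unit_cls x \<oplus>\<^bsub>extend_scalars M\<^esub> unit_cls y"
    and "x \<in> carrier M \<Longrightarrow> unit_cls (r \<odot>\<^bsub>M\<^esub> x) = to_fract r \<odot>\<^bsub>extend_scalars M\<^esub> unit_cls x"
    and "x \<in> carrier M \<Longrightarrow> g \<in> carrier G \<Longrightarrow> unit_cls (act M g x) = act (extend_scalars M) g (unit_cls x)"
proof -
  show "unit_cls x \<in> carrier (extend_scalars M)" if "x \<in> carrier M"
    unfolding unit_cls_def extend_carrier using that
    by (intro imageI CollectI keys_single_subset) (simp add: fract_mod_simps)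
  show "unit_cls (x \<oplus>\<^bsub>M\<^esub> y) = unit_cls x \<oplus>\<^bsub>extend_scalars M\<^esub> unit_cls y" if "x \<in> carrier M" "y \<in> carrier M"
    unfolding unit_cls_def extend_add cls_eq_iff using that by (intro K_add_right) (simp_all add: fract_mod_simps)
  show "unit_cls (r \<odot>\<^bsub>M\<^esub> x) = to_fract r \<odot>\<^bsub>extend_scalars M\<^esub> unit_cls x" if "x \<in> carrier M"
    using K_swap[OF that, of 1 r 1]
    by (simp only: unit_cls_def extend_smult cls_eq_iff free_map.ext_single prod.case)
  show "unit_cls (act M g x) = act (extend_scalars M) g (unit_cls x)" if "x \<in> carrier M" "g \<in> carrier G"
    by (simp only: unit_cls_def extend_act[OF that(2)] free_map.ext_single prod.case)
qed

lemma unit_cls_span: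
  assumes "z \<in> carrier (extend_scalars M)"
  shows "\<exists>d m. d \<noteq> 0 \<and> m \<in> carrier M \<and> z = Fract 1 d \<odot>\<^bsub>extend_scalars M\<^esub> unit_cls m"
proof -
  obtain f where f: "z = cls f" "Poly_Mapping.keys f \<subseteq> QM" using assms unfolding extend_carrier by blast
  obtain d m where dm: "d \<noteq> 0" "m \<in> carrier M" "f - sing (Fract 1 d) m 1 \<in> KK"
    using fraction_form[OF f(2)] by blast
  have "z = cls (sing (Fract 1 d) m 1)" using dm(3) by (simp only: f(1) cls_eq_iff)
  then have "z = Fract 1 d \<odot>\<^bsub>extend_scalars M\<^esub> unit_cls m"
    by (simp only: unit_cls_def extend_smult free_map.ext_single prod.case mult_1_right)
  then show ?thesis using dm by blast
qed

text \<open>A linear functional on \<open>M\<close> extends to the tensor product, so \<open>x\<close> cannot vanish there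
  unless all its coordinates do.\<close>

lemma functional_KK:
  assumes c: "\<And>x y. x \<in> carrier M \<Longrightarrow> y \<in> carrier M \<Longrightarrow> c (x \<oplus>\<^bsub>M\<^esub> y) = c x + c y"
    "\<And>r x. x \<in> carrier M \<Longrightarrow> c (r \<odot>\<^bsub>M\<^esub> x) = r * (c x :: 'r)"
    and "sing 1 x 1 \<in> KK"
  shows "c x = 0"
proof -
  let ?h = "\<lambda>(q, m) r. to_fract r * q * to_fract (c m)"
  interpret h: free_extension ?h
    by unfold_locales (simp add: algebra_simps split: prod.split)
  have "free_ext ?h f = 0" if "f \<in> KK" for f
    using that
  proof (induction f rule: K_induct)
    case (rel f)
    then show ?case
      by (rule bilinear_rels_free_ext[OF h.free_extension_axioms, rotated -1]) (auto simp: fract_mod_simps c algebra_simps)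
  next
    case (scale r f)
    have "free_ext ?h (Poly_Mapping.map ((*) r) f) = to_fract r * free_ext ?h f"
      by (rule h.ext_scale) (simp_all add: algebra_simps split: prod.split)
    then show ?case using scale by simp
  qed (simp_all add: h.ext_zero h.ext_add)
  from this[OF assms(3)] show ?thesis by (simp add: h.ext_single)
qed

end

text \<open>The coordinate functions of a basis, obtained from the existence and uniqueness of
  finite representations.\<close>

lemma basis_functionals:
  fixes M :: "('r::comm_ring_1, 'm, 'c) module_scheme"
  assumes M: "Module.module class_ring M" and B: "is_basis class_ring M B"
  obtains c :: "'m \<Rightarrow> 'm \<Rightarrow> 'r"
  where "\<And>x y b. x \<in> carrier M \<Longrightarrow> y \<in> carrier M \<Longrightarrow> c (x \<oplus>\<^bsub>M\<^esub> y) b = c x b + c y b"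
    and "\<And>r x b. x \<in> carrier M \<Longrightarrow> c (r \<odot>\<^bsub>M\<^esub> x) b = r * c x b"
    and "\<And>x. x \<in> carrier M \<Longrightarrow> (\<And>b. c x b = 0) \<Longrightarrow> x = \<zero>\<^bsub>M\<^esub>"
proof -
  interpret Module.module class_ring M by (rule M)
  have BM: "B \<subseteq> carrier M" and ind: "lin_indpt B" and span: "span B = carrier M"
    using B by (auto simp: is_basis_def)
  \<comment> \<open>\<open>B\<close> is not known to be finite, so \<open>a\<close> has to vanish
    outside a finite set \<open>A\<close>; by \<open>enlarge\<close>, two representations can share
    such a set.\<close>
  define rep where "rep x a \<longleftrightarrow> (\<exists>A. finite A \<and> A \<subseteq> B \<and> (\<forall>b. b \<notin> A \<longrightarrow> a b = 0) \<and> x = lincomb a A)" for x a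
  have null: "0 \<odot>\<^bsub>M\<^esub> x = \<zero>\<^bsub>M\<^esub>" if "x \<in> carrier M" for x
    using smult_l_null[OF that] by simp
  have enlarge: "lincomb a A = lincomb a A'"
    if "finite A'" "A \<subseteq> A'" "A' \<subseteq> B" "\<forall>b. b \<notin> A \<longrightarrow> a b = 0" for a A A'
    unfolding lincomb_def
    by (rule M.add.finprod_mono_neutral_cong_left) (use that BM null in auto)
  have ex: "\<exists>a. rep x a" if x: "x \<in> carrier M" for x
  proof -
    obtain a A where A: "finite A" "A \<subseteq> B" "x = lincomb a A"
      using x unfolding span[symmetric] span_def by blast
    have "lincomb a A = lincomb (\<lambda>b. if b \<in> A then a b else 0) A"
      unfolding lincomb_def using A BM by (intro M.finsum_cong') auto
    then show ?thesis unfolding rep_def using A by (intro exI[of _ "\<lambda>b. if b \<in> A then a b else 0"] exI[of _ A]) auto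
  qed
  have rep_add: "rep (x \<oplus>\<^bsub>M\<^esub> y) (\<lambda>b. a b + a' b)" if xa: "rep x a" and ya: "rep y a'" for x y a a'
  proof -
    obtain A A' where A: "finite A" "A \<subseteq> B" "\<forall>b. b \<notin> A \<longrightarrow> a b = 0" "x = lincomb a A"
      and A': "finite A'" "A' \<subseteq> B" "\<forall>b. b \<notin> A' \<longrightarrow> a' b = 0" "y = lincomb a' A'"
      using xa ya unfolding rep_def by blast
    have "x = lincomb a (A \<union> A')" "y = lincomb a' (A \<union> A')"
      using A A' enlarge[of "A \<union> A'" A a] enlarge[of "A \<union> A'" A' a'] by auto
    moreover have "lincomb (\<lambda>b. a b + a' b) (A \<union> A') = lincomb a (A \<union> A') \<oplus>\<^bsub>M\<^esub> lincomb a' (A \<union> A')"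
    proof -
      have cl: "\<And>b. b \<in> A \<union> A' \<Longrightarrow> b \<in> carrier M" using A A' BM by auto
      have "lincomb (\<lambda>b. a b + a' b) (A \<union> A') = (\<Oplus>\<^bsub>M\<^esub> b \<in> A \<union> A'. a b \<odot>\<^bsub>M\<^esub> b \<oplus>\<^bsub>M\<^esub> a' b \<odot>\<^bsub>M\<^esub> b)"
        unfolding lincomb_def
      proof (rule M.finsum_cong')
        show "(a b + a' b) \<odot>\<^bsub>M\<^esub> b = a b \<odot>\<^bsub>M\<^esub> b \<oplus>\<^bsub>M\<^esub> a' b \<odot>\<^bsub>M\<^esub> b" if "b \<in> A \<union> A'" for b
          using smult_l_distr[of "a b" "a' b" b] cl[OF that] by simp
      qed (use cl in auto)
      also have "\<dots> = lincomb a (A \<union> A') \<oplus>\<^bsub>M\<^esub> lincomb a' (A \<union> A')"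
        unfolding lincomb_def using cl by (intro M.finsum_addf) auto
      finally show ?thesis .
    qed
    ultimately show ?thesis unfolding rep_def using A A' by (intro exI[of _ "A \<union> A'"]) auto
  qed
  have rep_smult: "rep (r \<odot>\<^bsub>M\<^esub> x) (\<lambda>b. r * a b)" if xa: "rep x a" for x a r
  proof -
    obtain A where A: "finite A" "A \<subseteq> B" "\<forall>b. b \<notin> A \<longrightarrow> a b = 0" "x = lincomb a A"
      using xa unfolding rep_def by blast
    have "lincomb (\<lambda>b. r * a b) A = r \<odot>\<^bsub>M\<^esub> lincomb a A"
      using lincomb_smult[of A a r] A BM by auto
    then show ?thesis unfolding rep_def using A by (intro exI[of _ A]) auto
  qed
  have rep_closed: "x \<in> carrier M" if "rep x a" for x a
    using that BM unfolding rep_def by (auto intro!: lincomb_closed)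
  have rep_zero: "a b = 0" if za: "rep \<zero>\<^bsub>M\<^esub> a" for a b
  proof (rule ccontr)
    assume "a b \<noteq> 0"
    moreover obtain A where "finite A" "A \<subseteq> B" "\<forall>b. b \<notin> A \<longrightarrow> a b = 0" "\<zero>\<^bsub>M\<^esub> = lincomb a A"
      using za unfolding rep_def by blast
    ultimately have "lin_dep B"
      unfolding lin_dep_def by (intro exI[of _ A] exI[of _ a] exI[of _ b]) auto
    then show False using ind by contradiction
  qed
  have rep_unique: "a b = a' b" if xa: "rep x a" "rep x a'" for x a a' b
  proof -
    have x: "x \<in> carrier M" using rep_closed xa(1) .
    have "x \<oplus>\<^bsub>M\<^esub> (- 1) \<odot>\<^bsub>M\<^esub> x = \<zero>\<^bsub>M\<^esub>"
      using smult_l_distr[of 1 "- 1" x] smult_l_null[OF x] smult_one[OF x] x by simp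
    then have "rep \<zero>\<^bsub>M\<^esub> (\<lambda>b. a b + (- 1) * a' b)" using rep_add[OF xa(1) rep_smult[OF xa(2), of "- 1"]] by simp
    from rep_zero[OF this, of b] show ?thesis by simp
  qed
  \<comment> \<open>The choice is harmless: \<open>rep_unique\<close> yields additivity and
    homogeneity.\<close>
  define c where "c x = (SOME a. rep x a)" for x
  have c: "rep x (c x)" if "x \<in> carrier M" for x
    unfolding c_def using ex[OF that] by (rule someI_ex)
  show ?thesis
  proof
    show "c (x \<oplus>\<^bsub>M\<^esub> y) b = c x b + c y b" if xy: "x \<in> carrier M" "y \<in> carrier M" for x y b
      by (rule rep_unique[OF c rep_add[OF c c]]) (use xy in auto)
    show "c (r \<odot>\<^bsub>M\<^esub> x) b = r * c x b" if x: "x \<in> carrier M" for r x b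
      by (rule rep_unique[OF c rep_smult[OF c]]) (use x in auto)
    show "x = \<zero>\<^bsub>M\<^esub>" if x: "x \<in> carrier M" and 0: "\<And>b. c x b = 0" for x
    proof -
      obtain A where A: "A \<subseteq> B" "x = lincomb (c x) A" using c[OF x] unfolding rep_def by blast
      have "lincomb (c x) A = (\<Oplus>\<^bsub>M\<^esub> b \<in> A. \<zero>\<^bsub>M\<^esub>)"
        unfolding lincomb_def 0 using A(1) BM null by (intro M.finsum_cong') auto
      then show ?thesis using A(2) by simp
    qed
  qed
qed

section \<open>Common denominators\<close>

definition fmat :: "(nat \<Rightarrow> nat \<Rightarrow> 'r::idom) \<Rightarrow> nat \<Rightarrow> nat \<Rightarrow> 'r fract"
  where "fmat a = (\<lambda>i j. to_fract (a i j))"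

lemma fmat_apply: "fmat a i j = to_fract (a i j)"
  by (simp add: fmat_def)

lemma fmat_inj: "fmat a = fmat b \<Longrightarrow> a = b"
  by (rule matrix_eqI) (metis fmat_apply to_fract_eq_iff)

lemma fmat_ops:
  "fmat (a + b) = fmat a + fmat b" "fmat (msc r a) = msc (to_fract r) (fmat a)"
  "fmat (mact g a) = mact g (fmat a)" "fmat 0 = 0"
  by (rule matrix_eqI, simp add: fmat_apply msc_apply mact_apply)+

lemma to_fract_sum: "to_fract (\<Sum>x \<in> A. h x) = (\<Sum>x \<in> A. to_fract (h x))"
  by (induction A rule: infinite_finite_induct) simp_all

lemma fmat_alt_iff: "fmat a \<in> alt_set n \<longleftrightarrow> a \<in> alt_set n"
proof
  assume a: "fmat a \<in> alt_set n"
  show "a \<in> alt_set n"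
  proof (rule alt_setI)
    fix i j
    have "to_fract (a i j) = to_fract (- a j i)"
      using alt_setD(1)[OF a, of i j] by (simp only: fmat_apply to_fract_uminus)
    then show "a i j = - a j i" by (simp only: to_fract_eq_iff)
    have "to_fract (a i i) = to_fract 0" using alt_setD(2)[OF a, of i] by (simp only: fmat_apply to_fract_0)
    then show "a i i = 0" by simp
    show "a i j = 0" if "i \<notin> {1..n}"
    proof -
      have "to_fract (a i j) = to_fract 0" using alt_setD(3)[OF a that, of j] by (simp only: fmat_apply to_fract_0)
      then show ?thesis by simp
    qed
    have "to_fract (\<Sum>j = 1..n. a i j) = to_fract 0"
      using alt_setD(5)[OF a, of i] by (simp only: fmat_apply to_fract_0 to_fract_sum)
    then show "(\<Sum>j = 1..n. a i j) = 0" by (simp only: to_fract_eq_iff)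
  qed
next
  assume a: "a \<in> alt_set n"
  show "fmat a \<in> alt_set n"
  proof (rule alt_setI)
    fix i j
    show "fmat a i j = - fmat a j i"
      unfolding fmat_apply to_fract_uminus[symmetric] by (subst alt_setD(1)[OF a]) (rule refl)
    show "fmat a i i = 0" by (simp only: fmat_apply alt_setD(2)[OF a] to_fract_0)
    show "fmat a i j = 0" if "i \<notin> {1..n}" by (simp only: fmat_apply alt_setD(3)[OF a that] to_fract_0)
    show "(\<Sum>j = 1..n. fmat a i j) = 0"
      by (simp only: fmat_apply to_fract_sum[symmetric] alt_setD(5)[OF a] to_fract_0)
  qed
qed

lemma common_denominator:
  assumes "finite (F :: 'r::idom fract set)"
  shows "\<exists>d. d \<noteq> 0 \<and> (\<forall>q \<in> F. \<exists>z. to_fract d * q = to_fract z)"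
  using assms
proof (induction F rule: finite_induct)
  case empty
  show ?case by (intro exI[of _ 1]) simp
next
  case (insert q F)
  then obtain d where d: "d \<noteq> 0" "\<And>q. q \<in> F \<Longrightarrow> \<exists>z. to_fract d * q = to_fract z" by blast
  obtain a e where q: "q = Fract a e" "e \<noteq> 0" by (cases q) auto
  have "to_fract (d * e) * q = to_fract (d * a)" using q by (simp add: to_fract_def eq_fract)
  moreover have "\<exists>z. to_fract (d * e) * q' = to_fract z" if q': "q' \<in> F" for q'
  proof -
    obtain z where "to_fract d * q' = to_fract z" using d(2)[OF q'] by blast
    then have "to_fract (d * e) * q' = to_fract (e * z)" by (simp add: mult_ac)
    then show ?thesis by blast
  qed
  moreover have "d * e \<noteq> 0" using d(1) q(2) by simp
  ultimately show ?case by blast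
qed

lemma alt_common_denominator:
  fixes a :: "nat \<Rightarrow> nat \<Rightarrow> 'r::idom fract"
  assumes a: "a \<in> alt_set n"
  obtains d b where "d \<noteq> 0" "b \<in> alt_set n" "msc (to_fract d) a = fmat b"
proof -
  let ?F = "(\<lambda>(i, j). a i j) ` ({1..n} \<times> {1..n})"
  have "finite ?F" by simp
  from common_denominator[OF this] obtain d where d: "d \<noteq> 0"
    and dz: "\<And>q. q \<in> ?F \<Longrightarrow> \<exists>z. to_fract d * q = to_fract z" by blast
  have "\<exists>z. to_fract d * a i j = to_fract z" for i j
  proof (cases "i \<in> {1..n} \<and> j \<in> {1..n}")
    case True
    then show ?thesis using dz by force
  next
    case False
    then have "a i j = 0" using alt_setD(3,4)[OF a] by metis
    then show ?thesis by (metis mult_zero_right to_fract_0)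
  qed
  then obtain b where b: "\<And>i j. to_fract d * a i j = to_fract (b i j)" by metis
  have eq: "msc (to_fract d) a = fmat b"
    by (rule matrix_eqI) (simp only: msc_apply fmat_apply b)
  have "fmat b \<in> alt_set n" unfolding eq[symmetric] using a by (rule alt_set_msc)
  then show ?thesis using that d eq fmat_alt_iff by metis
qed

section \<open>Equivariant embeddings into rational matrices\<close>

text \<open>Serves both directions: for a given lattice of matrices \<open>L\<close> is the
  inclusion, for an abstract form it is x -> 1 \<otimes> x followed by the given
  isomorphism.\<close>

locale rat_embedding = scalar_extension "sym_group n" M
  for n :: nat and M :: "('r::idom, nat \<Rightarrow> nat, 'm) gmod" +
  fixes L :: "'m \<Rightarrow> nat \<Rightarrow> nat \<Rightarrow> 'r fract"
  assumes L_closed: "x \<in> carrier M \<Longrightarrow> L x \<in> alt_set n"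
    and L_add: "x \<in> carrier M \<Longrightarrow> y \<in> carrier M \<Longrightarrow> L (x \<oplus>\<^bsub>M\<^esub> y) = L x + L y"
    and L_smult: "x \<in> carrier M \<Longrightarrow> L (r \<odot>\<^bsub>M\<^esub> x) = msc (to_fract r) (L x)"
    and L_act: "g \<in> carrier (sym_group n) \<Longrightarrow> x \<in> carrier M \<Longrightarrow> L (act M g x) = mact g (L x)"
    and L_inj: "inj_on L (carrier M)"
begin

lemma L_zero: "L \<zero>\<^bsub>M\<^esub> = 0"
  using L_add[OF M.M.zero_closed M.M.zero_closed] by simp

text \<open>The isomorphism sends q \<otimes> x to q times \<open>L x\<close>. By
  \<open>fraction_form\<close> its injectivity reduces to that of \<open>L\<close>, and
  \<open>L_full\<close> gives surjectivity.\<close>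

lemma extend_iso_alt:
  assumes L_full: "\<And>a. a \<in> alt_set n \<Longrightarrow> \<exists>r x. r \<noteq> 0 \<and> x \<in> carrier M \<and> msc (to_fract r) a = L x"
  shows "gmod_iso class_ring (sym_group n) (extend_scalars M) (alt_mod n)"
proof -
  define h where "h = (\<lambda>(q, x) r. msc (to_fract r * q) (L x))"
  have h: "h (q, x) r = msc (to_fract r * q) (L x)" for q x r by (simp add: h_def)
  have h_add: "h p (r + s) = h p r + h p s" for p r s
    by (cases p) (simp only: h to_fract_add distrib_right msc_add_left)
  define P where "P = free_ext h"
  interpret P: free_extension h rewrites "free_ext h = P"
    by unfold_locales (simp_all only: h_add P_def)
  have P_single: "P (sing q x r) = msc (to_fract r * q) (L x)" for q x r
    by (simp only: P.ext_single h)
  have h_msc: "h p (r * s) = msc (to_fract r) (h p s)" for p r s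
    by (cases p) (simp only: h msc_simps to_fract_mult mult.assoc)
  have P_K: "P f = 0" if "f \<in> KK" for f
    using that
  proof (induction f rule: K_induct)
    case (rel f)
    then show ?case unfolding P_def
      by (rule bilinear_rels_free_ext[OF P.free_extension_axioms, rotated -1])
        (simp_all only: h fract_mod_simps to_fract_1 distrib_right mult_1_left msc_add msc_add_left
          msc_simps L_add L_smult, simp only: mult.commute)
  next
    case (scale r f)
    have "P (Poly_Mapping.map ((*) r) f) = msc (to_fract r) (P f)"
      by (rule P.ext_scale) (simp_all only: msc_add h_msc)
    then show ?case using scale by (simp only: msc_simps)
  qed (simp_all only: P.ext_zero P.ext_add add_0)
  have P_closed: "P f \<in> alt_set n" if "Poly_Mapping.keys f \<subseteq> QM" for f
    using that by (rule P.ext_mem) (auto simp: h intro!: alt_set_zero alt_set_add alt_set_msc L_closed)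
  have P_eq_0: "f \<in> KK" if keys: "Poly_Mapping.keys f \<subseteq> QM" and 0: "P f = 0" for f
  proof -
    obtain d m where dm: "d \<noteq> 0" "m \<in> carrier M" "f - sing (Fract 1 d) m 1 \<in> KK"
      using fraction_form[OF keys] by blast
    have "msc (Fract 1 d) (L m) = 0"
      using P_K[OF dm(3)] 0 by (simp only: P.ext_diff P_single to_fract_1 mult_1_left) simp
    then have "msc (to_fract d) (msc (Fract 1 d) (L m)) = 0" by (simp only: msc_simps)
    moreover have "to_fract d * Fract 1 d = 1" using dm(1) by (simp add: to_fract_def One_fract_def eq_fract)
    ultimately have "L m = 0" by (simp only: msc_simps)
    then have "m = \<zero>\<^bsub>M\<^esub>" using L_inj L_zero dm(2) M.M.zero_closed by (metis inj_onD)
    then have "sing (Fract 1 d) m 1 \<in> KK" using K_zero_right by blast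
    from K_add[OF dm(3) this] show ?thesis by simp
  qed
  define E where "E = descend P"
  have E_cls: "E (cls f) = P f" for f
    unfolding E_def
  proof (rule descend_cls)
    fix f g assume "f - g \<in> KK"
    from P_K[OF this] show "P f = P g" by (simp only: P.ext_diff) simp
  qed
  have map_P: "P (free_map (\<lambda>(a, x). (q * a, x)) f) = msc q (P f)" for q f
  proof (rule P.ext_free_map[OF subset_UNIV])
    show "h (case p of (a, x) \<Rightarrow> (q * a, x)) r = msc q (h p r)" for p r
      by (cases p) (simp only: prod.case h msc_simps mult.left_commute)
  qed (rule msc_add)
  have act_P: "P (free_map (\<lambda>(a, x). (a, act M g x)) f) = mact g (P f)"
    if g: "g \<in> carrier (sym_group n)" and f: "Poly_Mapping.keys f \<subseteq> QM" for g f
    using f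
  proof (rule P.ext_free_map)
    show "h (case p of (a, x) \<Rightarrow> (a, act M g x)) r = mact g (h p r)" if "p \<in> QM" for p r
      using that by (cases p) (simp only: prod.case h mact_simps mem_Sigma_iff L_act[OF g])
  qed (rule mact_simps)
  have "gmod_hom class_ring (sym_group n) (extend_scalars M) (alt_mod n) E"
  proof (rule gmod_homI)
    fix x assume "x \<in> carrier (extend_scalars M)"
    then obtain f where f: "x = cls f" "Poly_Mapping.keys f \<subseteq> QM" unfolding extend_carrier by blast
    show "E x \<in> carrier (alt_mod n)" using P_closed[OF f(2)] by (simp only: f(1) E_cls alt_mod_simps)
    show "E (r \<odot>\<^bsub>extend_scalars M\<^esub> x) = r \<odot>\<^bsub>alt_mod n\<^esub> E x" for r
      by (simp only: f(1) extend_smult E_cls map_P alt_mod_simps)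
    show "E (act (extend_scalars M) g x) = act (alt_mod n) g (E x)" if "g \<in> carrier (sym_group n)" for g
      by (simp only: f(1) extend_act[OF that] E_cls act_P[OF that f(2)] alt_mod_simps)
    show "E (x \<oplus>\<^bsub>extend_scalars M\<^esub> y) = E x \<oplus>\<^bsub>alt_mod n\<^esub> E y" if y: "y \<in> carrier (extend_scalars M)" for y
    proof -
      obtain g where "y = cls g" using y unfolding extend_carrier by blast
      then show ?thesis by (simp only: f(1) extend_add E_cls P.ext_add alt_mod_simps)
    qed
  qed
  moreover have "bij_betw E (carrier (extend_scalars M)) (carrier (alt_mod n))"
    unfolding bij_betw_def
  proof
    show "inj_on E (carrier (extend_scalars M))"
    proof
      fix x y assume x: "x \<in> carrier (extend_scalars M)" and y: "y \<in> carrier (extend_scalars M)" and eq: "E x = E y"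
      obtain f where f: "x = cls f" "Poly_Mapping.keys f \<subseteq> QM" using x unfolding extend_carrier by blast
      obtain g where g: "y = cls g" "Poly_Mapping.keys g \<subseteq> QM" using y unfolding extend_carrier by blast
      have "P (f - g) = 0" using eq by (simp only: f g E_cls P.ext_diff) simp
      from P_eq_0[OF keys_diff_subset[OF f(2) g(2)] this] show "x = y" by (simp only: f g cls_eq_iff)
    qed
    show "E ` carrier (extend_scalars M) = carrier (alt_mod n)"
    proof
      show "E ` carrier (extend_scalars M) \<subseteq> carrier (alt_mod n)"
      proof
        fix a assume "a \<in> E ` carrier (extend_scalars M)"
        then obtain f where "a = E (cls f)" "Poly_Mapping.keys f \<subseteq> QM" unfolding extend_carrier by blast
        then show "a \<in> carrier (alt_mod n)" using P_closed[of f] by (simp only: E_cls alt_mod_simps)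
      qed
      show "carrier (alt_mod n) \<subseteq> E ` carrier (extend_scalars M)"
      proof
        fix a :: "nat \<Rightarrow> nat \<Rightarrow> 'r fract" assume "a \<in> carrier (alt_mod n)"
        then obtain r x where rx: "r \<noteq> 0" "x \<in> carrier M" "msc (to_fract r) a = L x"
          using L_full by (simp only: alt_mod_simps) blast
        have "msc (Fract 1 r) (L x) = msc (Fract 1 r * to_fract r) a"
          unfolding rx(3)[symmetric] by (simp only: msc_simps)
        moreover have "Fract 1 r * to_fract r = 1" using rx(1) by (simp add: to_fract_def One_fract_def eq_fract)
        ultimately have "a = P (sing (Fract 1 r) x 1)"
          by (simp only: P_single to_fract_1 mult_1_left msc_simps)
        moreover have "Poly_Mapping.keys (sing (Fract 1 r) x (1 :: 'r)) \<subseteq> QM"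
          using rx(2) by (intro keys_single_subset) (simp add: fract_mod_simps)
        ultimately show "a \<in> E ` carrier (extend_scalars M)"
          unfolding extend_carrier image_image E_cls by blast
      qed
    qed
  qed
  ultimately show ?thesis by (auto simp: gmod_iso_iff)
qed

text \<open>Finitely many generators have finitely many matrix entries, and the elements made
  integral by a fixed \<open>d\<close> form a submodule.\<close>

lemma integral_multiple:
  assumes "fin_gen class_ring M"
  obtains d where "d \<noteq> 0" "\<And>x. x \<in> carrier M \<Longrightarrow> \<exists>b. msc (to_fract d) (L x) = fmat b"
proof -
  obtain Y where Y: "finite Y" "Y \<subseteq> carrier M" "M.span Y = carrier M"
    using assms unfolding fin_gen_def by blast
  let ?F = "(\<lambda>(x, i, j). L x i j) ` (Y \<times> {1..n} \<times> {1..n})"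
  have "finite ?F" using Y(1) by simp
  from common_denominator[OF this] obtain d where d: "d \<noteq> 0"
    and dF: "\<And>q. q \<in> ?F \<Longrightarrow> \<exists>z. to_fract d * q = to_fract z" by blast
  define I where "I = {x \<in> carrier M. \<exists>b. msc (to_fract d) (L x) = fmat b}"
  have "LinearCombinations.submodule class_ring I M"
    unfolding LinearCombinations.submodule_def
  proof (intro conjI allI impI)
    show "Module.module class_ring M" by (rule gmodule.axioms(1)[OF M.gmodule_axioms])
    show "I \<subseteq> carrier M" by (auto simp: I_def)
    show "\<zero>\<^bsub>M\<^esub> \<in> I"
      unfolding I_def using L_zero by (auto intro!: exI[of _ 0] simp only: msc_simps fmat_ops mem_Collect_eq M.M.zero_closed)
    fix v assume "v \<in> I"
    then obtain a where a: "msc (to_fract d) (L v) = fmat a" "v \<in> carrier M" unfolding I_def by blast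
    show "v \<oplus>\<^bsub>M\<^esub> w \<in> I" if "w \<in> I" for w
    proof -
      obtain b where b: "msc (to_fract d) (L w) = fmat b" "w \<in> carrier M" using \<open>w \<in> I\<close> unfolding I_def by blast
      have "msc (to_fract d) (L (v \<oplus>\<^bsub>M\<^esub> w)) = fmat (a + b)" by (simp only: a b L_add msc_add fmat_ops)
      then show ?thesis unfolding I_def using a b by blast
    qed
    show "c \<odot>\<^bsub>M\<^esub> v \<in> I" for c
    proof -
      have "msc (to_fract d) (L (c \<odot>\<^bsub>M\<^esub> v)) = msc (to_fract c) (msc (to_fract d) (L v))"
        by (simp only: L_smult[OF a(2)] msc_simps mult.commute)
      then have "msc (to_fract d) (L (c \<odot>\<^bsub>M\<^esub> v)) = fmat (msc c a)" by (simp only: a fmat_ops)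
      then show ?thesis unfolding I_def using a M.smult_closed[of c v] by auto
    qed
  qed
  moreover have "Y \<subseteq> I"
  proof
    fix x assume x: "x \<in> Y"
    then have xM: "x \<in> carrier M" using Y(2) by blast
    have "\<exists>z. to_fract d * L x i j = to_fract z" for i j
    proof (cases "i \<in> {1..n} \<and> j \<in> {1..n}")
      case True
      then have "L x i j \<in> ?F" using x by force
      then show ?thesis by (rule dF)
    next
      case False
      then have "L x i j = 0" using alt_setD(3,4)[OF L_closed[OF xM]] by metis
      then show ?thesis by (metis mult_zero_right to_fract_0)
    qed
    then obtain b where "\<And>i j. to_fract d * L x i j = to_fract (b i j)" by metis
    then have "msc (to_fract d) (L x) = fmat b" by (intro matrix_eqI) (simp only: msc_apply fmat_apply)
    then show "x \<in> I" unfolding I_def using xM by blast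
  qed
  ultimately have "M.span Y \<subseteq> I" by (rule M.span_is_subset[rotated])
  then show ?thesis using that d unfolding Y(3) I_def by blast
qed

text \<open>The factor \<open>q\<close> is a fraction, so that clearing denominators and dividing by
  a power of 2 are done in one step.\<close>

lemma integral_model:
  assumes "q \<noteq> 0" and f: "\<And>x. x \<in> carrier M \<Longrightarrow> msc q (L x) = fmat (f x)"
  shows "gmod_hom class_ring (sym_group n) M (alt_mod n) f" and "inj_on f (carrier M)"
proof -
  have eqI: "f x = b" if "x \<in> carrier M" "msc q (L x) = fmat b" for x b
    by (rule fmat_inj) (simp only: f[OF that(1), symmetric] that(2))
  show "gmod_hom class_ring (sym_group n) M (alt_mod n) f"
  proof (rule gmod_homI)
    fix x assume x: "x \<in> carrier M"
    show "f x \<in> carrier (alt_mod n)"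
      using alt_set_msc[OF L_closed[OF x], of q] by (simp only: f[OF x] fmat_alt_iff alt_mod_simps)
    show "f (x \<oplus>\<^bsub>M\<^esub> y) = f x \<oplus>\<^bsub>alt_mod n\<^esub> f y" if y: "y \<in> carrier M" for y
      by (rule eqI) (simp_all only: alt_mod_simps M.M.a_closed x y L_add msc_add f fmat_ops)
    show "f (r \<odot>\<^bsub>M\<^esub> x) = r \<odot>\<^bsub>alt_mod n\<^esub> f x" for r
    proof (rule eqI)
      have "msc q (L (r \<odot>\<^bsub>M\<^esub> x)) = msc (to_fract r) (msc q (L x))"
        by (simp only: L_smult[OF x] msc_simps mult.commute)
      then show "msc q (L (r \<odot>\<^bsub>M\<^esub> x)) = fmat (r \<odot>\<^bsub>alt_mod n\<^esub> f x)"
        by (simp only: f[OF x] fmat_ops alt_mod_simps)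
    qed (use x in simp)
    show "f (act M g x) = act (alt_mod n) g (f x)" if g: "g \<in> carrier (sym_group n)" for g
      by (rule eqI[OF gmodule_closed(3)[OF M.gmodule_axioms g x]])
        (simp only: alt_mod_simps L_act[OF g x] mact_simps(4)[symmetric] f[OF x] fmat_ops)
  qed
  show "inj_on f (carrier M)"
  proof
    fix x y assume x: "x \<in> carrier M" and y: "y \<in> carrier M" and eq: "f x = f y"
    have "msc q (L x) = msc q (L y)" by (simp only: f[OF x] f[OF y] eq)
    then have "msc (inverse q * q) (L x) = msc (inverse q * q) (L y)" by (simp only: msc_simps(5)[symmetric])
    then have "L x = L y" using assms(1) by simp
    then show "x = y" using L_inj x y by (metis inj_onD)
  qed
qed

end

text \<open>The map \<open>L\<close> sends \<open>x\<close> to the matrix of \<open>1 \<otimes> x\<close>.\<close>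

lemma extend_iso_altE:
  fixes M :: "('r::idom, nat \<Rightarrow> nat, 'm) gmod"
  assumes M: "gmodule class_ring (sym_group n) M" and B: "is_basis class_ring M B" and n: "n \<ge> 3"
    and iso: "gmod_iso class_ring (sym_group n) (extend_scalars M) (alt_mod n)"
  obtains L where "rat_embedding n M L" "\<exists>x \<in> carrier M. L x \<noteq> 0"
proof -
  interpret scalar_extension "sym_group n" M by (rule scalar_extension.intro[OF M])
  obtain E where hom: "gmod_hom class_ring (sym_group n) (extend_scalars M) (alt_mod n) E"
    and bij: "bij_betw E (carrier (extend_scalars M)) (carrier (alt_mod n))"
    using iso by (auto simp: gmod_iso_iff)
  note E = gmod_homD[OF hom, unfolded alt_mod_simps]
  define L where "L x = E (unit_cls x)" for x
  have "rat_embedding n M L"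
  proof
    fix x assume x: "x \<in> carrier M"
    show "L x \<in> alt_set n"
      unfolding L_def by (rule E(1)[OF unit_cls(1)[OF x]])
    show "L (x \<oplus>\<^bsub>M\<^esub> y) = L x + L y" if y: "y \<in> carrier M" for y
      unfolding L_def unit_cls(2)[OF x y] by (rule E(2)[OF unit_cls(1)[OF x] unit_cls(1)[OF y]])
    show "L (r \<odot>\<^bsub>M\<^esub> x) = msc (to_fract r) (L x)" for r
      unfolding L_def unit_cls(3)[OF x] by (rule E(3)[OF _ unit_cls(1)[OF x]]) simp
    show "L (act M g x) = mact g (L x)" if g: "g \<in> carrier (sym_group n)" for g
      unfolding L_def unit_cls(4)[OF x g] by (rule E(4)[OF g unit_cls(1)[OF x]])
  next
    show "inj_on L (carrier M)"
    proof
      fix x y assume x: "x \<in> carrier M" and y: "y \<in> carrier M" and eq: "L x = L y"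
      show "x = y"
      \<comment> \<open>Here the basis of \<open>M\<close> enters: without coordinate functionals, a
        nonzero element might vanish in the tensor product.\<close>
      proof (rule basis_functionals[OF gmodule.axioms(1)[OF M] B])
        fix c :: "'m \<Rightarrow> 'm \<Rightarrow> 'r"
        assume c: "\<And>x y b. x \<in> carrier M \<Longrightarrow> y \<in> carrier M \<Longrightarrow> c (x \<oplus>\<^bsub>M\<^esub> y) b = c x b + c y b"
          "\<And>r x b. x \<in> carrier M \<Longrightarrow> c (r \<odot>\<^bsub>M\<^esub> x) b = r * c x b"
          "\<And>x. x \<in> carrier M \<Longrightarrow> (\<And>b. c x b = 0) \<Longrightarrow> x = \<zero>\<^bsub>M\<^esub>"
        have "unit_cls x = unit_cls y"
          using bij eq unit_cls(1)[OF x] unit_cls(1)[OF y] unfolding L_def bij_betw_def by (metis inj_onD)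
        then have xy: "sing 1 x 1 - sing 1 y 1 \<in> KK" by (simp only: unit_cls_def cls_eq_iff)
        let ?m = "(- 1) \<odot>\<^bsub>M\<^esub> y"
        have m: "?m \<in> carrier M" using y by simp
        have "sing 1 (x \<oplus>\<^bsub>M\<^esub> ?m) 1 - (sing 1 x 1 + sing 1 ?m 1) \<in> KK"
          using x m by (intro K_add_right) (simp_all add: fract_mod_simps)
        moreover have "sing 1 ?m 1 - sing 1 y (- 1) \<in> KK"
          using K_smult_right[of 1 y "- 1" 1] y by (simp only: fract_mod_simps UNIV_I mult_1_left)
        \<comment> \<open>The three relations telescope to 1 \<otimes> (x - y), with
          \<open>?m\<close> in the place of -y.\<close>
        ultimately have "(sing 1 (x \<oplus>\<^bsub>M\<^esub> ?m) 1 - (sing 1 x 1 + sing 1 ?m 1)) + (sing 1 ?m 1 - sing 1 y (- 1)) +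
            (sing 1 x 1 - sing 1 y 1) \<in> KK" using xy by (intro K_add)
        then have "sing 1 (x \<oplus>\<^bsub>M\<^esub> ?m) 1 \<in> KK" by (simp add: single_uminus)
        then have "c (x \<oplus>\<^bsub>M\<^esub> ?m) b = 0" for b
          by (rule functional_KK[where c = "\<lambda>x. c x b", rotated 2]) (rule c; assumption)+
        then have "x \<oplus>\<^bsub>M\<^esub> ?m = \<zero>\<^bsub>M\<^esub>" using x m by (intro c(3)) auto
        moreover have "y \<oplus>\<^bsub>M\<^esub> ?m = \<zero>\<^bsub>M\<^esub>" by (rule c(3)) (use y m in \<open>simp_all add: c\<close>)
        ultimately show "x = y" using x y m by (metis M.M.add.right_cancel)
      qed
    qed
  qed
  moreover have "\<exists>x \<in> carrier M. L x \<noteq> 0"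
  proof (rule ccontr)
    assume "\<not> ?thesis"
    then have 0: "L x = 0" if "x \<in> carrier M" for x using that by blast
    \<comment> \<open>A nonzero rational matrix is the image of some 1/d \<otimes> m, hence a
      multiple of \<open>L m\<close>, so \<open>L\<close> cannot vanish identically.\<close>
    have "tri 1 2 3 \<in> alt_set n" using n by (intro tri_alt) auto
    then have "tri 1 2 3 \<in> E ` carrier (extend_scalars M)" using bij by (simp add: bij_betw_def)
    then obtain z where z: "z \<in> carrier (extend_scalars M)" "tri 1 2 3 = E z" by blast
    obtain d m where dm: "m \<in> carrier M" "z = Fract 1 d \<odot>\<^bsub>extend_scalars M\<^esub> unit_cls m"
      using unit_cls_span[OF z(1)] by blast
    have "E z = msc (Fract 1 d) (L m)"
      unfolding dm(2) L_def by (rule E(3)[OF _ unit_cls(1)[OF dm(1)]]) simp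
    then have "tri 1 2 3 = (0 :: nat \<Rightarrow> nat \<Rightarrow> 'r fract)" unfolding z(2) 0[OF dm(1)] by (simp only: msc_simps)
    then have "tri 1 2 3 1 2 = (0 :: 'r fract)" by (simp only: zero_matrix_apply)
    then show False by (simp add: tri_def arc_def)
  qed
  ultimately show ?thesis by (rule that)
qed

section \<open>The forms of the rational Specht module\<close>

lemma specht_iso_alt:
  "n \<ge> 1 \<Longrightarrow> gmod_iso class_ring (sym_group n) (specht n) (alt_mod n :: ('r::comm_ring_1, _, _) gmod)"
  by (rule specht_quotient.specht_iso[OF specht_quotient.intro])

lemma specht_is_gmodule:
  "n \<ge> 1 \<Longrightarrow> gmodule class_ring (sym_group n)
    (specht n :: ('r::comm_ring_1, nat \<Rightarrow> nat, ((nat \<Rightarrow>\<^sub>0 'r) \<times> (nat \<Rightarrow>\<^sub>0 'r) \<Rightarrow>\<^sub>0 'r) set) gmod)"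
  by (rule specht_quotient.specht_gmodule[OF specht_quotient.intro])

text \<open>Since 2 S lies in \<open>X\<close>, every rational matrix has a nonzero multiple in
  \<open>X\<close>, so the rational span of \<open>X\<close> is the whole module.\<close>

lemma form_of_lattice:
  fixes M :: "(z2adic, nat \<Rightarrow> nat, 'm) gmod"
  assumes n: "n \<ge> 1" and M: "gmodule class_ring (sym_group n) M" and X: "inv_lattice n X"
    and two: "\<And>b. b \<in> alt_set n \<Longrightarrow> msc 2 b \<in> X"
    and iso: "gmod_iso class_ring (sym_group n) M (sublat n X)"
    and coords: "\<exists>e c. coordinates (sublat n X) (specht_idx n) e c"
  shows "is_Z2_form (sym_group n) (specht n) M"
  unfolding is_Z2_form_def
proof (intro conjI)
  interpret M: gmodule class_ring "sym_group n" M by (rule M)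
  obtain e c where "coordinates (sublat n X) (specht_idx n) e c" using coords by blast
  from coordinates_transport[OF this gmodule.axioms(1)[OF M] iso] obtain e c
    where "coordinates M (specht_idx n) e c" by blast
  then interpret c: coordinates M "specht_idx n" e c .
  show "gmodule class_ring (sym_group n) M" by (rule M)
  show "fin_gen class_ring M" by (rule c.fin_gen_e)
  show "\<exists>B. is_basis class_ring M B" using c.is_basis_e by blast
  obtain f where f: "gmod_hom class_ring (sym_group n) M (sublat n X) f" "bij_betw f (carrier M) X"
    using iso by (auto simp: gmod_iso_iff)
  note h = gmod_homD[OF f(1), simplified]
  interpret rat_embedding n M "\<lambda>x. fmat (f x)"
  proof
    show "inj_on (\<lambda>x. fmat (f x)) (carrier M)"
      using f(2) by (auto intro!: inj_onI dest!: fmat_inj simp: bij_betw_def dest: inj_onD)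
  qed (simp_all only: h fmat_ops fmat_alt_iff latticeD(1)[OF X h(1)])
  have "gmod_iso class_ring (sym_group n) (extend_scalars M) (alt_mod n)"
  proof (rule extend_iso_alt)
    fix a :: "nat \<Rightarrow> nat \<Rightarrow> q2adic" assume a: "a \<in> alt_set n"
    obtain d b where db: "d \<noteq> 0" "b \<in> alt_set n" "msc (to_fract d) a = fmat b"
      using alt_common_denominator[OF a] .
    have "msc 2 b \<in> f ` carrier M" using two[OF db(2)] f(2) by (simp add: bij_betw_def)
    then obtain x where x: "x \<in> carrier M" "msc 2 b = f x" by blast
    have "msc (to_fract (2 * d)) a = fmat (f x)"
      unfolding x(2)[symmetric] fmat_ops db(3)[symmetric] by (simp only: msc_simps to_fract_mult)
    then show "\<exists>r x. r \<noteq> 0 \<and> x \<in> carrier M \<and> msc (to_fract r) a = fmat (f x)"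
      using db(1) x(1) two_z2adic_nonzero by (intro exI[of _ "2 * d"] exI[of _ x]) simp
  qed
  then show "gmod_iso class_ring (sym_group n) (extend_scalars M) (specht n)"
    by (rule gmod_iso_trans) (rule gmod_iso_sym[OF specht_is_gmodule[OF n] specht_iso_alt[OF n]])
qed

text \<open>A nonzero 2-adic integer has bounded 2-divisibility, so some power of 2 fails to divide
  all of \<open>Z\<close>. The least such exponent is positive, as \<open>2 ^ 0\<close> divides
  everything, and \<open>k\<close> is its predecessor.\<close>

lemma two_power_scaling:
  fixes Z :: "z2adic set"
  assumes "z \<in> Z" "z \<noteq> 0"
  obtains k where "\<forall>x \<in> Z. 2 ^ k dvd x" "\<exists>x \<in> Z. \<not> 2 ^ Suc k dvd x"
proof -
  let ?P = "\<lambda>k. \<exists>x \<in> Z. \<not> 2 ^ k dvd x"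
  have ex: "\<exists>k. ?P k" using z2adic_bounded_two_power_dvd[OF assms(2)] assms(1) by blast
  define k where "k = (LEAST k. ?P k)"
  have k: "?P k" unfolding k_def using ex by (rule LeastI_ex)
  then have "k \<noteq> 0" by (intro notI) simp
  then obtain l where l: "k = Suc l" using not0_implies_Suc by blast
  then have "\<not> ?P l" using not_less_Least[of l ?P] unfolding k_def by simp
  then show ?thesis using that[of l] k l by blast
qed

lemma form_classification:
  fixes M :: "(z2adic, nat \<Rightarrow> nat, 'm) gmod"
  assumes n: "n \<ge> 5" "odd n" and form: "is_Z2_form (sym_group n) (specht n) M"
  shows "\<exists>X \<in> {alt_set n, alt1 n, alt2 n}. gmod_iso class_ring (sym_group n) M (sublat n X)"
proof -
  have M: "gmodule class_ring (sym_group n) M" and fg: "fin_gen class_ring M"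
    and "\<exists>B. is_basis class_ring M B"
    and iso: "gmod_iso class_ring (sym_group n) (extend_scalars M) (specht n)"
    using form unfolding is_Z2_form_def by blast+
  then obtain B where B: "is_basis class_ring M B" by blast
  have n1: "n \<ge> 1" and n3: "n \<ge> 3" using n by simp_all
  have iso': "gmod_iso class_ring (sym_group n) (extend_scalars M) (alt_mod n)"
    by (rule gmod_iso_trans[OF iso specht_iso_alt[OF n1]])
  obtain L where L: "rat_embedding n M L" "\<exists>x \<in> carrier M. L x \<noteq> 0"
    using extend_iso_altE[OF M B n3 iso'] .
  interpret rat_embedding n M L by (rule L(1))
  obtain d where d: "d \<noteq> 0" and int: "\<And>x. x \<in> carrier M \<Longrightarrow> \<exists>b. msc (to_fract d) (L x) = fmat b"
    using integral_multiple[OF fg] by blast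
  obtain F where "\<And>x. x \<in> carrier M \<Longrightarrow> msc (to_fract d) (L x) = fmat (F x)"
    using int by metis
  then have F: "to_fract (F x i j) = to_fract d * L x i j" if "x \<in> carrier M" for x i j
    using that by (metis fmat_apply msc_apply)
  obtain x0 where x0: "x0 \<in> carrier M" "L x0 \<noteq> 0" using L(2) by blast
  then obtain i0 j0 where ij0: "L x0 i0 j0 \<noteq> 0" by (metis matrix_eqI zero_matrix_apply)
  \<comment> \<open>All entries of all matrices in the integral image: dividing by their common
    power of 2 produces an odd entry, as \<open>lattice_classification\<close> requires.\<close>
  define Z where "Z = {F x i j | x i j. x \<in> carrier M}"
  have "F x0 i0 j0 \<noteq> 0" using F[OF x0(1), of i0 j0] d ij0 by (metis mult_eq_0_iff to_fract_0 to_fract_eq_iff)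
  moreover have "F x0 i0 j0 \<in> Z" unfolding Z_def using x0(1) by blast
  ultimately obtain k where k: "\<forall>z \<in> Z. 2 ^ k dvd z" "\<exists>z \<in> Z. \<not> 2 ^ Suc k dvd z"
    using two_power_scaling by metis
  define p where "p = (2 :: z2adic) ^ k"
  have p: "p \<noteq> 0" using two_z2adic_nonzero by (simp add: p_def)
  have "\<exists>c. F x i j = p * c" if "x \<in> carrier M" for x i j
    using k(1) that unfolding Z_def p_def dvd_def by blast
  then obtain f where f: "\<And>x i j. x \<in> carrier M \<Longrightarrow> F x i j = p * f x i j" by metis
  have "msc (Fract d p) (L x) = fmat (f x)" if x: "x \<in> carrier M" for x
  proof (rule matrix_eqI)
    fix i j
    have "Fract d p = Fract 1 p * to_fract d" by (simp add: to_fract_def)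
    then have "Fract d p * L x i j = Fract 1 p * to_fract (p * f x i j)"
      by (simp only: mult.assoc F[OF x, symmetric] f[OF x])
    then show "msc (Fract d p) (L x) i j = fmat (f x) i j"
      using p by (simp only: msc_apply fmat_apply) (simp add: to_fract_def eq_fract)
  qed
  moreover have "Fract d p \<noteq> 0" using d p by (simp add: Zero_fract_def eq_fract)
  ultimately have hom: "gmod_hom class_ring (sym_group n) M (alt_mod n) f" and inj: "inj_on f (carrier M)"
    using integral_model[of "Fract d p" f] by blast+
  note h = gmod_homD[OF hom, simplified]
  define X where "X = f ` carrier M"
  have "gmod_hom class_ring (sym_group n) M (sublat n X) f"
    by (rule gmod_homI) (simp_all add: X_def h)
  moreover have "bij_betw f (carrier M) X" using inj by (simp add: bij_betw_def X_def)
  ultimately have isoX: "gmod_iso class_ring (sym_group n) M (sublat n X)"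
    unfolding gmod_iso_iff by auto
  have X: "inv_lattice n X"
    unfolding inv_lattice_def
  proof (intro conjI ballI allI impI)
    show "X \<subseteq> alt_set n" using h(1) by (auto simp: X_def)
    have "f \<zero>\<^bsub>M\<^esub> = 0" using h(2)[OF M.M.zero_closed M.M.zero_closed] by simp
    then show "0 \<in> X" unfolding X_def by (metis M.M.zero_closed imageI)
    fix a assume "a \<in> X"
    then obtain x where x: "x \<in> carrier M" "a = f x" by (auto simp: X_def)
    show "a + b \<in> X" if b: "b \<in> X" for b
    proof -
      obtain y where y: "y \<in> carrier M" "b = f y" using b by (auto simp: X_def)
      then show ?thesis unfolding X_def x(2) y(2) h(2)[OF x(1) y(1), symmetric]
        by (intro imageI M.M.a_closed x y)
    qed
    show "msc r a \<in> X" for r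
      unfolding X_def x(2) h(3)[OF x(1), symmetric] using x(1) by (intro imageI M.smult_closed) simp_all
    show "mact g a \<in> X" if "g permutes {1..n}" for g
    proof -
      have g: "g \<in> carrier (sym_group n)" using that by (simp add: sym_group_carrier)
      show ?thesis unfolding X_def x(2) h(4)[OF g x(1), symmetric]
        by (intro imageI gmodule_closed(3)[OF M g x(1)])
    qed
  qed
  obtain x i j where x: "x \<in> carrier M" "\<not> 2 ^ Suc k dvd F x i j" using k(2) unfolding Z_def by blast
  have "\<not> 2 dvd f x i j"
  proof
    assume "2 dvd f x i j"
    then have "2 * 2 ^ k dvd p * f x i j" unfolding p_def by (subst mult.commute) (rule mult_dvd_mono; simp)
    then show False using x(2) f[OF x(1)] by simp
  qed
  then have "X = alt_set n \<or> X = alt1 n \<or> X = alt2 n"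
    using x(1) by (intro lattice_classification[OF n X, of "f x"]) (auto simp: X_def)
  with isoX show ?thesis by blast
qed

lemma alt_mod_sublat: "sublat n (alt_set n) = alt_mod n"
  by (simp add: alt_mod_def)

theorem theorem7p10:
  fixes n :: nat
    and S S1 S2 :: "(z2adic, nat \<Rightarrow> nat,
      ((nat \<Rightarrow>\<^sub>0 z2adic) \<times> (nat \<Rightarrow>\<^sub>0 z2adic) \<Rightarrow>\<^sub>0 z2adic) set) gmod"
    and b :: "nat \<times> nat \<Rightarrow> ((nat \<Rightarrow>\<^sub>0 z2adic) \<times> (nat \<Rightarrow>\<^sub>0 z2adic) \<Rightarrow>\<^sub>0 z2adic) set"
    and V :: "(q2adic, nat \<Rightarrow> nat,
      ((nat \<Rightarrow>\<^sub>0 q2adic) \<times> (nat \<Rightarrow>\<^sub>0 q2adic) \<Rightarrow>\<^sub>0 q2adic) set) gmod"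
  assumes "n \<ge> 5" and "odd n"
    and "S = specht n" and "b = specht_b n"
    and "S1 = S\<lparr>carrier := S1_set n\<rparr>"
    and "S2 = S\<lparr>carrier := S2_set n\<rparr>"
    and "V = specht n"
  shows "(inj_on b (specht_idx n) \<and> is_basis class_ring S (b ` specht_idx n)) \<and>
    gsublattice class_ring (sym_group n) S (carrier S1) \<and>
    gsublattice class_ring (sym_group n) S (carrier S2) \<and>
    (is_Z2_form (sym_group n) V S \<and>
     is_Z2_form (sym_group n) V S1 \<and>
     is_Z2_form (sym_group n) V S2) \<and>
    (\<not> gmod_iso class_ring (sym_group n) S S1 \<and>
     \<not> gmod_iso class_ring (sym_group n) S S2 \<and>
     \<not> gmod_iso class_ring (sym_group n) S1 S2) \<and>
    (\<forall>M :: (z2adic, nat \<Rightarrow> nat, 'm) gmod. is_Z2_form (sym_group n) V M \<longrightarrow>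
      gmod_iso class_ring (sym_group n) M S \<or>
      gmod_iso class_ring (sym_group n) M S1 \<or>
      gmod_iso class_ring (sym_group n) M S2)"
proof -
  note n = assms(1,2)
  have n1: "n \<ge> 1" using n by simp
  interpret q: specht_quotient n "bilinear_rels (nat_specht n) (nat_specht n) \<union>
      {Poly_Mapping.single (x, x) (1 :: z2adic) | x. x \<in> carrier (nat_specht n)}" "ext2_kernel (nat_specht n)"
    by (rule specht_quotient.intro[OF n1])
  let ?m = q.mat_of
  note hom = q.mat_of_hom and bij = q.mat_of_bij
  interpret C: coordinates "specht n" "specht_idx n" "specht_b n" "\<lambda>x. coord (?m x)"
    by (rule q.specht_coordinates)
  have S: "gmodule class_ring (sym_group n) S" unfolding assms(3) by (rule q.specht_gmodule)
  have comb: "specht_comb n \<alpha> \<in> carrier (specht n)" "\<And>p. p \<in> specht_idx n \<Longrightarrow> coord (?m (specht_comb n \<alpha>)) p = \<alpha> p"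
    for \<alpha> :: "nat \<times> nat \<Rightarrow> z2adic"
    unfolding specht_comb_def using C.comb_closed C.c_comb by blast+
  have m_alt: "?m x \<in> alt_set n" if "x \<in> carrier (specht n)" for x
    using gmod_homD(1)[OF hom that] by simp
  \<comment> \<open>The matrix of a combination has the coefficients \<alpha> as its coordinates, so
    the condition on \<alpha> is one on the matrix.\<close>
  have S1_eq: "S1_set n = {x \<in> carrier (specht n). ?m x \<in> alt1 n}"
  proof (intro equalityI subsetI)
    fix x assume "x \<in> S1_set n"
    then obtain \<alpha> where a: "x = specht_comb n \<alpha>" "2 dvd (\<Sum>p \<in> specht_idx n. \<alpha> p)" by (auto simp: S1_set_def)
    have "psum n (?m x) = (\<Sum>p \<in> specht_idx n. \<alpha> p)"
      unfolding psum_def a(1) by (rule sum.cong) (simp_all add: comb(2))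
    then show "x \<in> {x \<in> carrier (specht n). ?m x \<in> alt1 n}"
      using a comb(1) m_alt by (simp add: alt1_def)
  next
    fix x assume "x \<in> {x \<in> carrier (specht n). ?m x \<in> alt1 n}"
    then have x: "x \<in> carrier (specht n)" "2 dvd psum n (?m x)" by (auto simp: alt1_def)
    have "x = specht_comb n (coord (?m x))" unfolding specht_comb_def by (rule C.expansion[OF x(1)])
    then show "x \<in> S1_set n" using x(2) unfolding S1_set_def psum_def by blast
  qed
  have last: "(n - 1, n) \<in> specht_idx n" using n by (simp add: specht_idx_iff)
  have S2_eq: "S2_set n = {x \<in> carrier (specht n). ?m x \<in> alt2 n}"
  proof (intro equalityI subsetI)
    fix x assume "x \<in> S2_set n"
    then obtain \<alpha> where a: "x = specht_comb n \<alpha>" "\<And>p. p \<in> specht_idx n \<Longrightarrow> 2 dvd (\<alpha> p - \<alpha> (n - 1, n))"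
      unfolding S2_set_def by blast
    have "2 dvd coord (?m x) p - coord (?m x) (n - 1, n)" if "p \<in> specht_idx n" for p
      unfolding a(1) comb(2)[OF that] comb(2)[OF last] by (rule a(2)[OF that])
    then show "x \<in> {x \<in> carrier (specht n). ?m x \<in> alt2 n}"
      using comb(1) m_alt unfolding a(1) alt2_def by blast
  next
    fix x assume "x \<in> {x \<in> carrier (specht n). ?m x \<in> alt2 n}"
    then have x: "x \<in> carrier (specht n)" "\<forall>p \<in> specht_idx n. 2 dvd coord (?m x) p - coord (?m x) (n - 1, n)"
      unfolding alt2_def by blast+
    have "x = specht_comb n (coord (?m x))" unfolding specht_comb_def by (rule C.expansion[OF x(1)])
    then show "x \<in> S2_set n" using x(2) unfolding S2_set_def by blast
  qed
  \<comment> \<open>Invariance of both sublattices and their matrix models are pulled back along the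
    isomorphism \<open>?m\<close>.\<close>
  note pre = gsublattice_preimage[OF q.specht_gmodule alt_mod_gmodule hom bij gsublattice_lattice]
  have sub1: "gsublattice class_ring (sym_group n) S (carrier S1)"
    and iso1: "gmod_iso class_ring (sym_group n) S1 (sublat n (alt1 n))"
    using pre[OF lattice_alt1] unfolding assms(3,5) S1_eq by simp_all
  have sub2: "gsublattice class_ring (sym_group n) S (carrier S2)"
    and iso2: "gmod_iso class_ring (sym_group n) S2 (sublat n (alt2 n))"
    using pre[OF lattice_alt2[OF n]] unfolding assms(3,6) S2_eq by simp_all
  have iso: "gmod_iso class_ring (sym_group n) S (sublat n (alt_set n))"
    unfolding alt_mod_sublat assms(3) by (rule q.specht_iso)
  have S1: "gmodule class_ring (sym_group n) S1" and S2: "gmodule class_ring (sym_group n) S2"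
    using gmodule_gsublattice[OF S sub1] gmodule_gsublattice[OF S sub2] by (simp_all add: assms(5,6))
  have two1: "msc 2 a \<in> alt1 n" if "a \<in> alt_set n" for a
    using that by (simp add: alt1_def alt_set_msc psum_simps)
  have "is_Z2_form (sym_group n) V S"
    unfolding assms(7)
  proof (rule form_of_lattice[OF n1 S lattice_alt _ iso])
    show "\<exists>e c. coordinates (sublat n (alt_set n)) (specht_idx n) e c"
      unfolding alt_mod_sublat using alt_coordinates by blast
  qed (rule alt_set_msc)
  moreover have "is_Z2_form (sym_group n) V S1"
    unfolding assms(7)
    by (rule form_of_lattice[OF n1 S1 lattice_alt1 two1 iso1 alt1_coordinates[OF n(1)]])
  moreover have "is_Z2_form (sym_group n) V S2"
    unfolding assms(7)
    by (rule form_of_lattice[OF n1 S2 lattice_alt2[OF n] _ iso2 alt2_coordinates[OF n]])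
      (simp add: alt2_def alt_set_msc two_dvd_diff_iff)
  moreover have "\<not> gmod_iso class_ring (sym_group n) S S1"
    using not_iso_alt_alt1[OF n(1)] gmod_iso_trans[OF gmod_iso_trans[OF gmod_iso_sym[OF S iso]] iso1] by blast
  moreover have "cyc 1 2 3 4 \<in> alt_set n" "cyc 1 2 3 4 \<in> alt1 n"
    using n by (intro cyc_alt cyc_alt1; simp)+
  then have "\<not> gmod_iso class_ring (sym_group n) (sublat n (alt_set n)) (sublat n (alt2 n))"
    "\<not> gmod_iso class_ring (sym_group n) (sublat n (alt1 n)) (sublat n (alt2 n))"
    using two1 by (intro not_iso_alt2[OF n]; simp add: alt_set_msc alt1_def)+
  then have "\<not> gmod_iso class_ring (sym_group n) S S2" "\<not> gmod_iso class_ring (sym_group n) S1 S2"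
    using gmod_iso_trans[OF gmod_iso_trans[OF gmod_iso_sym[OF S iso]] iso2]
      gmod_iso_trans[OF gmod_iso_trans[OF gmod_iso_sym[OF S1 iso1]] iso2] by blast+
  moreover have "gmod_iso class_ring (sym_group n) M S \<or> gmod_iso class_ring (sym_group n) M S1 \<or>
      gmod_iso class_ring (sym_group n) M S2"
    if "is_Z2_form (sym_group n) V M" for M :: "(z2adic, nat \<Rightarrow> nat, 'm) gmod"
    using form_classification[OF n that[unfolded assms(7)]]
      gmod_iso_trans[OF _ gmod_iso_sym[OF S iso]] gmod_iso_trans[OF _ gmod_iso_sym[OF S1 iso1]]
      gmod_iso_trans[OF _ gmod_iso_sym[OF S2 iso2]] by blast
  moreover have "inj_on b (specht_idx n) \<and> is_basis class_ring S (b ` specht_idx n)"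
    unfolding assms(3,4) using C.inj_e C.is_basis_e by blast
  ultimately show ?thesis using sub1 sub2 by blast
qed

end
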